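(* Let $\omega$ be a locally bounded nonnegative function on $(0,\infty)$, and define functions $W^{(\omega)}_n$ on $[0,\infty)$ by \[W^{(\omega)}_0(x)=1,\qquad W^{(\omega)}_{n+1}(x)=\int_x^\infty W(z-x)\,\omega(z)\,W^{(\omega)}_n(z)\,\mathrm{d}z,\quad x\ge0,\ n\ge0.\] Let $b\ge0$. If $\sum_{n=0}^\infty W^{(\omega)}_n(b)<\infty$, then for all $x\ge b$, \[\mathbb{E}_x\left[\exp\left(-\int_0^{\tau_b^-}\omega(Z_s)\,\mathrm{d}s\right);\ \tau_b^-<\infty\right]=\frac{\sum_{n=0}^\infty W^{(\omega)}_n(x)}{\sum_{n=0}^\infty W^{(\omega)}_n(b)}.\]
   Context: Let $\Psi(\lambda)=\gamma\lambda+\frac{\sigma^2}{2}\lambda^2+\int_0^\infty(e^{-\lambda z}-1+\lambda z)\,\pi(\mathrm{d}z)$ for $\lambda\ge0$, with $\gamma\ge0$, $\sigma\ge0$, $\pi$ a measure on $(0,\infty)$ with $\int_0^\infty(z\wedge z^2)\pi(\mathrm{d}z)<\infty$. $Z$ is a spectrally positive Lévy process with $\mathbb{E}[e^{-\lambda Z_1}\mid Z_0=x]=e^{-\lambda x+\Psi(\lambda)}$, and $\mathbb{P}_x,\mathbb{E}_x$ refer to $Z_0=x$. $\tau_b^-=\inf\{t\ge0:Z_t<b\}$. $W$ is the scale function: $W(x)=0$ for $x<0$, $W$ continuous strictly increasing on $[0,\infty)$ with $\int_0^\infty e^{-qy}W(y)\,\mathrm{d}y=1/\Psi(q)$ for $q>0$.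 *)

theory Defs
  imports "HOL-Probability.Probability"
begin

definition Psi :: "real \<Rightarrow> real \<Rightarrow> real measure \<Rightarrow> real \<Rightarrow> real" where
  "Psi \<gamma> \<sigma> \<pi> l = \<gamma> * l + \<sigma>\<^sup>2 / 2 * l\<^sup>2
      + (\<integral>z. (exp (- l * z) - 1 + l * z) \<partial>\<pi>)"

definition levy_process :: "'a measure \<Rightarrow> (real \<Rightarrow> 'a \<Rightarrow> real) \<Rightarrow> bool" where
  "levy_process M Z \<longleftrightarrow>
     prob_space M
   \<and> (\<forall>t\<ge>0. Z t \<in> borel_measurable M)
   \<and> (\<forall>\<omega>\<in>space M. Z 0 \<omega> = 0)
   \<and> (AE \<omega> in M. \<forall>t\<ge>0. continuous (at_right t) (\<lambda>s. Z s \<omega>)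
                      \<and> (t > 0 \<longrightarrow> (\<exists>l. ((\<lambda>s. Z s \<omega>) \<longlongrightarrow> l) (at_left t))))
   \<and> (\<forall>(n::nat) (t::nat \<Rightarrow> real). 0 \<le> t 0 \<and> (\<forall>i<n. t i \<le> t (Suc i)) \<longrightarrow>
        prob_space.indep_vars M (\<lambda>_. borel) (\<lambda>i \<omega>. Z (t (Suc i)) \<omega> - Z (t i) \<omega>) {..<n})
   \<and> (\<forall>s t. 0 \<le> s \<and> 0 \<le> t \<longrightarrow>
        distr M borel (\<lambda>\<omega>. Z (s + t) \<omega> - Z s \<omega>) = distr M borel (Z t))"

definition scale_function :: "(real \<Rightarrow> real) \<Rightarrow> (real \<Rightarrow> real) \<Rightarrow> bool" where
  "scale_function P W \<longleftrightarrow>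
     (\<forall>x<0. W x = 0)
   \<and> continuous_on {0..} W
   \<and> strict_mono_on {0..} W
   \<and> (\<forall>q>0. ((\<lambda>y. exp (- q * y) * W y) has_integral 1 / P q) {0..})"

fun Wom :: "(real \<Rightarrow> real) \<Rightarrow> (real \<Rightarrow> real) \<Rightarrow> nat \<Rightarrow> real \<Rightarrow> ennreal" where
  "Wom W w 0 x = 1"
| "Wom W w (Suc n) x =
     (\<integral>\<^sup>+ z. indicator {x..} z * ennreal (W (z - x) * w z) * Wom W w n z \<partial>lborel)"

definition tau_below :: "(real \<Rightarrow> 'a \<Rightarrow> real) \<Rightarrow> real \<Rightarrow> real \<Rightarrow> 'a \<Rightarrow> ereal" where
  "tau_below Z x b \<omega> = Inf (ereal ` {t. 0 \<le> t \<and> x + Z t \<omega> < b})"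

definition exp_neg_enn :: "ennreal \<Rightarrow> ennreal" where
  "exp_neg_enn I = (if I = \<infinity> then 0 else ennreal (exp (- enn2real I)))"

definition killed_functional ::
    "(real \<Rightarrow> 'a \<Rightarrow> real) \<Rightarrow> (real \<Rightarrow> real) \<Rightarrow> real \<Rightarrow> real \<Rightarrow> 'a \<Rightarrow> ennreal" where
  "killed_functional Z w x b \<omega> =
     (if tau_below Z x b \<omega> < \<infinity> then
        exp_neg_enn (\<integral>\<^sup>+ s\<in>{0..<real_of_ereal (tau_below Z x b \<omega>)}.
                        ennreal (w (x + Z s \<omega>)) \<partial>lborel)
      else 0)"

end

theory Submission
  imports Defs
begin

text \<open>Shift the barrier to \<open>0\<close> and let \<open>U\<close> be the potential operator of the process killed on passing below \<open>0\<close>.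
  Its density is \<open>W y - W (y - z)\<close>, so \<open>h = (\<Sum>n. W\<^sub>n)\<close> satisfies \<open>h + U (\<omega> h) = h 0\<close>.
  With \<open>V\<close> the potential operator of the process killed in addition at rate \<open>\<omega>\<close>, the Markov property gives the resolvent
  identity \<open>V f + V (\<omega> U f) = U f\<close>; for \<open>f = \<omega> h\<close> it reads \<open>h 0 * V \<omega> = U (\<omega> h) = h 0 - h\<close>,
  while pathwise \<open>V \<omega>\<close> is \<open>1\<close> minus the wanted expectation.

  The density of \<open>U\<close> is identified by its Laplace transform. Optional stopping of
  \<open>exp (- q Z\<^sub>t - \<psi> q t)\<close> on dyadic grids gives \<open>E exp (- \<psi> q \<tau>) = exp (- q z)\<close>, because large downward steps of size
  \<open>\<epsilon>\<close> over a time \<open>\<delta>\<close> have probability \<open>o(\<delta>)\<close> (Chernoff bound with \<open>\<psi> r = O(r\<^sup>2)\<close>); the Markov property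
  then yields \<open>U (exp (- q \<cdot>)) z = (1 - exp (- q z)) / \<psi> q\<close>. Only the Markov property at deterministic times is used.\<close>

section \<open>Uniqueness of Laplace transforms\<close>

text \<open>The obstacle is that \<open>M\<close> is an abstract probability space without shift
  operators, and independence is assumed only for finitely many increments. The Markov property is
  therefore stated as an integral identity with an independent copy of the future, and is obtained
  as a limit of functionals of increments on dyadic grids. Such limits see survival up to a
  deterministic time but not the passage time itself, which is why the law of the passage time
  enters through survival probabilities integrated over time; exceptional single times then form
  null sets for \<open>lborel\<close>. Subtraction in \<open>ennreal\<close> is unreliable at
  infinity, so identities are kept additive and cancelled only after a finiteness proof. The
  finiteness behind the resolvent identity comes from the series: \<open>1 \<le> h\<close> and
  \<open>U (\<omega> h) \<le> h 0\<close>. The scale function supplies more than the density of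
  \<open>U\<close>: its transform \<open>1 / \<Psi>\<close> forces \<open>\<Psi> > 0\<close> on the
  positive axis, which makes the discount rates positive and passage almost sure.\<close>

lemma laplace_eqI_finite:
  fixes M N :: "real measure"
  assumes "finite_measure M" and "finite_measure N" and M: "sets M = sets borel" and N: "sets N = sets borel"
    and nnM: "AE y in M. 0 \<le> y" and nnN: "AE y in N. (0::real) \<le> y"
    and eq: "\<And>n::nat. (\<integral>y. exp (- y) ^ n \<partial>M) = (\<integral>y. exp (- y) ^ n \<partial>N)"
  shows "M = N"
proof -
  interpret finite_measure M by fact
  interpret N: finite_measure N by fact
  note [measurable_cong] = M N
  have int_pow: "integrable M (\<lambda>y. exp (- y) ^ n)" "integrable N (\<lambda>y. exp (- y) ^ n)" for n :: nat
  proof -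
    show "integrable M (\<lambda>y. exp (- y) ^ n)"
      by (rule integrable_const_bound[where B = 1]) (use nnM in \<open>auto simp: power_le_one\<close>)
    show "integrable N (\<lambda>y. exp (- y) ^ n)"
      by (rule N.integrable_const_bound[where B = 1]) (use nnN in \<open>auto simp: power_le_one\<close>)
  qed
  \<comment> \<open>With \<open>s = exp (- y)\<close> in \<open>{0..1}\<close> the hypothesis
    becomes equality of all moments in \<open>s\<close>, hence of the integrals of all polynomials
    in \<open>s\<close>.\<close>
  have poly: "integrable M (\<lambda>y. g (exp (- y))) \<and> integrable N (\<lambda>y. g (exp (- y)))
      \<and> (\<integral>y. g (exp (- y)) \<partial>M) = (\<integral>y. g (exp (- y)) \<partial>N)"
    if g: "real_polynomial_function g" for g :: "real \<Rightarrow> real"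
  proof -
    obtain a n where "g = (\<lambda>x. \<Sum>i\<le>n. a i * x ^ i)"
      using g by (auto simp: real_polynomial_function_iff_sum)
    then show ?thesis
      using int_pow by (simp add: eq)
  qed
  have cont: "(\<integral>y. f (exp (- y)) \<partial>M) = (\<integral>y. f (exp (- y)) \<partial>N)"
    if f: "continuous_on UNIV f" and bd: "\<And>s. \<bar>f s\<bar> \<le> 1" for f :: "real \<Rightarrow> real"
  proof (rule ccontr)
    have fm[measurable]: "f \<in> borel_measurable borel"
      using f by (rule borel_measurable_continuous_onI)
    have ifM: "integrable M (\<lambda>y. f (exp (- y)))"
      by (rule integrable_const_bound[where B = 1]) (use bd in auto)
    have ifN: "integrable N (\<lambda>y. f (exp (- y)))"
      by (rule N.integrable_const_bound[where B = 1]) (use bd in auto)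
    define d where "d = \<bar>(\<integral>y. f (exp (- y)) \<partial>M) - (\<integral>y. f (exp (- y)) \<partial>N)\<bar>"
    \<comment> \<open>With uniform error \<open>d / (K + 1)\<close> on \<open>{0..1}\<close> the two
      approximation errors add up to at most \<open>d * (K / (K + 1)) < d\<close>, whatever the
      total masses.\<close>
    define K where "K = measure M (space M) + measure N (space N)"
    assume "\<not> ?thesis"
    then have d: "d > 0" by (simp add: d_def)
    have K: "K \<ge> 0" by (simp add: K_def)
    have "d / (K + 1) > 0" using d K by simp
    then obtain g where g: "real_polynomial_function g"
      "\<And>s. s \<in> {0..1} \<Longrightarrow> \<bar>f s - g s\<bar> < d / (K + 1)"
      using Stone_Weierstrass_real_polynomial_function[of "{0..1::real}" f "d / (K + 1)"]
        continuous_on_subset[OF f subset_UNIV] by auto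
    note pg = poly[OF g(1)]
    have bM: "\<bar>(\<integral>y. f (exp (- y)) \<partial>M) - (\<integral>y. g (exp (- y)) \<partial>M)\<bar> \<le> d / (K + 1) * measure M (space M)"
    proof -
      have "\<bar>(\<integral>y. f (exp (- y)) - g (exp (- y)) \<partial>M)\<bar> \<le> (\<integral>y. \<bar>f (exp (- y)) - g (exp (- y))\<bar> \<partial>M)"
        by (rule integral_abs_bound)
      also have "\<dots> \<le> (\<integral>y. d / (K + 1) \<partial>M)"
        using nnM ifM pg g(2) by (intro integral_mono_AE) (auto elim!: eventually_mono intro!: less_imp_le)
      finally show ?thesis
        using ifM pg by (simp add: mult.commute)
    qed
    have bN: "\<bar>(\<integral>y. f (exp (- y)) \<partial>N) - (\<integral>y. g (exp (- y)) \<partial>N)\<bar> \<le> d / (K + 1) * measure N (space N)"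
    proof -
      have "\<bar>(\<integral>y. f (exp (- y)) - g (exp (- y)) \<partial>N)\<bar> \<le> (\<integral>y. \<bar>f (exp (- y)) - g (exp (- y))\<bar> \<partial>N)"
        by (rule integral_abs_bound)
      also have "\<dots> \<le> (\<integral>y. d / (K + 1) \<partial>N)"
        using nnN ifN pg g(2) by (intro integral_mono_AE) (auto elim!: eventually_mono intro!: less_imp_le)
      finally show ?thesis
        using ifN pg by (simp add: mult.commute)
    qed
    have "d \<le> d / (K + 1) * measure M (space M) + d / (K + 1) * measure N (space N)"
      using bM bN pg unfolding d_def by linarith
    also have "\<dots> = d * (K / (K + 1))"
      by (simp add: K_def add_divide_distrib distrib_left)
    also have "\<dots> < d * 1"
      using d K by (intro mult_strict_left_mono) auto
    finally show False by simp
  qed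
  have meas: "measure M {a<..} = measure N {a<..}" for a
  proof -
    \<comment> \<open>A continuous ramp in \<open>s\<close> that vanishes for
      \<open>s \<ge> exp (- a)\<close> and increases to 1 below it; as a function of
      \<open>y\<close> it approximates the indicator of the open ray.\<close>
    define f where "f n s = max 0 (min 1 (real n * (exp (- a) - s)))" for n :: nat and s
    have fc: "continuous_on UNIV (f n)" for n
      unfolding f_def by (intro continuous_intros)
    have fb: "\<bar>f n s\<bar> \<le> 1" for n s by (auto simp: f_def)
    have [measurable]: "f n \<in> borel_measurable borel" for n
      by (rule borel_measurable_continuous_onI[OF fc])
    have lim: "(\<lambda>n. f n (exp (- y))) \<longlonglongrightarrow> indicator {a<..} y" for y
    proof (cases "y > a")
      case True
      then have e: "exp (- a) - exp (- y) > 0" by simp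
      obtain n0 :: nat where n0: "1 / (exp (- a) - exp (- y)) < n0"
        using reals_Archimedean2 by blast
      have "f n (exp (- y)) = 1" if "n \<ge> n0" for n
      proof -
        have "1 / (exp (- a) - exp (- y)) \<le> real n" using n0 that by linarith
        then have "1 \<le> real n * (exp (- a) - exp (- y))" using e by (simp add: pos_divide_le_eq)
        then show ?thesis by (simp add: f_def)
      qed
      then have "eventually (\<lambda>n. f n (exp (- y)) = 1) sequentially"
        by (auto simp: eventually_sequentially)
      then show ?thesis using True by (simp add: tendsto_eventually)
    next
      case False
      then have le: "real n * (exp (- a) - exp (- y)) \<le> 0" for n
        by (intro mult_nonneg_nonpos) auto
      have "f n (exp (- y)) = 0" for n
        using le[of n] by (simp add: f_def)
      then show ?thesis using False by simp
    qed
    have "(\<lambda>n. \<integral>y. f n (exp (- y)) \<partial>M) \<longlonglongrightarrow> (\<integral>y. indicator {a<..} y \<partial>M)"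
      by (rule integral_dominated_convergence[where w = "\<lambda>_. 1"]) (use lim fb in auto)
    moreover have "(\<lambda>n. \<integral>y. f n (exp (- y)) \<partial>N) \<longlonglongrightarrow> (\<integral>y. indicator {a<..} y \<partial>N)"
      by (rule integral_dominated_convergence[where w = "\<lambda>_. 1"]) (use lim fb in auto)
    ultimately have "(\<integral>y. indicator {a<..} y \<partial>M) = (\<integral>y. (indicator {a<..} y :: real) \<partial>N)"
      using cont[OF fc fb] LIMSEQ_unique by auto
    then show ?thesis by (simp add: M N)
  qed
  show ?thesis
    by (rule measure_eqI_lessThan) (simp_all add: M N meas emeasure_eq_measure N.emeasure_eq_measure)
qed

text \<open>The weight \<open>exp (- y)\<close> makes both measures finite, by the transform at 1,
  and moves index \<open>n\<close> to \<open>Suc n\<close>, so positive integers suffice. The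
  density \<open>exp y\<close> removes it again. Potential measures, for which this form is made,
  can have infinite mass.\<close>

lemma laplace_eqI:
  fixes M N :: "real measure"
  assumes M: "sets M = sets borel" and N: "sets N = sets borel"
    and nnM: "AE y in M. 0 \<le> y" and nnN: "AE y in N. 0 \<le> y"
    and fin: "\<And>n::nat. n > 0 \<Longrightarrow> (\<integral>\<^sup>+ y. ennreal (exp (- (real n * y))) \<partial>M) < \<infinity>"
    and eq: "\<And>n::nat. n > 0 \<Longrightarrow> (\<integral>\<^sup>+ y. ennreal (exp (- (real n * y))) \<partial>M) = (\<integral>\<^sup>+ y. ennreal (exp (- (real n * y))) \<partial>N)"
  shows "M = N"
proof -
  note [measurable_cong] = M N
  define D where "D L = density L (\<lambda>y::real. ennreal (exp (- y)))" for L
  have sD[measurable_cong]: "sets (D M) = sets borel" "sets (D N) = sets borel"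
    by (simp_all add: D_def M N)
  have fm: "finite_measure (D M)" "finite_measure (D N)"
    using fin[of 1] eq[of 1]
    by (auto intro!: finite_measureI simp: D_def emeasure_density
        sets_eq_imp_space_eq[OF M] sets_eq_imp_space_eq[OF N])
  have aeD: "AE y in D M. 0 \<le> y" "AE y in D N. 0 \<le> y"
    using nnM nnN unfolding D_def by (subst AE_density; force)+
  have tr: "(\<integral>\<^sup>+ y. ennreal (exp (- y) ^ n) \<partial>D L) = (\<integral>\<^sup>+ y. ennreal (exp (- (real (Suc n) * y))) \<partial>L)"
    if "sets L = sets borel" for n L
    unfolding D_def
    using that by (subst nn_integral_density)
      (auto simp: ennreal_mult[symmetric] exp_of_nat_mult[symmetric] exp_add[symmetric] algebra_simps
        intro!: nn_integral_cong simp del: ennreal_mult)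
  have "D M = D N"
  proof (rule laplace_eqI_finite[OF fm sD aeD])
    fix n :: nat
    show "(\<integral>y. exp (- y) ^ n \<partial>D M) = (\<integral>y. exp (- y) ^ n \<partial>D N)"
      by (subst (1 2) integral_eq_nn_integral) (simp_all add: tr[OF M] tr[OF N] eq del: of_nat_Suc)
  qed
  moreover have "density (D L) (\<lambda>y. ennreal (exp y)) = L" if L: "sets L = sets borel" for L
  proof -
    have "density (D L) (\<lambda>y. ennreal (exp y)) = density L (\<lambda>y. ennreal (exp (- y)) * ennreal (exp y))"
      unfolding D_def using L by (subst density_density_eq) auto
    also have "\<dots> = L"
      by (simp add: ennreal_mult[symmetric] exp_add[symmetric] density_1)
    finally show ?thesis .
  qed
  ultimately show ?thesis using M N by metis
qed

section \<open>The Laplace exponent and the scale function\<close>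

text \<open>The \<open>min\<close> is the function integrable under \<open>\<pi>\<close>:
  \<open>exp (- u) - 1 + u\<close> is at most both \<open>u\<close> and \<open>u\<^sup>2\<close>,
  and \<open>max 1 r ^ 2\<close> dominates \<open>r\<close> and \<open>r\<^sup>2\<close>
  alike.\<close>

lemma Psi_integrand_bounds:
  fixes r z :: real
  assumes "z > 0" "r \<ge> 0"
  shows "0 \<le> exp (- r * z) - 1 + r * z" "exp (- r * z) - 1 + r * z \<le> max 1 r ^ 2 * min z (z\<^sup>2)"
proof -
  show "0 \<le> exp (- r * z) - 1 + r * z"
    using exp_ge_add_one_self[of "- r * z"] by simp
  define u where "u = r * z"
  have u: "u \<ge> 0" using assms by (simp add: u_def)
  have 1: "exp (- u) - 1 + u \<le> u" using u by simp
  have 2: "exp (- u) - 1 + u \<le> u\<^sup>2"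
  proof -
    have "exp (- u) * (1 + u) \<le> exp (- u) * exp u"
      using exp_ge_add_one_self[of u] by (intro mult_left_mono) auto
    then have "exp (- u) * (1 + u) \<le> 1" by (simp flip: exp_add)
    then have "exp (- u) \<le> 1 / (1 + u)" using u by (simp add: pos_le_divide_eq)
    also have "\<dots> \<le> 1 - u + u\<^sup>2"
    proof -
      \<comment> \<open>The product on the right is \<open>1 + u ^ 3\<close>.\<close>
      have "1 \<le> (1 - u + u\<^sup>2) * (1 + u)"
        using u by (simp add: algebra_simps power2_eq_square)
      then show ?thesis using u by (simp add: pos_divide_le_eq)
    qed
    finally show ?thesis by simp
  qed
  have rm: "r \<le> (max 1 r)\<^sup>2" "r\<^sup>2 \<le> (max 1 r)\<^sup>2"
  proof -
    have "max 1 r * 1 \<le> max 1 r * max 1 r" by (intro mult_left_mono) auto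
    then show "r \<le> (max 1 r)\<^sup>2" by (simp add: power2_eq_square)
    show "r\<^sup>2 \<le> (max 1 r)\<^sup>2" using assms by (intro power_mono) auto
  qed
  have "u \<le> (max 1 r)\<^sup>2 * z" using rm(1) assms by (simp add: u_def mult_right_mono)
  moreover have "u\<^sup>2 \<le> (max 1 r)\<^sup>2 * z\<^sup>2" using rm(2) assms by (simp add: u_def power_mult_distrib mult_right_mono)
  ultimately have "exp (- u) - 1 + u \<le> (max 1 r)\<^sup>2 * z" "exp (- u) - 1 + u \<le> (max 1 r)\<^sup>2 * z\<^sup>2"
    using 1 2 by linarith+
  then show "exp (- r * z) - 1 + r * z \<le> max 1 r ^ 2 * min z (z\<^sup>2)"
    by (simp add: min_def u_def)
qed

text \<open>For \<open>r \<ge> 1\<close> the jump integral is at most \<open>r\<^sup>2\<close> times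
  the integral of \<open>min z (z\<^sup>2)\<close>. Quadratic growth keeps the Chernoff exponent
  bounded when \<open>r\<close> grows like the square root of the number of grid steps per unit of
  time.\<close>

lemma Psi_nonneg_and_quadratic_bound:
  assumes g: "\<gamma> \<ge> 0" and pi[measurable_cong]: "sets \<pi> = sets borel" and pi0: "emeasure \<pi> {..0} = 0"
    and fin: "(\<integral>\<^sup>+ z. ennreal (min z (z\<^sup>2)) \<partial>\<pi>) < \<infinity>"
  shows "r \<ge> 0 \<Longrightarrow> Psi \<gamma> \<sigma> \<pi> r \<ge> 0" and "\<exists>C>0. \<forall>r\<ge>1. Psi \<gamma> \<sigma> \<pi> r \<le> C * r\<^sup>2"
proof -
  have pos: "AE z in \<pi>. 0 < z"
    using pi0 by (intro AE_I[where N = "{..0}"]) (auto simp: pi)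
  have im: "integrable \<pi> (\<lambda>z. min z (z\<^sup>2))"
    by (rule integrableI_nonneg) (use fin pos in \<open>auto elim!: eventually_mono\<close>)
  define I where "I = (\<integral>z. min z (z\<^sup>2) \<partial>\<pi>)"
  have I: "I \<ge> 0" unfolding I_def
    by (rule integral_nonneg_AE) (use pos in \<open>auto elim!: eventually_mono\<close>)
  have lo: "0 \<le> (\<integral>z. (exp (- r * z) - 1 + r * z) \<partial>\<pi>)" if "r \<ge> 0" for r
    by (rule integral_nonneg_AE) (use pos Psi_integrand_bounds(1)[OF _ that] in \<open>auto elim!: eventually_mono\<close>)
  have up: "(\<integral>z. (exp (- r * z) - 1 + r * z) \<partial>\<pi>) \<le> r\<^sup>2 * I" if "r \<ge> 1" for r
  proof -
    have "(\<integral>z. (exp (- r * z) - 1 + r * z) \<partial>\<pi>) \<le> (\<integral>z. r\<^sup>2 * min z (z\<^sup>2) \<partial>\<pi>)"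
    proof (rule integral_mono_AE')
      show "AE z in \<pi>. exp (- r * z) - 1 + r * z \<le> r\<^sup>2 * min z (z\<^sup>2)"
        using pos
      proof eventually_elim
        case (elim z)
        then show ?case using Psi_integrand_bounds(2)[of z r] that by (simp add: max_def)
      qed
      show "AE z in \<pi>. 0 \<le> r\<^sup>2 * min z (z\<^sup>2)"
        using pos by (auto elim!: eventually_mono)
    qed (use im in simp)
    then show ?thesis by (simp add: I_def)
  qed
  show "r \<ge> 0 \<Longrightarrow> Psi \<gamma> \<sigma> \<pi> r \<ge> 0"
    using lo[of r] g by (simp add: Psi_def)
  show "\<exists>C>0. \<forall>r\<ge>1. Psi \<gamma> \<sigma> \<pi> r \<le> C * r\<^sup>2"
  proof (intro exI conjI allI impI)
    \<comment> \<open>The summand 1 makes the constant strictly positive.\<close>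
    show "\<gamma> + \<sigma>\<^sup>2 / 2 + I + 1 > 0" using g I by (simp add: add_nonneg_pos)
    fix r :: real assume r: "r \<ge> 1"
    have "\<gamma> * r \<le> \<gamma> * r\<^sup>2" using r g by (intro mult_left_mono) (auto simp: power2_eq_square)
    then have "Psi \<gamma> \<sigma> \<pi> r \<le> \<gamma> * r\<^sup>2 + \<sigma>\<^sup>2 / 2 * r\<^sup>2 + r\<^sup>2 * I"
      using up[OF r] by (simp add: Psi_def)
    also have "\<dots> \<le> (\<gamma> + \<sigma>\<^sup>2 / 2 + I + 1) * r\<^sup>2"
      by (simp add: algebra_simps)
    finally show "Psi \<gamma> \<sigma> \<pi> r \<le> (\<gamma> + \<sigma>\<^sup>2 / 2 + I + 1) * r\<^sup>2" .
  qed
qed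

text \<open>Bridge from the gauge integral, in which \<open>scale_function\<close> is specified, to
  the nonnegative Lebesgue integral.\<close>

lemma nn_integral_has_integral_nonneg:
  fixes f :: "real \<Rightarrow> real"
  assumes "(f has_integral c) S" "\<And>y. y \<in> S \<Longrightarrow> 0 \<le> f y" "(\<lambda>y. indicator S y * f y) \<in> borel_measurable borel"
  shows "(\<integral>\<^sup>+ y. ennreal (indicator S y * f y) \<partial>lborel) = ennreal c"
proof (rule nn_integral_has_integral_lborel)
  show "((\<lambda>y. indicator S y * f y) has_integral c) UNIV"
  proof -
    have "(\<lambda>y. indicator S y * f y) = (\<lambda>y. if y \<in> S then f y else 0)"
      by (auto simp: indicator_def)
    then show ?thesis using assms(1) has_integral_restrict_UNIV[of S f c] by simp
  qed
qed (use assms in \<open>auto simp: indicator_def\<close>)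

lemma scale_function_measurable:
  assumes "scale_function P W"
  shows "W \<in> borel_measurable borel"
proof -
  have "(\<lambda>y. if y \<in> {0..} then W y else 0) \<in> borel_measurable borel"
    by (rule borel_measurable_continuous_on_if) (use assms in \<open>auto simp: scale_function_def\<close>)
  also have "(\<lambda>y. if y \<in> {0..} then W y else 0) = W"
    using assms by (auto simp: scale_function_def)
  finally show ?thesis .
qed

text \<open>Otherwise \<open>V = W - W 0\<close> would have \<open>q\<close> times its Laplace transform at \<open>q\<close> bounded below by \<open>- W 0 > 0\<close>,
  although this quantity tends to \<open>V 0 = 0\<close> as \<open>q\<close> grows.\<close>

lemma scale_function_nonneg:
  assumes W: "scale_function P W" and P: "\<And>q. q > 0 \<Longrightarrow> P q \<ge> 0"
  shows "W y \<ge> 0"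
proof -
  have [measurable]: "W \<in> borel_measurable borel" by (rule scale_function_measurable[OF W])
  have mono: "W s \<le> W t" if "0 \<le> s" "s \<le> t" for s t
    using W that strict_mono_on_leD[of "{0..}" W s t] by (auto simp: scale_function_def)
  have "W 0 \<ge> 0"
  proof (rule ccontr)
    assume "\<not> W 0 \<ge> 0"
    then have c: "- W 0 > 0" by simp
    \<comment> \<open>Cutting off on the negative axis keeps \<open>V\<close> monotone and
      nonnegative, because \<open>W\<close> increases on \<open>{0..}\<close> and
      \<open>V 0 = 0\<close>.\<close>
    define V where "V y = indicator {0..} y * (W y - W 0)" for y
    have Vm[measurable]: "V \<in> borel_measurable borel" unfolding V_def by measurable
    have V0: "V y \<ge> 0" for y using mono by (auto simp: V_def indicator_def)
    have Vmono: "V s \<le> V t" if "s \<le> t" for s t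
      using that mono by (auto simp: V_def indicator_def)
    have Veq: "indicator {0..} y * (a * V y) = a * V y" for a y by (simp add: V_def indicator_def)
    have lap: "(\<integral>\<^sup>+ y. ennreal (exp (- q * y) * V y) \<partial>lborel) = ennreal (1 / P q - W 0 / q)" if q: "q > 0" for q
    proof -
      have 1: "((\<lambda>y. exp (- q * y) * W y) has_integral 1 / P q) {0..}"
        using W q by (auto simp: scale_function_def)
      have 2: "((\<lambda>y. exp (- q * y)) has_integral 1 / q) {0..}"
        using has_integral_exp_minus_to_infinity[OF q, of 0] by (simp add: field_simps)
      have "((\<lambda>y. exp (- q * y) * V y) has_integral (1 / P q - W 0 / q)) {0..}"
        using has_integral_diff[OF 1 has_integral_mult_right[OF 2, of "W 0"]]
        by (rule has_integral_eq_rhs[OF has_integral_cong[THEN iffD1, rotated]])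
           (auto simp: V_def algebra_simps)
      from nn_integral_has_integral_nonneg[OF this] V0
      have "(\<integral>\<^sup>+ y. ennreal (indicator {0..} y * (exp (- q * y) * V y)) \<partial>lborel) = ennreal (1 / P q - W 0 / q)"
        by simp
      then show ?thesis unfolding Veq .
    qed
    \<comment> \<open>Substituting \<open>y / q\<close> multiplies the transform by \<open>q\<close>
      and gives \<open>q / P q - W 0\<close>. The first term is nonnegative even if
      \<open>P q = 0\<close>, as division by 0 yields 0.\<close>
    have scaled: "(\<integral>\<^sup>+ y. ennreal (exp (- y) * V (y / q)) \<partial>lborel) \<ge> ennreal (- W 0)" if q: "q > 0" for q
    proof -
      have "(\<integral>\<^sup>+ y. ennreal (exp (- q * y) * V y) \<partial>lborel)
          = ennreal (1 / q) * (\<integral>\<^sup>+ y. ennreal (exp (- q * (y / q)) * V (y / q)) \<partial>lborel)"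
        using q by (subst nn_integral_real_affine[where c = "1 / q" and t = 0]) auto
      then have "ennreal (1 / q) * (\<integral>\<^sup>+ y. ennreal (exp (- y) * V (y / q)) \<partial>lborel) = ennreal (1 / P q - W 0 / q)"
        using lap[OF q] q by simp
      then have "ennreal q * ennreal (1 / q) * (\<integral>\<^sup>+ y. ennreal (exp (- y) * V (y / q)) \<partial>lborel)
          = ennreal q * ennreal (1 / P q - W 0 / q)"
        by (simp add: mult.assoc)
      moreover have "ennreal q * ennreal (1 / q) = 1" using q by (simp add: ennreal_mult[symmetric])
      moreover have "ennreal q * ennreal (1 / P q - W 0 / q) = ennreal (q / P q - W 0)"
      proof -
        have "q * (1 / P q - W 0 / q) = q / P q - W 0"
          using q by (simp add: right_diff_distrib)
        moreover have "1 / P q \<ge> 0" "- (W 0 / q) \<ge> 0" using q c P[OF q] by (auto simp: divide_nonpos_pos)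
        then have "1 / P q - W 0 / q \<ge> 0" by linarith
        ultimately show ?thesis using q by (subst ennreal_mult[symmetric]) auto
      qed
      moreover have "q / P q - W 0 \<ge> - W 0" using q P[OF q] by simp
      ultimately show ?thesis by (simp add: ennreal_leI)
    qed
    \<comment> \<open>Along \<open>q = Suc n\<close> the integrands tend to 0, since
      \<open>V\<close> is right-continuous at 0 with value 0. Monotonicity of \<open>V\<close>
      bounds them by the integrand for \<open>q = 1\<close>, whose integral is finite by
      \<open>lap\<close>.\<close>
    have "(\<lambda>n. \<integral>\<^sup>+ y. ennreal (exp (- y) * V (y / real (Suc n))) \<partial>lborel) \<longlonglongrightarrow> (\<integral>\<^sup>+ y. 0 \<partial>(lborel :: real measure))"
    proof (rule nn_integral_dominated_convergence[where w = "\<lambda>y. ennreal (exp (- y) * V y)"])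
      show "(\<integral>\<^sup>+ y. ennreal (exp (- y) * V y) \<partial>lborel) < \<infinity>" using lap[of 1] by simp
      show "AE y in lborel. ennreal (exp (- y) * V (y / real (Suc j))) \<le> ennreal (exp (- y) * V y)" for j
      proof (rule AE_I2)
        fix y :: real
        have "V (y / real (Suc j)) \<le> V y"
        proof (cases "y \<ge> 0")
          case True
          then have "y / real (Suc j) \<le> y / 1" by (intro divide_left_mono) auto
          then show ?thesis by (intro Vmono) simp
        next
          case False
          then have "y / real (Suc j) < 0" by (simp add: divide_neg_pos)
          then show ?thesis using False by (simp add: V_def)
        qed
        then show "ennreal (exp (- y) * V (y / real (Suc j))) \<le> ennreal (exp (- y) * V y)"
          by (intro ennreal_leI mult_left_mono) auto
      qed
      show "AE y in lborel. (\<lambda>i. ennreal (exp (- y) * V (y / real (Suc i)))) \<longlonglongrightarrow> 0"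
      proof (rule AE_I2)
        fix y :: real
        have "(\<lambda>i. V (y / real (Suc i))) \<longlonglongrightarrow> 0"
        proof (cases "y \<ge> 0")
          case True
          have "(\<lambda>i. y / real (Suc i)) \<longlonglongrightarrow> 0" by real_asymp
          moreover have "continuous_on {0..} W" using W by (simp add: scale_function_def)
          ultimately have "(\<lambda>i. W (y / real (Suc i))) \<longlonglongrightarrow> W 0"
            using True by (intro continuous_on_tendsto_compose[where f = W]) auto
          then have "(\<lambda>i. W (y / real (Suc i)) - W 0) \<longlonglongrightarrow> 0" by (simp add: LIM_zero)
          then show ?thesis using True by (simp add: V_def)
        next
          case False
          then have "V (y / real (Suc i)) = 0" for i
            using divide_neg_pos[of y "real (Suc i)"] by (simp add: V_def indicator_def del: of_nat_Suc)
          then show ?thesis by simp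
        qed
        then have "(\<lambda>i. exp (- y) * V (y / real (Suc i))) \<longlonglongrightarrow> exp (- y) * 0" by (intro tendsto_intros)
        from tendsto_ennrealI[OF this]
        show "(\<lambda>i. ennreal (exp (- y) * V (y / real (Suc i)))) \<longlonglongrightarrow> 0" by simp
      qed
    qed (auto simp del: of_nat_Suc)
    then have "ennreal (- W 0) \<le> (\<integral>\<^sup>+ y. 0 \<partial>(lborel :: real measure))"
      by (rule LIMSEQ_le_const) (use scaled in \<open>auto simp del: of_nat_Suc\<close>)
    then show False using c by simp
  qed
  then show ?thesis
    using mono[of 0 y] W by (cases "y \<ge> 0") (auto simp: scale_function_def)
qed

text \<open>Strict positivity of \<open>P\<close> is read off from \<open>W\<close>:
  \<open>P q = 0\<close> would give the transform the value \<open>1 / 0 = 0\<close>, although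
  \<open>W\<close> is positive on the positive axis.\<close>

lemma scale_function_laplace:
  assumes W: "scale_function P W" and P: "\<And>q. q > 0 \<Longrightarrow> P q \<ge> 0" and q: "q > 0"
  shows "(\<integral>\<^sup>+ y. ennreal (exp (- q * y) * W y) \<partial>lborel) = ennreal (1 / P q)" and "P q > 0"
proof -
  have [measurable]: "W \<in> borel_measurable borel" by (rule scale_function_measurable[OF W])
  note nn = scale_function_nonneg[OF W P]
  have ind: "indicator {0..} y * (a * W y) = a * W y" for a y
    using W by (auto simp: indicator_def scale_function_def)
  show lap: "(\<integral>\<^sup>+ y. ennreal (exp (- q * y) * W y) \<partial>lborel) = ennreal (1 / P q)"
    using nn_integral_has_integral_nonneg[of "\<lambda>y. exp (- q * y) * W y" "1 / P q" "{0..}"] W q nn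
    unfolding ind by (auto simp: scale_function_def)
  have pos: "W y > 0" if "y > 0" for y
    using W nn[of 0] that strict_mono_onD[of "{0..}" W 0 y] by (force simp: scale_function_def)
  show "P q > 0"
  proof (rule ccontr)
    assume "\<not> P q > 0"
    then have "P q = 0" using P[OF q] by simp
    then have "(\<integral>\<^sup>+ y. ennreal (exp (- q * y) * W y) \<partial>lborel) = 0" using lap by simp
    then have "AE y in lborel. ennreal (exp (- q * y) * W y) = 0"
      by (rule nn_integral_0_iff_AE[THEN iffD1, rotated]) measurable
    then have "AE y in lborel. (y::real) \<notin> {0<..<1}"
    proof eventually_elim
      case (elim y)
      then have "\<not> W y > 0" by (auto simp: ennreal_eq_0_iff mult_le_0_iff)
      then show ?case using pos[of y] by auto
    qed
    then have "emeasure lborel {0<..<1::real} = 0"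
      by (subst (asm) AE_iff_measurable[where N = "{0<..<1}"]) auto
    then show False by simp
  qed
qed

section \<open>Markov property of right-continuous Levy processes\<close>

text \<open>Normal form of the process: every path is right-continuous and negative times carry the
  value 0, so that \<open>Z\<close> is jointly measurable in time and path on the whole real line.
  \<open>levy_process_regular_version\<close> supplies it.\<close>

locale rc_levy = prob_space M for M :: "'a measure" +
  fixes Z :: "real \<Rightarrow> 'a \<Rightarrow> real"
  assumes Z_meas: "\<And>t. Z t \<in> borel_measurable M"
    and Z_0: "\<And>\<omega>. \<omega> \<in> space M \<Longrightarrow> Z 0 \<omega> = 0"
    and Z_neg: "\<And>t \<omega>. t < 0 \<Longrightarrow> Z t \<omega> = 0"
    and Z_rc: "\<And>t \<omega>. \<omega> \<in> space M \<Longrightarrow> t \<ge> 0 \<Longrightarrow> continuous (at_right t) (\<lambda>s. Z s \<omega>)"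
    and Z_indep: "\<And>(n::nat) t. 0 \<le> t 0 \<Longrightarrow> (\<And>i. i < n \<Longrightarrow> t i \<le> t (Suc i)) \<Longrightarrow>
        indep_vars (\<lambda>_. borel) (\<lambda>i \<omega>. Z (t (Suc i)) \<omega> - Z (t i) \<omega>) {..<n}"
    and Z_stat: "\<And>s t. 0 \<le> s \<Longrightarrow> 0 \<le> t \<Longrightarrow>
        distr M borel (\<lambda>\<omega>. Z (s + t) \<omega> - Z s \<omega>) = distr M borel (Z t)"
begin

section \<open>Dyadic approximation from the right and joint measurability\<close>

lemma Z_tendsto_from_right:
  assumes "\<omega> \<in> space M" "t \<ge> 0" "\<And>n. t \<le> X n" "X \<longlonglongrightarrow> t"
  shows "(\<lambda>n. Z (X n) \<omega>) \<longlonglongrightarrow> Z t \<omega>"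
proof -
  \<comment> \<open>The sequence may hit \<open>t\<close>, which \<open>at_right t\<close> excludes;
    within \<open>{t..}\<close> the filter is the same and sequential continuity applies.\<close>
  have "{t..} - {t} = {t<..} - {t}" by auto
  then have "at t within {t..} = at_right t" by (simp add: at_within_def)
  then have "continuous (at t within {t..}) (\<lambda>s. Z s \<omega>)" using Z_rc[OF assms(1,2)] by simp
  then show ?thesis
    by (rule continuous_within_tendsto_compose') (use assms in auto)
qed

text \<open>Adding 1 after the floor places the dyadic point on the right of \<open>r\<close>, the
  side on which paths are continuous. It may leave a given time interval, whence the
  \<open>min\<close> with \<open>s\<close> below.\<close>

definition grid_up :: "nat \<Rightarrow> real \<Rightarrow> real" where
  "grid_up n r = (of_int \<lfloor>2 ^ n * r\<rfloor> + 1) / 2 ^ n"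

lemma grid_up: "r \<le> grid_up n r" "(\<lambda>n. grid_up n r) \<longlonglongrightarrow> r"
proof -
  have lo: "r \<le> grid_up n r" for n
  proof -
    have "2 ^ n * r \<le> of_int \<lfloor>2 ^ n * r\<rfloor> + 1" by linarith
    then show ?thesis by (simp add: grid_up_def field_simps)
  qed
  have hi: "grid_up n r \<le> r + (1/2) ^ n" for n
  proof -
    have "of_int \<lfloor>2 ^ n * r\<rfloor> + 1 \<le> 2 ^ n * r + 1" by linarith
    then have "grid_up n r \<le> (2 ^ n * r + 1) / 2 ^ n" unfolding grid_up_def by (intro divide_right_mono) auto
    also have "\<dots> = r + (1/2) ^ n" by (simp add: add_divide_distrib power_one_over)
    finally show ?thesis .
  qed
  show "r \<le> grid_up n r" by (rule lo)
  have "(\<lambda>n. r + (1/2) ^ n) \<longlonglongrightarrow> r"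
    using tendsto_add[OF tendsto_const LIMSEQ_power_zero[of "1/2 :: real"], of r] by simp
  then show "(\<lambda>n. grid_up n r) \<longlonglongrightarrow> r"
    by (rule tendsto_sandwich[OF _ _ tendsto_const[of r], rotated -1]) (use lo hi in auto)
qed

text \<open>Dyadic fractions of the interval length rather than dyadic numbers, to match the equal
  subdivisions that carry the increments. Strictness of \<open>r < s\<close> gives
  \<open>K n \<le> 2 ^ n\<close>, so the approximating times stay in the interval.\<close>

lemma grid_approx:
  assumes "0 \<le> r" "r < s"
  obtains X K where "\<And>n. K n \<le> (2 :: nat) ^ n" "\<And>n. X n = s * real (K n) / 2 ^ n" "\<And>n. r \<le> X n" "X \<longlonglongrightarrow> r"
proof -
  have s: "s > 0" using assms by simp
  define X where "X n = s * grid_up n (r / s)" for n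
  define K where "K n = nat (\<lfloor>2 ^ n * (r / s)\<rfloor> + 1)" for n
  have K: "K n \<le> 2 ^ n \<and> real (K n) = of_int \<lfloor>2 ^ n * (r / s)\<rfloor> + 1" for n
  proof -
    have "0 \<le> 2 ^ n * (r / s)" using s assms by simp
    then have k0: "\<lfloor>2 ^ n * (r / s)\<rfloor> + 1 \<ge> 0" by (simp only: zero_le_floor add_nonneg_nonneg zero_le_one)
    have "2 ^ n * (r / s) < 2 ^ n * 1" using assms s by (intro mult_strict_left_mono) auto
    then have "\<lfloor>2 ^ n * (r / s)\<rfloor> < 2 ^ n" by (simp only: floor_less_iff) simp
    then show ?thesis using k0 by (simp add: K_def nat_le_iff)
  qed
  show ?thesis
  proof
    show "X n = s * real (K n) / 2 ^ n" for n using K[of n] by (simp add: X_def grid_up_def)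
    show "r \<le> X n" for n
      using grid_up(1)[of "r / s" n] s by (simp add: X_def field_simps)
    have "X \<longlonglongrightarrow> s * (r / s)" unfolding X_def by (intro tendsto_intros grid_up)
    then show "X \<longlonglongrightarrow> r" using s by simp
  qed (use K in auto)
qed

text \<open>Progressive measurability. \<open>N\<close> is left open because the lemma serves both
  the full space and the past at time \<open>s\<close>.\<close>

lemma Z_stopped_joint_measurable:
  assumes sp: "space N = space M" and s: "s \<ge> 0"
    and meas: "\<And>r. 0 \<le> r \<Longrightarrow> r \<le> s \<Longrightarrow> Z r \<in> borel_measurable N"
  shows "(\<lambda>(r, \<omega>). Z (min s r) \<omega>) \<in> borel_measurable (borel \<Otimes>\<^sub>M N)"
proof -
  define f where "f n = (\<lambda>(r, \<omega>). if r < 0 then 0 else Z (min s (grid_up n r)) \<omega>)" for n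
  have "f n \<in> borel_measurable (borel \<Otimes>\<^sub>M N)" for n
  proof -
    \<comment> \<open>For fixed \<open>n\<close> the time depends on \<open>fst x\<close> only
      through an integer, so measurability follows by a countable case distinction.\<close>
    have "(\<lambda>x. Z (max 0 (min s ((of_int \<lfloor>2 ^ n * (fst x :: real)\<rfloor> + 1) / 2 ^ n))) (snd x))
       \<in> borel_measurable (borel \<Otimes>\<^sub>M N)"
    proof (rule measurable_compose_countable[where g = "\<lambda>x. \<lfloor>2 ^ n * (fst x :: real)\<rfloor>"
          and f = "\<lambda>k x. Z (max 0 (min s ((of_int k + 1) / 2 ^ n))) (snd x)"])
      fix k :: int
      have "Z (max 0 (min s ((of_int k + 1) / 2 ^ n))) \<in> borel_measurable N"
        using s by (intro meas) auto
      then show "(\<lambda>x. Z (max 0 (min s ((of_int k + 1) / 2 ^ n))) (snd x)) \<in> borel_measurable (borel \<Otimes>\<^sub>M N)"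
        by measurable
    qed measurable
    then have "(\<lambda>x. if fst x < 0 then 0 else Z (max 0 (min s (grid_up n (fst x)))) (snd x))
        \<in> borel_measurable (borel \<Otimes>\<^sub>M N)"
      unfolding grid_up_def by measurable
    also have "(\<lambda>x. if fst x < 0 then 0 else Z (max 0 (min s (grid_up n (fst x)))) (snd x)) = f n"
    proof
      fix x :: "real \<times> 'a"
      show "(if fst x < 0 then 0 else Z (max 0 (min s (grid_up n (fst x)))) (snd x)) = f n x"
        using grid_up(1)[of "fst x" n] s by (auto simp: f_def split: prod.splits)
    qed
    finally show ?thesis .
  qed
  moreover have "(\<lambda>n. f n x) \<longlonglongrightarrow> (case x of (r, \<omega>) \<Rightarrow> Z (min s r) \<omega>)" if "x \<in> space (borel \<Otimes>\<^sub>M N)" for x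
  proof -
    obtain r \<omega> where x: "x = (r, \<omega>)" "\<omega> \<in> space M" using \<open>x \<in> _\<close> sp by (auto simp: space_pair_measure)
    show ?thesis
    proof (cases "r < 0")
      case True
      then have "Z (min s r) \<omega> = 0" using s by (intro Z_neg) auto
      then show ?thesis using True by (simp add: x f_def)
    next
      case False
      have "(\<lambda>n. Z (min s (grid_up n r)) \<omega>) \<longlonglongrightarrow> Z (min s r) \<omega>"
      proof (rule Z_tendsto_from_right[OF x(2)])
        show "min s r \<le> min s (grid_up n r)" for n using grid_up(1)[of r n] by auto
        show "(\<lambda>n. min s (grid_up n r)) \<longlonglongrightarrow> min s r" by (intro tendsto_min tendsto_const grid_up)
      qed (use s False in auto)
      then show ?thesis using False by (simp add: x f_def)
    qed
  qed
  ultimately show ?thesis by (rule borel_measurable_LIMSEQ_real[rotated])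
qed

lemma Z_joint_measurable: "(\<lambda>(r :: real, \<omega>). Z r \<omega>) \<in> borel_measurable (borel \<Otimes>\<^sub>M M)"
proof (rule borel_measurable_LIMSEQ_real)
  show "(\<lambda>(r :: real, \<omega>). Z (min (real n) r) \<omega>) \<in> borel_measurable (borel \<Otimes>\<^sub>M M)" for n
    by (rule Z_stopped_joint_measurable) (auto intro: Z_meas)
  fix x :: "real \<times> 'a" assume "x \<in> space (borel \<Otimes>\<^sub>M M)"
  obtain r \<omega> where x: "x = (r, \<omega>)" by (cases x)
  obtain n0 :: nat where "r \<le> n0" using real_arch_simple by blast
  then have "min (real n) r = r" if "n \<ge> n0" for n
    using that by (metis min_absorb2 of_nat_le_iff order_trans)
  then have "eventually (\<lambda>n. (case x of (r, \<omega>) \<Rightarrow> Z (min (real n) r) \<omega>) = (case x of (r, \<omega>) \<Rightarrow> Z r \<omega>)) sequentially"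
    unfolding eventually_sequentially x by (intro exI[of _ n0]) auto
  then show "(\<lambda>n. case x of (r, \<omega>) \<Rightarrow> Z (min (real n) r) \<omega>) \<longlonglongrightarrow> (case x of (r, \<omega>) \<Rightarrow> Z r \<omega>)"
    by (rule tendsto_eventually)
qed

lemma Z_measurable_compose[measurable (raw)]:
  assumes "f \<in> borel_measurable N" "g \<in> measurable N M"
  shows "(\<lambda>x. Z (f x) (g x)) \<in> borel_measurable N"
  using measurable_compose[OF measurable_Pair[OF assms] Z_joint_measurable] by simp

section \<open>Increments and the past of the process\<close>

definition increments :: "real \<Rightarrow> real \<Rightarrow> nat \<Rightarrow> 'a \<Rightarrow> nat \<Rightarrow> real" where
  "increments s u m \<omega> = (\<lambda>k\<in>{..<m}. Z (s + u * real (Suc k) / real m) \<omega> - Z (s + u * real k / real m) \<omega>)"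

abbreviation "PiR m \<equiv> PiM {..<m} (\<lambda>_::nat. borel :: real measure)"

lemma increments_measurable[measurable]: "increments s u m \<in> measurable M (PiR m)"
  unfolding increments_def by (intro measurable_restrict) measurable

lemma sum_increments:
  assumes "k \<le> m"
  shows "(\<Sum>j<k. increments s u m \<omega> j) = Z (s + u * real k / real m) \<omega> - Z s \<omega>"
proof -
  have "(\<Sum>j<k. increments s u m \<omega> j) = (\<Sum>j<k. Z (s + u * real (Suc j) / real m) \<omega> - Z (s + u * real j / real m) \<omega>)"
    using assms by (intro sum.cong) (auto simp: increments_def)
  also have "\<dots> = Z (s + u * real k / real m) \<omega> - Z s \<omega>"
    by (subst sum_lessThan_telescope) simp
  finally show ?thesis .
qed

text \<open>The start \<open>s\<close> has disappeared on the right: equal subintervals give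
  independent increments with one common law, which lets a fresh copy from time 0 replace the future
  after \<open>s\<close>.\<close>

lemma distr_increments:
  assumes "0 \<le> s" "0 \<le> u" "m > 0"
  shows "distr M (PiR m) (increments s u m) = PiM {..<m} (\<lambda>_. distr M borel (Z (u / real m)))"
proof -
  define t where "t i = s + u * real i / real m" for i
  define X where "X i \<omega> = Z (t (Suc i)) \<omega> - Z (t i) \<omega>" for i \<omega>
  have [measurable]: "X i \<in> borel_measurable M" for i unfolding X_def by measurable
  have "indep_vars (\<lambda>_. borel) X {..<m}"
    unfolding X_def using assms by (intro Z_indep) (auto simp: t_def divide_right_mono mult_left_mono)
  then have "distr M (PiR m) (\<lambda>x. \<lambda>i\<in>{..<m}. X i x) = PiM {..<m} (\<lambda>i. distr M borel (X i))"
    using assms by (subst (asm) indep_vars_iff_distr_eq_PiM) auto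
  also have "PiM {..<m} (\<lambda>i. distr M borel (X i)) = PiM {..<m} (\<lambda>_. distr M borel (Z (u / real m)))"
  proof (rule PiM_cong)
    fix i assume "i \<in> {..<m}"
    have "t (Suc i) = t i + u / real m" using assms by (simp add: t_def field_simps)
    then have "X i = (\<lambda>\<omega>. Z (t i + u / real m) \<omega> - Z (t i) \<omega>)" by (auto simp: X_def)
    then show "distr M borel (X i) = distr M borel (Z (u / real m))"
      using assms by (simp add: Z_stat t_def)
  qed simp
  also have "(\<lambda>x. \<lambda>i\<in>{..<m}. X i x) = increments s u m"
    by (auto simp: increments_def X_def t_def fun_eq_iff)
  finally show ?thesis .
qed

text \<open>Only dyadic increments of \<open>{0..s}\<close> generate the past. The families for
  different \<open>n\<close> are nested, so their union is closed under intersection, and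
  right-continuity recovers every \<open>Z r\<close> with \<open>0 \<le> r \<le> s\<close>.\<close>

definition past_sets :: "real \<Rightarrow> nat \<Rightarrow> 'a set set" where
  "past_sets s n = {increments 0 s (2 ^ n) -` A \<inter> space M | A. A \<in> sets (PiR (2 ^ n))}"

definition past :: "real \<Rightarrow> 'a measure" where
  "past s = sigma (space M) (\<Union>n. past_sets s n)"

lemma past_sets_events: "past_sets s n \<subseteq> events"
  by (auto simp: past_sets_def intro: measurable_sets[OF increments_measurable])

lemma past_sets_Pow: "(\<Union>n. past_sets s n) \<subseteq> Pow (space M)"
  using past_sets_events sets.space_closed by blast

lemma space_past[simp]: "space (past s) = space M"
  by (simp add: past_def space_measure_of_conv)

lemma sets_past: "sets (past s) = sigma_sets (space M) (\<Union>n. past_sets s n)"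
  unfolding past_def by (rule sets_measure_of[OF past_sets_Pow])

lemma past_sub: "sets (past s) \<subseteq> events"
  unfolding sets_past using past_sets_events by (intro sets.sigma_sets_subset) auto

lemma measurable_past: "f \<in> measurable (past s) N \<Longrightarrow> f \<in> measurable M N"
  using past_sub by (auto simp: measurable_def)

text \<open>A coarse increment is the sum of two adjacent fine ones, so coarse events are preimages
  under the fine increments.\<close>

lemma incseq_past_sets: "incseq (past_sets s)"
proof (rule incseq_SucI, rule subsetI)
  fix n B assume "B \<in> past_sets s n"
  then obtain A where A: "A \<in> sets (PiR (2 ^ n))" "B = increments 0 s (2 ^ n) -` A \<inter> space M"
    by (auto simp: past_sets_def)
  define h where "h g = (\<lambda>k\<in>{..<2 ^ n}. g (2 * k) + g (2 * k + 1))" for g :: "nat \<Rightarrow> real"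
  have h[measurable]: "h \<in> measurable (PiR (2 ^ Suc n)) (PiR (2 ^ n))"
    unfolding h_def
  proof (rule measurable_restrict)
    fix k :: nat assume "k \<in> {..<2 ^ n}"
    then have "2 * k \<in> {..<2 ^ Suc n}" "2 * k + 1 \<in> {..<2 ^ Suc n}" by auto
    then show "(\<lambda>g. g (2 * k) + g (2 * k + 1)) \<in> borel_measurable (PiR (2 ^ Suc n))"
      by (intro borel_measurable_add measurable_component_singleton)
  qed
  have eq: "increments 0 s (2 ^ n) \<omega> = h (increments 0 s (2 ^ Suc n) \<omega>)" for \<omega>
  proof
    fix k
    have "s * real (Suc (2 * k + 1)) / (2 * 2 ^ n) = s * real (Suc k) / 2 ^ n"
      "s * real (2 * k) / (2 * 2 ^ n) = s * real k / 2 ^ n"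
      by (simp_all add: field_simps)
    then show "increments 0 s (2 ^ n) \<omega> k = h (increments 0 s (2 ^ Suc n) \<omega>) k"
      by (auto simp: increments_def h_def simp del: of_nat_Suc)
  qed
  have "B = increments 0 s (2 ^ Suc n) -` (h -` A \<inter> space (PiR (2 ^ Suc n))) \<inter> space M"
    unfolding A(2) using measurable_space[OF increments_measurable] by (auto simp: eq)
  then show "B \<in> past_sets s (Suc n)"
    unfolding past_sets_def using measurable_sets[OF h A(1)] by blast
qed

lemma Int_stable_past_sets: "Int_stable (\<Union>n. past_sets s n)"
proof (rule Int_stableI)
  fix A B assume "A \<in> (\<Union>n. past_sets s n)" "B \<in> (\<Union>n. past_sets s n)"
  then obtain i j where "A \<in> past_sets s i" "B \<in> past_sets s j" by auto
  then have "A \<in> past_sets s (max i j)" "B \<in> past_sets s (max i j)"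
    using incseqD[OF incseq_past_sets, of i "max i j" s] incseqD[OF incseq_past_sets, of j "max i j" s] by auto
  then obtain A' B' where A': "A' \<in> sets (PiR (2 ^ max i j))" "A = increments 0 s (2 ^ max i j) -` A' \<inter> space M"
    and B': "B' \<in> sets (PiR (2 ^ max i j))" "B = increments 0 s (2 ^ max i j) -` B' \<inter> space M"
    by (auto simp: past_sets_def)
  have "A \<inter> B = increments 0 s (2 ^ max i j) -` (A' \<inter> B') \<inter> space M" using A' B' by auto
  then have "A \<inter> B \<in> past_sets s (max i j)"
    unfolding past_sets_def using A' B' by blast
  then show "A \<inter> B \<in> (\<Union>n. past_sets s n)" by blast
qed

text \<open>Partial sums of increments give the values on the grid; any other \<open>r < s\<close>
  is a right limit of grid times that stay inside \<open>{0..s}\<close>.\<close>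

lemma Z_measurable_past:
  assumes "0 \<le> r" "r \<le> s"
  shows "Z r \<in> borel_measurable (past s)"
proof -
  have inc: "increments 0 s (2 ^ n) \<in> measurable (past s) (PiR (2 ^ n))" for n
  proof (rule measurableI)
    show "increments 0 s (2 ^ n) \<omega> \<in> space (PiR (2 ^ n))" if "\<omega> \<in> space (past s)" for \<omega>
      using measurable_space[OF increments_measurable] that by simp
    show "increments 0 s (2 ^ n) -` A \<inter> space (past s) \<in> sets (past s)" if "A \<in> sets (PiR (2 ^ n))" for A
      unfolding sets_past using that by (intro sigma_sets.Basic) (auto simp: past_sets_def)
  qed
  have grid: "Z (s * real k / 2 ^ n) \<in> borel_measurable (past s)" if "k \<le> 2 ^ n" for k n
  proof -
    have "(\<lambda>\<omega>. \<Sum>j<k. increments 0 s (2 ^ n) \<omega> j) \<in> borel_measurable (past s)"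
    proof (rule borel_measurable_sum)
      fix j assume "j \<in> {..<k}"
      then have "j \<in> {..<2 ^ n}" using that by auto
      then show "(\<lambda>\<omega>. increments 0 s (2 ^ n) \<omega> j) \<in> borel_measurable (past s)"
        by (rule measurable_compose[OF inc measurable_component_singleton])
    qed
    also have "(\<lambda>\<omega>. \<Sum>j<k. increments 0 s (2 ^ n) \<omega> j) \<in> borel_measurable (past s)
        \<longleftrightarrow> Z (s * real k / 2 ^ n) \<in> borel_measurable (past s)"
      by (rule measurable_cong) (use sum_increments[OF that, of 0 s] Z_0 in simp)
    finally show ?thesis .
  qed
  show ?thesis
  proof (cases "r < s")
    case False
    then show ?thesis using grid[of 1 0] assms by simp
  next
    case True
    obtain X K where X: "\<And>n. K n \<le> 2 ^ n" "\<And>n. X n = s * real (K n) / 2 ^ n" "\<And>n. r \<le> X n" "X \<longlonglongrightarrow> r"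
      using grid_approx[OF assms(1) True] by metis
    show ?thesis
    proof (rule borel_measurable_LIMSEQ_real)
      show "Z (X n) \<in> borel_measurable (past s)" for n using grid[OF X(1)] by (simp add: X(2))
      show "(\<lambda>n. Z (X n) \<omega>) \<longlonglongrightarrow> Z r \<omega>" if "\<omega> \<in> space (past s)" for \<omega>
        by (rule Z_tendsto_from_right[OF _ assms(1) X(3,4)]) (use that in simp)
    qed
  qed
qed

lemma indep_past_increments:
  assumes "0 \<le> s" "0 \<le> u" "m > 0"
  shows "indep_set (sets (past s)) {increments s u m -` A \<inter> space M | A. A \<in> sets (PiR m)}"
proof -
  define F where "F = {increments s u m -` A \<inter> space M | A. A \<in> sets (PiR m)}"
  have FE: "F \<subseteq> events" by (auto simp: F_def intro: measurable_sets[OF increments_measurable])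
  have "indep_set (\<Union>n. past_sets s n) F"
    unfolding indep_sets2_eq
  proof (intro conjI ballI)
    show "(\<Union>n. past_sets s n) \<subseteq> events" using past_sets_events by auto
    show "F \<subseteq> events" by (rule FE)
    fix a b assume a: "a \<in> (\<Union>n. past_sets s n)" and b: "b \<in> F"
    then obtain n A B where A: "A \<in> sets (PiR (2 ^ n))" "a = increments 0 s (2 ^ n) -` A \<inter> space M"
      and B: "B \<in> sets (PiR m)" "b = increments s u m -` B \<inter> space M"
      by (auto simp: past_sets_def F_def)
    define N :: nat where "N = 2 ^ n"
    have N: "N > 0" by (simp add: N_def)
    \<comment> \<open>The subdivision of \<open>{0..s}\<close> into \<open>N\<close> pieces and that
      of \<open>{s..s + u}\<close> into \<open>m\<close> pieces are glued at index \<open>N\<close>,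
      so independence along a single time sequence separates past from future.\<close>
    define t where "t i = (if i \<le> N then s * real i / real N else s + u * real (i - N) / real m)" for i
    define X where "X i \<omega> = Z (t (Suc i)) \<omega> - Z (t i) \<omega>" for i \<omega>
    have "indep_vars (\<lambda>_. borel) X {..<N + m}"
      unfolding X_def
    proof (rule Z_indep)
      show "0 \<le> t 0" by (simp add: t_def)
      fix i
      consider "Suc i \<le> N" | "i = N" | "i > N" by linarith
      then show "t i \<le> t (Suc i)"
      proof cases
        case 1
        then show ?thesis using assms N by (simp add: t_def divide_right_mono mult_left_mono)
      next
        case 2
        then show ?thesis using assms N by (simp add: t_def)
      next
        case 3
        then have "u * real (i - N) / real m \<le> u * real (Suc i - N) / real m"
          using assms by (intro divide_right_mono mult_left_mono) auto
        then show ?thesis using 3 by (simp add: t_def)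
      qed
    qed
    then have "indep_var (PiR N) (\<lambda>\<omega>. restrict (\<lambda>i. X i \<omega>) {..<N}) (PiM {N..<N + m} (\<lambda>_. borel)) (\<lambda>\<omega>. restrict (\<lambda>i. X i \<omega>) {N..<N + m})"
      by (rule indep_var_restrict) auto
    then have "indep_var (PiR N) ((\<lambda>g. g) \<circ> (\<lambda>\<omega>. restrict (\<lambda>i. X i \<omega>) {..<N}))
      (PiR m) ((\<lambda>g. \<lambda>k\<in>{..<m}. g (N + k)) \<circ> (\<lambda>\<omega>. restrict (\<lambda>i. X i \<omega>) {N..<N + m}))"
      by (rule indep_var_compose) (auto intro!: measurable_restrict measurable_component_singleton)
    moreover have "(\<lambda>g. g) \<circ> (\<lambda>\<omega>. restrict (\<lambda>i. X i \<omega>) {..<N}) = increments 0 s N"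
      by (auto simp: fun_eq_iff increments_def X_def t_def)
    moreover have "(\<lambda>g. \<lambda>k\<in>{..<m}. g (N + k)) \<circ> (\<lambda>\<omega>. restrict (\<lambda>i. X i \<omega>) {N..<N + m}) = increments s u m"
    proof -
      have "t (N + k) = s + u * real k / real m" for k using N by (simp add: t_def)
      from this this[of "Suc _"] show ?thesis
        by (auto simp: fun_eq_iff increments_def X_def simp del: of_nat_Suc)
    qed
    ultimately have "indep_var (PiR N) (increments 0 s N) (PiR m) (increments s u m)" by simp
    then have "indep_set {increments 0 s N -` A \<inter> space M | A. A \<in> sets (PiR N)} F"
      unfolding F_def indep_var_eq indep_sets2_eq by (blast intro: sigma_sets.Basic)
    then show "prob (a \<inter> b) = prob a * prob b"
      unfolding indep_sets2_eq N_def using A b by blast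
  qed
  moreover have "Int_stable F"
  proof (rule Int_stableI)
    fix a b assume "a \<in> F" "b \<in> F"
    then obtain A B where "A \<in> sets (PiR m)" "a = increments s u m -` A \<inter> space M"
      "B \<in> sets (PiR m)" "b = increments s u m -` B \<inter> space M" by (auto simp: F_def)
    then have "a \<inter> b = increments s u m -` (A \<inter> B) \<inter> space M" "A \<inter> B \<in> sets (PiR m)" by auto
    then show "a \<inter> b \<in> F" unfolding F_def by blast
  qed
  \<comment> \<open>Both generators are closed under intersection, so independence passes to the
    generated sigma-algebras.\<close>
  ultimately have "indep_set (sigma_sets (space M) (\<Union>n. past_sets s n)) (sigma_sets (space M) F)"
    by (intro indep_set_sigma_sets Int_stable_past_sets)
  then show ?thesis
    unfolding sets_past F_def[symmetric] indep_sets2_eq by blast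
qed

text \<open>Independence makes the joint law of \<open>\<omega>\<close>, seen through the past, and
  of the increments after \<open>s\<close> a product; stationarity lets the second factor be sampled
  from a copy started at time 0.\<close>

lemma nn_integral_past_increments:
  assumes "0 \<le> s" "0 \<le> u" "m > 0"
    and [measurable]: "\<Phi> \<in> borel_measurable (past s \<Otimes>\<^sub>M PiR m)"
  shows "(\<integral>\<^sup>+ \<omega>. \<Phi> (\<omega>, increments s u m \<omega>) \<partial>M) = (\<integral>\<^sup>+ \<omega>. \<integral>\<^sup>+ \<omega>'. \<Phi> (\<omega>, increments 0 u m \<omega>') \<partial>M \<partial>M)"
proof -
  note ind = indep_past_increments[OF assms(1-3)]
  have id[measurable]: "(\<lambda>\<omega>. \<omega>) \<in> measurable M (past s)"
    by (rule measurable_past) (rule measurable_ident_sets[OF refl])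
  interpret D: prob_space "distr M (PiR m) (increments 0 u m)"
    by (rule prob_space_distr) simp
  have same: "distr M (PiR m) (increments s u m) = distr M (PiR m) (increments 0 u m)"
    using assms by (simp add: distr_increments)
  have "(\<integral>\<^sup>+ \<omega>. \<Phi> (\<omega>, increments s u m \<omega>) \<partial>M)
    = (\<integral>\<^sup>+ y. \<Phi> y \<partial>distr M (past s \<Otimes>\<^sub>M PiR m) (\<lambda>\<omega>. (\<omega>, increments s u m \<omega>)))"
    by (subst nn_integral_distr) auto
  also have "distr M (past s \<Otimes>\<^sub>M PiR m) (\<lambda>\<omega>. (\<omega>, increments s u m \<omega>))
      = distr M (past s) (\<lambda>\<omega>. \<omega>) \<Otimes>\<^sub>M distr M (PiR m) (increments 0 u m)"
  proof (rule pair_measure_eqI[symmetric])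
    show "sigma_finite_measure (distr M (past s) (\<lambda>\<omega>. \<omega>))"
      by (intro finite_measure.axioms(1) prob_space.finite_measure prob_space_distr) simp
    show "sigma_finite_measure (distr M (PiR m) (increments 0 u m))" ..
    show "sets (distr M (past s) (\<lambda>\<omega>. \<omega>) \<Otimes>\<^sub>M distr M (PiR m) (increments 0 u m)) =
        sets (distr M (past s \<Otimes>\<^sub>M PiR m) (\<lambda>\<omega>. (\<omega>, increments s u m \<omega>)))"
      using sets_pair_measure_cong[of "distr M (past s) (\<lambda>\<omega>. \<omega>)" "past s" "distr M (PiR m) (increments 0 u m)" "PiR m"]
      by (simp only: sets_distr)
    fix A B assume "A \<in> sets (distr M (past s) (\<lambda>\<omega>. \<omega>))" "B \<in> sets (distr M (PiR m) (increments 0 u m))"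
    then have [measurable]: "A \<in> sets (past s)" "B \<in> sets (PiR m)" by auto
    have AM: "A \<subseteq> space M" using sets.sets_into_space[of A "past s"] by simp
    have "emeasure (distr M (past s) (\<lambda>\<omega>. \<omega>)) A * emeasure (distr M (PiR m) (increments 0 u m)) B
      = ennreal (prob A * prob (increments s u m -` B \<inter> space M))"
      unfolding same[symmetric] using AM
      by (simp add: emeasure_distr emeasure_eq_measure ennreal_mult Int_absorb2)
    also have "prob A * prob (increments s u m -` B \<inter> space M) = prob (A \<inter> (increments s u m -` B \<inter> space M))"
      by (rule indep_setD[OF ind, symmetric]) auto
    also have "ennreal \<dots> = emeasure (distr M (past s \<Otimes>\<^sub>M PiR m) (\<lambda>\<omega>. (\<omega>, increments s u m \<omega>))) (A \<times> B)"
      using AM by (subst emeasure_distr) (auto simp: emeasure_eq_measure intro!: arg_cong[where f = prob])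
    finally show "emeasure (distr M (past s) (\<lambda>\<omega>. \<omega>)) A * emeasure (distr M (PiR m) (increments 0 u m)) B =
        emeasure (distr M (past s \<Otimes>\<^sub>M PiR m) (\<lambda>\<omega>. (\<omega>, increments s u m \<omega>))) (A \<times> B)" .
  qed
  also have "(\<integral>\<^sup>+ y. \<Phi> y \<partial>(distr M (past s) (\<lambda>\<omega>. \<omega>) \<Otimes>\<^sub>M distr M (PiR m) (increments 0 u m)))
     = (\<integral>\<^sup>+ \<omega>. \<integral>\<^sup>+ d. \<Phi> (\<omega>, d) \<partial>distr M (PiR m) (increments 0 u m) \<partial>distr M (past s) (\<lambda>\<omega>. \<omega>))"
    by (subst D.nn_integral_fst[symmetric]) (auto cong: measurable_cong_sets)
  also have "\<dots> = (\<integral>\<^sup>+ \<omega>. \<integral>\<^sup>+ d. \<Phi> (\<omega>, d) \<partial>distr M (PiR m) (increments 0 u m) \<partial>M)"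
    by (subst nn_integral_distr) auto
  also have "\<dots> = (\<integral>\<^sup>+ \<omega>. \<integral>\<^sup>+ \<omega>'. \<Phi> (\<omega>, increments 0 u m \<omega>') \<partial>M \<partial>M)"
    by (intro nn_integral_cong, subst nn_integral_distr) auto
  finally show ?thesis .
qed

section \<open>Survival events and the Markov property\<close>

definition stay :: "real \<Rightarrow> real \<Rightarrow> real \<Rightarrow> 'a \<Rightarrow> bool" where
  "stay z s u \<omega> \<longleftrightarrow> (\<forall>r\<in>{0..u}. 0 \<le> z + Z (s + r) \<omega>)"

abbreviation "alive z \<equiv> stay z 0"

text \<open>The endpoint \<open>u\<close> is itself a grid point, and any earlier time is a right
  limit of grid times. Passage means being strictly below the level, so survival is a closed
  condition and passes to the limit.\<close>

lemma stay_iff_grid: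
  assumes \<omega>: "\<omega> \<in> space M" and s: "s \<ge> 0" and u: "u \<ge> 0"
  shows "stay z s u \<omega> \<longleftrightarrow> (\<forall>n. \<forall>k\<le>(2 :: nat) ^ n. 0 \<le> z + Z (s + u * real k / 2 ^ n) \<omega>)"
proof
  assume st: "stay z s u \<omega>"
  show "\<forall>n. \<forall>k\<le>(2 :: nat) ^ n. 0 \<le> z + Z (s + u * real k / 2 ^ n) \<omega>"
  proof (intro allI impI)
    fix n k :: nat assume "k \<le> 2 ^ n"
    then have "real k \<le> 2 ^ n" by (metis of_nat_le_iff of_nat_numeral of_nat_power)
    then have "u * real k / 2 ^ n \<le> u * 2 ^ n / 2 ^ n" using u by (intro divide_right_mono mult_left_mono) auto
    then show "0 \<le> z + Z (s + u * real k / 2 ^ n) \<omega>"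
      using st u unfolding stay_def by (intro bspec[of "{0..u}" "\<lambda>r. 0 \<le> z + Z (s + r) \<omega>"]) auto
  qed
next
  assume gr: "\<forall>n. \<forall>k\<le>(2 :: nat) ^ n. 0 \<le> z + Z (s + u * real k / 2 ^ n) \<omega>"
  show "stay z s u \<omega>"
    unfolding stay_def
  proof
    fix r assume r: "r \<in> {0..u}"
    show "0 \<le> z + Z (s + r) \<omega>"
    proof (cases "r < u")
      case False
      then show ?thesis using gr[rule_format, of 1 0] r by simp
    next
      case True
      obtain X K where X: "\<And>n. K n \<le> (2 :: nat) ^ n" "\<And>n. X n = u * real (K n) / 2 ^ n" "\<And>n. r \<le> X n" "X \<longlonglongrightarrow> r"
        using grid_approx[of r u] r True by (metis atLeastAtMost_iff)
      have "(\<lambda>n. Z (s + X n) \<omega>) \<longlonglongrightarrow> Z (s + r) \<omega>"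
        by (rule Z_tendsto_from_right[OF \<omega>]) (use s r X(3,4) in \<open>auto intro!: tendsto_intros\<close>)
      then have "(\<lambda>n. z + Z (s + X n) \<omega>) \<longlonglongrightarrow> z + Z (s + r) \<omega>" by (intro tendsto_intros)
      then show ?thesis
        by (rule LIMSEQ_le_const) (use gr[rule_format, OF X(1)] X(2) in simp)
    qed
  qed
qed

lemma alive_add: "s \<ge> 0 \<Longrightarrow> u \<ge> 0 \<Longrightarrow> alive z (s + u) \<omega> \<longleftrightarrow> alive z s \<omega> \<and> stay z s u \<omega>"
proof -
  assume s: "s \<ge> 0" "u \<ge> 0"
  then have "{0..s + u} = {0..s} \<union> (+) s ` {0..u}" by auto
  moreover have "stay z s u \<omega> \<longleftrightarrow> (\<forall>r\<in>(+) s ` {0..u}. 0 \<le> z + Z r \<omega>)"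
    by (simp add: stay_def del: image_add_atLeastAtMost)
  ultimately show ?thesis by (simp only: stay_def[of z 0] add_0 ball_Un)
qed

lemma alive_mono: "alive z t \<omega> \<Longrightarrow> s \<le> t \<Longrightarrow> alive z s \<omega>"
  by (auto simp: stay_def)

lemma alive_measurable[measurable (raw)]:
  assumes [measurable]: "f \<in> borel_measurable N" "g \<in> borel_measurable N" "h \<in> measurable N M"
  shows "Measurable.pred N (\<lambda>x. alive (f x) (g x) (h x))"
proof -
  \<comment> \<open>For negative times \<open>alive\<close> holds vacuously, which the first
    disjunct reproduces.\<close>
  have "Measurable.pred N (\<lambda>x. g x < 0 \<or> (\<forall>n. \<forall>k\<in>{..(2 :: nat) ^ n}. 0 \<le> f x + Z (g x * real k / 2 ^ n) (h x)))"
    by measurable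
  also have "?this \<longleftrightarrow> Measurable.pred N (\<lambda>x. alive (f x) (g x) (h x))"
  proof (rule measurable_cong)
    fix x assume "x \<in> space N"
    then have "h x \<in> space M" by (rule measurable_space[OF assms(3)])
    then show "(g x < 0 \<or> (\<forall>n. \<forall>k\<in>{..(2 :: nat) ^ n}. 0 \<le> f x + Z (g x * real k / 2 ^ n) (h x)))
        \<longleftrightarrow> alive (f x) (g x) (h x)"
      using stay_iff_grid[of "h x" 0 "g x" "f x"] by (cases "g x < 0") (auto simp: stay_def)
  qed
  finally show ?thesis .
qed

lemma alive_measurable_past:
  assumes s: "s \<ge> 0"
  shows "Measurable.pred (past s) (alive z s)"
proof -
  have "Measurable.pred (past s) (\<lambda>\<omega>. \<forall>n. \<forall>k\<in>{..(2 :: nat) ^ n}. 0 \<le> z + Z (s * real k / 2 ^ n) \<omega>)"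
  proof (intro pred_intros_countable(1) pred_intros_finite(3))
    fix n k :: nat assume "k \<in> {..2 ^ n}"
    then have "real k \<le> 2 ^ n" by (metis atMost_iff of_nat_le_iff of_nat_numeral of_nat_power)
    then have "s * real k / 2 ^ n \<le> s * 2 ^ n / 2 ^ n" using s by (intro divide_right_mono mult_left_mono) auto
    then have [measurable]: "Z (s * real k / 2 ^ n) \<in> borel_measurable (past s)"
      using s by (intro Z_measurable_past) auto
    show "Measurable.pred (past s) (\<lambda>\<omega>. 0 \<le> z + Z (s * real k / 2 ^ n) \<omega>)" by measurable
  qed simp
  also have "?this \<longleftrightarrow> ?thesis"
    by (rule measurable_cong) (use stay_iff_grid[of _ 0 s z] s in auto)
  finally show ?thesis .
qed

text \<open>The grid conditions become stronger with \<open>n\<close>, because index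
  \<open>k\<close> at level \<open>n\<close> is index \<open>2 * k\<close> at level
  \<open>Suc n\<close>. The sequence is therefore eventually constant.\<close>

lemma grid_if_tendsto_stay:
  fixes c :: ennreal
  assumes \<omega>: "\<omega> \<in> space M" and s: "s \<ge> 0" and u: "u \<ge> 0"
  shows "(\<lambda>n. if \<forall>k\<le>(2 :: nat) ^ n. 0 \<le> z + Z (s + u * real k / 2 ^ n) \<omega> then c else 0)
     \<longlonglongrightarrow> (if stay z s u \<omega> then c else 0)"
proof (cases "stay z s u \<omega>")
  case True
  then show ?thesis using stay_iff_grid[OF assms, of z] by simp
next
  case False
  define P where "P n \<longleftrightarrow> (\<forall>k\<le>(2 :: nat) ^ n. 0 \<le> z + Z (s + u * real k / 2 ^ n) \<omega>)" for n
  obtain n0 where n0: "\<not> P n0" using stay_iff_grid[OF assms, of z] False unfolding P_def by blast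
  have step: "P n" if "P (Suc n)" for n
    unfolding P_def
  proof (intro allI impI)
    fix k :: nat assume "k \<le> 2 ^ n"
    then have "2 * k \<le> 2 ^ Suc n" by simp
    then have "0 \<le> z + Z (s + u * real (2 * k) / 2 ^ Suc n) \<omega>" using that unfolding P_def by blast
    then show "0 \<le> z + Z (s + u * real k / 2 ^ n) \<omega>" by simp
  qed
  have "\<not> P n" if "n \<ge> n0" for n
    using that by (induction n rule: dec_induct) (use n0 step in auto)
  then have "eventually (\<lambda>n. (if P n then c else 0) = 0) sequentially"
    by (auto simp: eventually_sequentially)
  then show ?thesis using False unfolding P_def by (simp add: tendsto_eventually)
qed

text \<open>Both sides are limits of integrals of functionals of finitely many increments, to which
  \<open>nn_integral_past_increments\<close> applies; the bound \<open>C\<close> is the dominating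
  function.\<close>

lemma markov_bounded:
  assumes s: "0 \<le> s" and u: "0 \<le> u" and [measurable]: "\<Phi> \<in> borel_measurable (past s \<Otimes>\<^sub>M borel)"
    and bd: "\<And>x. \<Phi> x \<le> ennreal C"
  shows "(\<integral>\<^sup>+ \<omega>. (if stay z s u \<omega> then \<Phi> (\<omega>, Z (s + u) \<omega>) else 0) \<partial>M)
       = (\<integral>\<^sup>+ \<omega>. \<integral>\<^sup>+ \<omega>'. (if alive (z + Z s \<omega>) u \<omega>' then \<Phi> (\<omega>, Z s \<omega> + Z u \<omega>') else 0) \<partial>M \<partial>M)"
proof -
  let ?A = "\<lambda>\<omega> \<omega>'. (if alive (z + Z s \<omega>) u \<omega>' then \<Phi> (\<omega>, Z s \<omega> + Z u \<omega>') else 0)"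
  let ?S = "\<lambda>\<omega>. (if stay z s u \<omega> then \<Phi> (\<omega>, Z (s + u) \<omega>) else 0)"
  have id[measurable]: "(\<lambda>\<omega>. \<omega>) \<in> measurable M (past s)"
    by (rule measurable_past) (rule measurable_ident_sets[OF refl])
  have Zs[measurable]: "Z s \<in> borel_measurable (past s)" using s by (intro Z_measurable_past) auto
  \<comment> \<open>The path on the grid is rebuilt from its position at \<open>s\<close> and the
    partial sums of \<open>d\<close>. Inserting the increments after \<open>s\<close> leads to the
    left side, those of the copy from time 0 to the right side.\<close>
  define F where "F n = (\<lambda>(\<omega>, d). if \<forall>k\<in>{..(2 :: nat) ^ n}. 0 \<le> z + Z s \<omega> + (\<Sum>j<k. d j)
      then \<Phi> (\<omega>, Z s \<omega> + (\<Sum>j<(2 :: nat) ^ n. d j)) else 0)" for n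
  have sum_meas: "(\<lambda>x. \<Sum>j<k. snd x j) \<in> borel_measurable (past s \<Otimes>\<^sub>M PiR (2 ^ n))" if "k \<le> 2 ^ n" for k n
  proof (rule borel_measurable_sum)
    fix j assume "j \<in> {..<k}"
    then have "j \<in> {..<2 ^ n}" using that by auto
    then show "(\<lambda>x. snd x j) \<in> borel_measurable (past s \<Otimes>\<^sub>M PiR (2 ^ n))"
      by (rule measurable_compose[OF measurable_snd measurable_component_singleton])
  qed
  have F[measurable]: "F n \<in> borel_measurable (past s \<Otimes>\<^sub>M PiR (2 ^ n))" for n
  proof -
    have 1: "Measurable.pred (past s \<Otimes>\<^sub>M PiR (2 ^ n)) (\<lambda>x. \<forall>k\<in>{..(2 :: nat) ^ n}. 0 \<le> z + Z s (fst x) + (\<Sum>j<k. snd x j))"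
    proof (rule pred_intros_finite(3))
      fix k assume "k \<in> {..(2 :: nat) ^ n}"
      then have [measurable]: "(\<lambda>x. \<Sum>j<k. snd x j) \<in> borel_measurable (past s \<Otimes>\<^sub>M PiR (2 ^ n))"
        by (intro sum_meas) simp
      show "Measurable.pred (past s \<Otimes>\<^sub>M PiR (2 ^ n)) (\<lambda>x. 0 \<le> z + Z s (fst x) + (\<Sum>j<k. snd x j))"
        by measurable
    qed simp
    have [measurable]: "(\<lambda>x. \<Sum>j<(2 :: nat) ^ n. snd x j) \<in> borel_measurable (past s \<Otimes>\<^sub>M PiR (2 ^ n))"
      by (rule sum_meas) simp
    have 2: "(\<lambda>x. \<Phi> (fst x, Z s (fst x) + (\<Sum>j<(2 :: nat) ^ n. snd x j))) \<in> borel_measurable (past s \<Otimes>\<^sub>M PiR (2 ^ n))"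
      by measurable
    show ?thesis
      using 1 2 unfolding F_def case_prod_beta' by measurable
  qed
  have part: "(\<Sum>j<k. increments t u (2 ^ n) \<omega> j) = Z (t + u * real k / 2 ^ n) \<omega> - Z t \<omega>" if "k \<le> 2 ^ n" for k n t \<omega>
    using sum_increments[OF that, of t u \<omega>] by simp
  have FL: "F n (\<omega>, increments s u (2 ^ n) \<omega>)
     = (if \<forall>k\<le>(2 :: nat) ^ n. 0 \<le> z + Z (s + u * real k / 2 ^ n) \<omega> then \<Phi> (\<omega>, Z (s + u) \<omega>) else 0)" for n \<omega>
    unfolding F_def using part[of _ n s] by (auto simp: add.assoc)
  have FR: "F n (\<omega>, increments 0 u (2 ^ n) \<omega>')
     = (if \<forall>k\<le>(2 :: nat) ^ n. 0 \<le> (z + Z s \<omega>) + Z (0 + u * real k / 2 ^ n) \<omega>' then \<Phi> (\<omega>, Z s \<omega> + Z u \<omega>') else 0)"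
    if "\<omega>' \<in> space M" for n \<omega> \<omega>'
    unfolding F_def using part[of _ n 0] Z_0[OF that] by (auto simp: add.assoc)
  have fin: "(\<integral>\<^sup>+ \<omega>. ennreal C \<partial>M) < \<infinity>"
    by (simp add: emeasure_space_1)
  have FC: "F n x \<le> ennreal C" for n x
    using bd by (auto simp: F_def split: prod.splits)
  have "(\<lambda>n. \<integral>\<^sup>+ \<omega>. F n (\<omega>, increments s u (2 ^ n) \<omega>) \<partial>M)
     \<longlonglongrightarrow> (\<integral>\<^sup>+ \<omega>. ?S \<omega> \<partial>M)"
  proof (rule nn_integral_dominated_convergence[where w = "\<lambda>_. ennreal C"])
    show "AE \<omega> in M. (\<lambda>n. F n (\<omega>, increments s u (2 ^ n) \<omega>)) \<longlonglongrightarrow> ?S \<omega>"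
      unfolding FL using s u by (intro AE_I2 grid_if_tendsto_stay)
    show "(\<lambda>\<omega>. if stay z s u \<omega> then \<Phi> (\<omega>, Z (s + u) \<omega>) else 0) \<in> borel_measurable M"
    proof (rule borel_measurable_LIMSEQ_order)
      show "(\<lambda>n. F n (\<omega>, increments s u (2 ^ n) \<omega>)) \<longlonglongrightarrow> ?S \<omega>"
        if "\<omega> \<in> space M" for \<omega>
        unfolding FL using s u that by (intro grid_if_tendsto_stay)
    qed measurable
  qed (use fin FC in auto)
  moreover have "(\<lambda>n. \<integral>\<^sup>+ \<omega>. F n (\<omega>, increments s u (2 ^ n) \<omega>) \<partial>M)
     \<longlonglongrightarrow> (\<integral>\<^sup>+ \<omega>. \<integral>\<^sup>+ \<omega>'. ?A \<omega> \<omega>' \<partial>M \<partial>M)"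
  proof -
    have inner: "(\<lambda>n. \<integral>\<^sup>+ \<omega>'. F n (\<omega>, increments 0 u (2 ^ n) \<omega>') \<partial>M)
      \<longlonglongrightarrow> (\<integral>\<^sup>+ \<omega>'. ?A \<omega> \<omega>' \<partial>M)"
      if [measurable]: "\<omega> \<in> space M" for \<omega>
    proof (rule nn_integral_dominated_convergence[where w = "\<lambda>_. ennreal C"])
      have [measurable]: "\<omega> \<in> space (past s)" using that by simp
      show "AE \<omega>' in M. (\<lambda>n. F n (\<omega>, increments 0 u (2 ^ n) \<omega>')) \<longlonglongrightarrow> ?A \<omega> \<omega>'"
        using grid_if_tendsto_stay[of _ 0 u "z + Z s \<omega>"] u by (intro AE_I2) (simp add: FR)
      show "(\<lambda>\<omega>'. F n (\<omega>, increments 0 u (2 ^ n) \<omega>')) \<in> borel_measurable M" for n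
        by measurable
      show "(\<lambda>\<omega>'. if alive (z + Z s \<omega>) u \<omega>' then \<Phi> (\<omega>, Z s \<omega> + Z u \<omega>') else 0) \<in> borel_measurable M"
        by measurable
    qed (use fin FC in auto)
    have "(\<lambda>n. \<integral>\<^sup>+ \<omega>. \<integral>\<^sup>+ \<omega>'. F n (\<omega>, increments 0 u (2 ^ n) \<omega>') \<partial>M \<partial>M)
     \<longlonglongrightarrow> (\<integral>\<^sup>+ \<omega>. \<integral>\<^sup>+ \<omega>'. ?A \<omega> \<omega>' \<partial>M \<partial>M)"
    proof (rule nn_integral_dominated_convergence[where w = "\<lambda>_. ennreal C"])
      show "AE \<omega> in M. (\<integral>\<^sup>+ \<omega>'. F j (\<omega>, increments 0 u (2 ^ j) \<omega>') \<partial>M) \<le> ennreal C" for j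
      proof (rule AE_I2)
        fix \<omega>
        have "(\<integral>\<^sup>+ \<omega>'. F j (\<omega>, increments 0 u (2 ^ j) \<omega>') \<partial>M) \<le> (\<integral>\<^sup>+ \<omega>'. ennreal C \<partial>M)"
          by (intro nn_integral_mono FC)
        then show "(\<integral>\<^sup>+ \<omega>'. F j (\<omega>, increments 0 u (2 ^ j) \<omega>') \<partial>M) \<le> ennreal C"
          by (simp add: emeasure_space_1)
      qed
      show "AE \<omega> in M. (\<lambda>n. \<integral>\<^sup>+ \<omega>'. F n (\<omega>, increments 0 u (2 ^ n) \<omega>') \<partial>M)
          \<longlonglongrightarrow> (\<integral>\<^sup>+ \<omega>'. ?A \<omega> \<omega>' \<partial>M)"
        by (intro AE_I2 inner)
    qed (use fin in auto)
    then show ?thesis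
      using s u by (subst nn_integral_past_increments) auto
  qed
  ultimately show ?thesis by (rule LIMSEQ_unique)
qed

lemma min_of_nat_tendsto: "(\<lambda>n. min c (of_nat n)) \<longlonglongrightarrow> (c :: ennreal)"
proof -
  have "(\<lambda>n. min c (of_nat n)) \<longlonglongrightarrow> min c top"
    by (intro tendsto_min tendsto_const of_nat_tendsto_top_ennreal)
  then show ?thesis by simp
qed

lemma stay_measurable[measurable]:
  assumes s: "s \<ge> 0" and u: "u \<ge> 0"
  shows "Measurable.pred M (stay z s u)"
proof -
  have "Measurable.pred M (\<lambda>\<omega>. \<forall>n. \<forall>k\<in>{..(2 :: nat) ^ n}. 0 \<le> z + Z (s + u * real k / 2 ^ n) \<omega>)"
    by measurable
  also have "?this \<longleftrightarrow> ?thesis"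
    by (rule measurable_cong) (use stay_iff_grid[of _ s u z] s u in auto)
  finally show ?thesis .
qed

text \<open>Truncation of \<open>\<Phi>\<close> and monotone convergence remove the bound.
  \<open>\<Phi>\<close> sees the whole past, not only \<open>Z s\<close>, so that it can carry a
  discount accumulated up to \<open>s\<close>.\<close>

lemma markov:
  assumes s: "0 \<le> s" and u: "0 \<le> u" and [measurable]: "\<Phi> \<in> borel_measurable (past s \<Otimes>\<^sub>M borel)"
  shows "(\<integral>\<^sup>+ \<omega>. (if stay z s u \<omega> then \<Phi> (\<omega>, Z (s + u) \<omega>) else 0) \<partial>M)
       = (\<integral>\<^sup>+ \<omega>. \<integral>\<^sup>+ \<omega>'. (if alive (z + Z s \<omega>) u \<omega>' then \<Phi> (\<omega>, Z s \<omega> + Z u \<omega>') else 0) \<partial>M \<partial>M)"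
    (is "?L = ?R")
proof -
  let ?A = "\<lambda>\<omega> \<omega>'. (if alive (z + Z s \<omega>) u \<omega>' then \<Phi> (\<omega>, Z s \<omega> + Z u \<omega>') else 0)"
  have id[measurable]: "(\<lambda>\<omega>. \<omega>) \<in> measurable M (past s)"
    by (rule measurable_past) (rule measurable_ident_sets[OF refl])
  note [measurable] = stay_measurable[OF s u]
  define \<Phi>n where "\<Phi>n n x = min (\<Phi> x) (of_nat n)" for n :: nat and x
  let ?An = "\<lambda>(n :: nat) \<omega> \<omega>'. (if alive (z + Z s \<omega>) u \<omega>' then \<Phi>n n (\<omega>, Z s \<omega> + Z u \<omega>') else 0)"
  have [measurable]: "\<Phi>n n \<in> borel_measurable (past s \<Otimes>\<^sub>M borel)" for n
    unfolding \<Phi>n_def by measurable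
  have lim: "(\<lambda>n. if P then \<Phi>n n x else 0) \<longlonglongrightarrow> (if P then \<Phi> x else 0)" for P x
    unfolding \<Phi>n_def using min_of_nat_tendsto by simp
  have lim': "(\<lambda>n. \<Phi>n n x) \<longlonglongrightarrow> \<Phi> x" for x
    using lim[of True x] by simp
  have inc: "incseq (\<lambda>n. if P then \<Phi>n n x else 0)" for P x
    unfolding \<Phi>n_def by (auto simp: incseq_def intro: order_trans[OF min.cobounded2 of_nat_mono])
  have inc': "incseq (\<lambda>n \<omega>. if P \<omega> then \<Phi>n n (f \<omega>) else 0)" for P and f :: "'a \<Rightarrow> 'a \<times> real"
    using inc by (auto simp: incseq_def le_fun_def)
  have eq: "(\<integral>\<^sup>+ \<omega>. (if stay z s u \<omega> then \<Phi>n n (\<omega>, Z (s + u) \<omega>) else 0) \<partial>M)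
       = (\<integral>\<^sup>+ \<omega>. \<integral>\<^sup>+ \<omega>'. ?An n \<omega> \<omega>' \<partial>M \<partial>M)" for n
    by (rule markov_bounded[OF s u, of _ "real n"]) (auto simp: \<Phi>n_def ennreal_of_nat_eq_real_of_nat)
  have "(\<lambda>n. \<integral>\<^sup>+ \<omega>. (if stay z s u \<omega> then \<Phi>n n (\<omega>, Z (s + u) \<omega>) else 0) \<partial>M) \<longlonglongrightarrow> ?L"
    by (rule nn_integral_LIMSEQ) (auto intro!: inc' lim lim')
  moreover have "(\<lambda>n. \<integral>\<^sup>+ \<omega>. \<integral>\<^sup>+ \<omega>'. ?An n \<omega> \<omega>' \<partial>M \<partial>M) \<longlonglongrightarrow> ?R"
  proof -
    \<comment> \<open>Values outside \<open>space M\<close> are set to 0 since the limit is required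
      at every point, while measurability of the inner integrand is available for
      \<open>\<omega>\<close> in the space.\<close>
    define I where "I n \<omega> = (if \<omega> \<in> space M then
      \<integral>\<^sup>+ \<omega>'. ?An n \<omega> \<omega>' \<partial>M else 0)" for n \<omega>
    define J where "J \<omega> = (if \<omega> \<in> space M then
      \<integral>\<^sup>+ \<omega>'. ?A \<omega> \<omega>' \<partial>M else 0)" for \<omega>
    have "(\<lambda>n. \<integral>\<^sup>+ \<omega>. I n \<omega> \<partial>M) \<longlonglongrightarrow> (\<integral>\<^sup>+ \<omega>. J \<omega> \<partial>M)"
    proof (rule nn_integral_LIMSEQ)
      show "incseq I"
        using inc by (auto simp: I_def incseq_def le_fun_def intro!: nn_integral_mono)
      show "I n \<in> borel_measurable M" for n
        unfolding I_def by measurable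
      show "(\<lambda>n. I n \<omega>) \<longlonglongrightarrow> J \<omega>" for \<omega>
      proof (cases "\<omega> \<in> space M")
        case True
        then have [measurable]: "\<omega> \<in> space (past s)" by simp
        have "(\<lambda>n. \<integral>\<^sup>+ \<omega>'. ?An n \<omega> \<omega>' \<partial>M)
            \<longlonglongrightarrow> (\<integral>\<^sup>+ \<omega>'. ?A \<omega> \<omega>' \<partial>M)"
          by (rule nn_integral_LIMSEQ) (auto intro!: inc' lim lim')
        then show ?thesis using True by (simp add: I_def J_def)
      qed (simp add: I_def J_def)
    qed
    moreover have "(\<integral>\<^sup>+ \<omega>. J \<omega> \<partial>M) = ?R"
      by (rule nn_integral_cong) (simp add: J_def)
    moreover have "(\<integral>\<^sup>+ \<omega>. I n \<omega> \<partial>M)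
      = (\<integral>\<^sup>+ \<omega>. \<integral>\<^sup>+ \<omega>'. ?An n \<omega> \<omega>' \<partial>M \<partial>M)" for n
      by (rule nn_integral_cong) (simp add: I_def)
    ultimately show ?thesis by simp
  qed
  ultimately show ?thesis unfolding eq by (rule LIMSEQ_unique)
qed

end

section \<open>First passage below a level\<close>

text \<open>Deterministic core of optional stopping on a grid: \<open>a k\<close> stands for the
  exponential functional on survival of \<open>k\<close> steps, \<open>b k\<close> for its value on
  death in the next step, \<open>c k\<close> for the survival probability. Summation by parts
  identifies \<open>1 - (1 - \<theta>) * (\<Sum>k. \<theta> ^ k * c k)\<close> with the sum of
  \<open>\<theta> ^ Suc k * (c k - c (Suc k))\<close>, the mean of \<open>\<theta>\<close> to the
  power of the death index.\<close>

lemma discounted_sum_bounds: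
  fixes a b c :: "nat \<Rightarrow> real"
  assumes E: "E > 1" and a0: "a 0 = A" and rec: "\<And>k. a (Suc k) + b k = E * a k"
    and a: "\<And>k. 0 \<le> a k" "\<And>k. a k \<le> 1" and c: "\<And>k. 0 \<le> c k" "\<And>k. c k \<le> 1" "c 0 = 1"
    and lo: "\<And>k. c k - c (Suc k) \<le> b k" and hi: "\<And>k. b k \<le> B * (c k - c (Suc k)) + \<eta>"
    and \<eta>: "\<eta> \<ge> 0"
  defines "\<theta> \<equiv> 1 / E"
  shows "summable (\<lambda>k. \<theta> ^ k * c k)"
    and "1 - (1 - \<theta>) * (\<Sum>k. \<theta> ^ k * c k) \<le> A"
    and "A \<le> B * (1 - (1 - \<theta>) * (\<Sum>k. \<theta> ^ k * c k)) + \<eta> / (E - 1)"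
proof -
  have \<theta>: "0 < \<theta>" "\<theta> < 1" "\<theta> * E = 1" using E by (auto simp: \<theta>_def)
  show sm: "summable (\<lambda>k. \<theta> ^ k * c k)"
  proof (rule summable_comparison_test')
    show "summable (\<lambda>k. \<theta> ^ k)" using \<theta> by (simp add: summable_geometric)
    show "norm (\<theta> ^ k * c k) \<le> \<theta> ^ k" if "k \<ge> 0" for k
      using \<theta> c(1)[of k] c(2)[of k] by (simp add: mult_left_le)
  qed
  define L where "L K = (\<Sum>k<K. \<theta> ^ Suc k * (c k - c (Suc k)))" for K
  have L: "L K = 1 - (1 - \<theta>) * (\<Sum>k<K. \<theta> ^ k * c k) - \<theta> ^ K * c K" for K
    by (induction K) (auto simp: L_def c algebra_simps)
  \<comment> \<open>The recursion makes \<open>\<theta> ^ Suc k * b k\<close> telescope, as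
    \<open>\<theta> * E = 1\<close>.\<close>
  have T: "(\<Sum>k<K. \<theta> ^ Suc k * b k) = A - \<theta> ^ K * a K" for K
  proof (induction K)
    case (Suc K)
    have "b K = E * a K - a (Suc K)" using rec[of K] by simp
    then have "\<theta> ^ Suc K * b K = \<theta> ^ K * (\<theta> * E) * a K - \<theta> ^ Suc K * a (Suc K)"
      by (simp only: power_Suc right_diff_distrib mult.assoc mult.commute mult.left_commute)
    then show ?case using Suc \<theta> by simp
  qed (simp add: a0)
  \<comment> \<open>By this bound the discounted errors \<open>\<eta>\<close> of all steps together
    cost at most \<open>\<eta> / (E - 1)\<close>.\<close>
  have G: "(\<Sum>k<K. \<theta> ^ Suc k) \<le> 1 / (E - 1)" for K
  proof -
    have "(\<Sum>k<K. \<theta> ^ Suc k) \<le> (\<Sum>k. \<theta> ^ Suc k)"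
      using \<theta> by (intro sum_le_suminf) (auto simp: summable_geometric summable_mult)
    also have "\<dots> = \<theta> * (1 / (1 - \<theta>))"
      using \<theta> by (simp add: suminf_mult summable_geometric suminf_geometric)
    also have "\<dots> = 1 / (E - 1)" using E by (simp add: \<theta>_def field_simps)
    finally show ?thesis .
  qed
  have "L K \<le> A - \<theta> ^ K * a K" for K
    unfolding T[symmetric] L_def using \<theta> lo by (intro sum_mono mult_left_mono) auto
  then have loK: "L K \<le> A" for K
    using \<theta> a by (smt (verit) mult_nonneg_nonneg zero_le_power)
  have hiK: "A - \<theta> ^ K \<le> B * L K + \<eta> / (E - 1)" for K
  proof -
    have "A - \<theta> ^ K \<le> A - \<theta> ^ K * a K" using \<theta> a(1)[of K] a(2)[of K] by (simp add: mult_left_le)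
    also have "\<dots> \<le> (\<Sum>k<K. \<theta> ^ Suc k * (B * (c k - c (Suc k)) + \<eta>))"
      unfolding T[symmetric] using \<theta> hi by (intro sum_mono mult_left_mono) auto
    also have "\<dots> = B * L K + \<eta> * (\<Sum>k<K. \<theta> ^ Suc k)"
      unfolding L_def sum_distrib_left sum.distrib[symmetric] by (intro sum.cong refl) (simp add: algebra_simps)
    also have "\<dots> \<le> B * L K + \<eta> * (1 / (E - 1))"
      using G \<eta> by (intro add_left_mono mult_left_mono)
    finally show ?thesis by simp
  qed
  have p0: "(\<lambda>K. \<theta> ^ K) \<longlonglongrightarrow> 0" using \<theta> by (intro LIMSEQ_power_zero) auto
  have pc: "(\<lambda>K. \<theta> ^ K * c K) \<longlonglongrightarrow> 0"
    by (rule tendsto_sandwich[OF _ _ tendsto_const p0])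
      (use \<theta> c in \<open>auto intro!: always_eventually simp: mult_left_le\<close>)
  have "(\<lambda>K. 1 - (1 - \<theta>) * (\<Sum>k<K. \<theta> ^ k * c k) - \<theta> ^ K * c K) \<longlonglongrightarrow> 1 - (1 - \<theta>) * (\<Sum>k. \<theta> ^ k * c k) - 0"
    by (intro tendsto_intros pc summable_LIMSEQ sm)
  then have Llim: "L \<longlonglongrightarrow> 1 - (1 - \<theta>) * (\<Sum>k. \<theta> ^ k * c k)"
    unfolding L[abs_def, symmetric] by (simp add: L[symmetric])
  show "1 - (1 - \<theta>) * (\<Sum>k. \<theta> ^ k * c k) \<le> A"
    by (rule LIMSEQ_le_const2[OF Llim]) (use loK in auto)
  have "(\<lambda>K. A - \<theta> ^ K) \<longlonglongrightarrow> A - 0" by (intro tendsto_intros p0)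
  moreover have "(\<lambda>K. B * L K + \<eta> / (E - 1)) \<longlonglongrightarrow> B * (1 - (1 - \<theta>) * (\<Sum>k. \<theta> ^ k * c k)) + \<eta> / (E - 1)"
    by (intro tendsto_intros Llim)
  ultimately show "A \<le> B * (1 - (1 - \<theta>) * (\<Sum>k. \<theta> ^ k * c k)) + \<eta> / (E - 1)"
    by (simp add: LIMSEQ_le hiK exI[of _ 0])
qed

lemma nn_integral_exp_density_interval:
  fixes p l h :: real
  assumes "p > 0" "l \<le> h"
  shows "(\<integral>\<^sup>+ t\<in>{l..<h}. ennreal (p * exp (- p * t)) \<partial>lborel) = ennreal (exp (- p * l) - exp (- p * h))"
proof -
  have "(\<integral>\<^sup>+ t\<in>{l..<h}. ennreal (p * exp (- p * t)) \<partial>lborel) = (\<integral>\<^sup>+ t\<in>{l..h}. ennreal (p * exp (- p * t)) \<partial>lborel)"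
    by (rule nn_integral_cong_AE) (use AE_lborel_singleton[of h] in \<open>eventually_elim, auto simp: indicator_def\<close>)
  also have "\<dots> = ennreal (- exp (- p * h) - (- exp (- p * l)))"
    by (rule nn_integral_FTC_Icc) (use assms in \<open>auto intro!: derivative_eq_intros\<close>)
  finally show ?thesis by simp
qed

lemma nn_integral_exp_density_tail:
  fixes p l :: real
  assumes "p > 0"
  shows "(\<integral>\<^sup>+ t\<in>{l..}. ennreal (p * exp (- p * t)) \<partial>lborel) = ennreal (exp (- p * l))"
proof -
  have lim: "((\<lambda>t. - exp (- p * t)) \<longlongrightarrow> 0) at_top" using assms by real_asymp
  have "(\<integral>\<^sup>+ t\<in>{l..}. ennreal (p * exp (- p * t)) \<partial>lborel) = ennreal (0 - (- exp (- p * l)))"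
    by (rule nn_integral_FTC_atLeast[OF _ _ _ lim]) (use assms in \<open>auto intro!: derivative_eq_intros\<close>)
  then show ?thesis by simp
qed

text \<open>The geometric sum is the mean of a step function at an exponential time of rate
  \<open>p\<close>, where step \<open>k\<close> has weight
  \<open>(1 - \<theta>) * \<theta> ^ k\<close> with \<open>\<theta> = exp (- p * \<delta>)\<close>.
  In this form the mesh limit can be taken by dominated convergence.\<close>

lemma nn_integral_exp_density_step:
  fixes c :: "nat \<Rightarrow> real"
  assumes p: "p > 0" and d: "\<delta> > 0" and c: "\<And>k. c k \<ge> 0" and sm: "summable (\<lambda>k. exp (- p * \<delta>) ^ k * c k)"
  shows "(\<integral>\<^sup>+ t\<in>{0..}. ennreal (p * exp (- p * t)) * ennreal (c (nat \<lfloor>t / \<delta>\<rfloor>)) \<partial>lborel)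
    = ennreal ((1 - exp (- p * \<delta>)) * (\<Sum>k. exp (- p * \<delta>) ^ k * c k))"
proof -
  let ?X = "\<lambda>(k :: nat) (t :: real). (ennreal (p * exp (- p * t)) * indicator {real k * \<delta>..<real (Suc k) * \<delta>} t)"
  have pt: "ennreal (p * exp (- p * t)) * ennreal (c (nat \<lfloor>t / \<delta>\<rfloor>)) * indicator {0..} t
     = (\<Sum>k. ennreal (c k) * ?X k t)" for t
  proof (cases "t \<ge> 0")
    case True
    define k0 where "k0 = nat \<lfloor>t / \<delta>\<rfloor>"
    have fl: "t \<in> {real k * \<delta>..<real (Suc k) * \<delta>} \<longleftrightarrow> k = k0" for k
    proof -
      have "t \<in> {real k * \<delta>..<real (Suc k) * \<delta>} \<longleftrightarrow> real k \<le> t / \<delta> \<and> t / \<delta> < real k + 1"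
        using d by (simp add: pos_le_divide_eq pos_divide_less_eq add.commute)
      also have "\<dots> \<longleftrightarrow> \<lfloor>t / \<delta>\<rfloor> = int k" by (auto simp: floor_eq_iff)
      also have "\<dots> \<longleftrightarrow> k = k0" using True d by (auto simp: k0_def)
      finally show ?thesis .
    qed
    have ind: "indicator {real k * \<delta>..<real (Suc k) * \<delta>} t = (if k = k0 then 1 else 0 :: ennreal)" for k
      using fl[of k] by (simp only: indicator_def of_bool_def)
    have "(\<Sum>k. ennreal (c k) * ?X k t)
       = (\<Sum>k\<in>{k0}. ennreal (c k) * ?X k t)"
      unfolding ind by (rule suminf_finite) auto
    also have "\<dots> = ennreal (c k0) * ennreal (p * exp (- p * t))"
      unfolding ind by simp
    finally show ?thesis using True by (simp add: k0_def mult.commute)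
  next
    case False
    have "t \<notin> {real k * \<delta>..<real (Suc k) * \<delta>}" for k
    proof -
      have "0 \<le> real k * \<delta>" using d by simp
      then have "t < real k * \<delta>" using False by linarith
      then show ?thesis by simp
    qed
    then show ?thesis using False by simp
  qed
  have "(\<integral>\<^sup>+ t\<in>{0..}. ennreal (p * exp (- p * t)) * ennreal (c (nat \<lfloor>t / \<delta>\<rfloor>)) \<partial>lborel)
     = (\<Sum>k. \<integral>\<^sup>+ t. ennreal (c k) * ?X k t \<partial>lborel)"
    unfolding pt by (rule nn_integral_suminf) measurable
  also have "\<dots> = (\<Sum>k. ennreal ((1 - exp (- p * \<delta>)) * (exp (- p * \<delta>) ^ k * c k)))"
  proof (rule suminf_cong)
    fix k
    have "(\<integral>\<^sup>+ t. ennreal (c k) * ?X k t \<partial>lborel)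
       = ennreal (c k) * ennreal (exp (- p * (real k * \<delta>)) - exp (- p * (real (Suc k) * \<delta>)))"
      using p d by (subst nn_integral_cmult, simp, subst nn_integral_exp_density_interval) auto
    also have "\<dots> = ennreal (c k * (exp (- p * (real k * \<delta>)) - exp (- p * (real (Suc k) * \<delta>))))"
      using c p d by (subst ennreal_mult) auto
    also have "c k * (exp (- p * (real k * \<delta>)) - exp (- p * (real (Suc k) * \<delta>)))
       = (1 - exp (- p * \<delta>)) * (exp (- p * \<delta>) ^ k * c k)"
      by (simp add: exp_of_nat_mult[symmetric] exp_add[symmetric] algebra_simps)
    finally show "(\<integral>\<^sup>+ t. ennreal (c k) * ?X k t \<partial>lborel)
       = ennreal ((1 - exp (- p * \<delta>)) * (exp (- p * \<delta>) ^ k * c k))" .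
  qed
  also have "\<dots> = ennreal (\<Sum>k. (1 - exp (- p * \<delta>)) * (exp (- p * \<delta>) ^ k * c k))"
    using p d c sm by (intro suminf_ennreal2) (auto intro!: summable_mult mult_nonneg_nonneg)
  also have "(\<Sum>k. (1 - exp (- p * \<delta>)) * (exp (- p * \<delta>) ^ k * c k)) = (1 - exp (- p * \<delta>)) * (\<Sum>k. exp (- p * \<delta>) ^ k * c k)"
    by (rule suminf_mult[OF sm])
  finally show ?thesis .
qed

text \<open>The exponent enters through three properties. Positivity will be inherited from the
  scale function, the quadratic bound from the integrability of the jump measure.\<close>

locale sp_levy = rc_levy +
  fixes \<psi> :: "real \<Rightarrow> real"
  assumes psi_laplace: "\<And>l. l \<ge> 0 \<Longrightarrow> (\<integral>\<^sup>+ \<omega>. ennreal (exp (- l * Z 1 \<omega>)) \<partial>M) = ennreal (exp (\<psi> l))"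
    and psi_pos: "\<And>l. l > 0 \<Longrightarrow> \<psi> l > 0"
    and psi_quadratic: "\<exists>C>0. \<forall>r\<ge>1. \<psi> r \<le> C * r\<^sup>2"
begin

text \<open>\<open>Z 1\<close> is a sum of \<open>2 ^ n\<close> independent increments with the law
  of \<open>Z (1 / 2 ^ n)\<close>, so the transform is a root of
  \<open>exp (\<psi> l)\<close>.\<close>

lemma laplace_dyadic:
  assumes l: "l \<ge> 0"
  shows "(\<integral>\<^sup>+ \<omega>. ennreal (exp (- l * Z (1 / 2 ^ n) \<omega>)) \<partial>M) = ennreal (exp (\<psi> l / 2 ^ n))" (is "?I = _")
proof -
  define N :: nat where "N = 2 ^ n"
  have N: "N > 0" "real N = 2 ^ n" by (auto simp: N_def)
  define X where "X i \<omega> = Z (real (Suc i) / N) \<omega> - Z (real i / N) \<omega>" for i \<omega>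
  have [measurable]: "X i \<in> borel_measurable M" for i unfolding X_def by measurable
  have "indep_vars (\<lambda>_. borel) X {..<N}"
    unfolding X_def by (rule Z_indep) (auto simp: divide_right_mono)
  then have ind: "indep_vars (\<lambda>_. borel) (\<lambda>i \<omega>. ennreal (exp (- l * X i \<omega>))) {..<N}"
    by (rule indep_vars_compose2) measurable
  have same: "(\<integral>\<^sup>+ \<omega>. ennreal (exp (- l * X i \<omega>)) \<partial>M) = ?I" for i
  proof -
    have "X i = (\<lambda>\<omega>. Z (real i / N + 1 / N) \<omega> - Z (real i / N) \<omega>)" by (auto simp: X_def add_divide_distrib add.commute)
    then have d: "distr M borel (X i) = distr M borel (Z (1 / N))" using Z_stat[of "real i / N" "1 / N"] by simp
    have "(\<integral>\<^sup>+ \<omega>. ennreal (exp (- l * X i \<omega>)) \<partial>M) = (\<integral>\<^sup>+ y. ennreal (exp (- l * y)) \<partial>distr M borel (X i))"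
      by (subst nn_integral_distr) auto
    also have "\<dots> = ?I" unfolding d using N by (subst nn_integral_distr) auto
    finally show ?thesis .
  qed
  have "ennreal (exp (\<psi> l)) = (\<integral>\<^sup>+ \<omega>. (\<Prod>i<N. ennreal (exp (- l * X i \<omega>))) \<partial>M)"
    unfolding psi_laplace[OF l, symmetric]
  proof (rule nn_integral_cong)
    fix \<omega> assume "\<omega> \<in> space M"
    then have "Z 1 \<omega> = (\<Sum>i<N. X i \<omega>)"
      unfolding X_def using N by (subst sum_lessThan_telescope) (simp add: Z_0)
    then show "ennreal (exp (- l * Z 1 \<omega>)) = (\<Prod>i<N. ennreal (exp (- l * X i \<omega>)))"
      by (simp add: prod_ennreal sum_distrib_left exp_sum[symmetric] sum_negf)
  qed
  also have "\<dots> = (\<Prod>i<N. \<integral>\<^sup>+ \<omega>. ennreal (exp (- l * X i \<omega>)) \<partial>M)"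
    by (rule indep_vars_nn_integral[OF _ ind]) auto
  also have "\<dots> = ?I ^ N" by (simp only: same) simp
  finally have eq: "?I ^ N = ennreal (exp (\<psi> l))" ..
  \<comment> \<open>A positive power of infinity would be infinite; this has to be excluded before a
    real root is taken.\<close>
  then have "?I \<noteq> \<top>" using N by (auto simp: top_power_ennreal)
  then obtain v where v: "?I = ennreal v" "v \<ge> 0" by (cases ?I) auto
  have "v ^ N = exp (\<psi> l)" using eq v by (simp add: ennreal_power)
  also have "\<dots> = exp (\<psi> l / 2 ^ n) ^ N" using N by (simp add: exp_of_nat_mult[symmetric])
  finally have "v = exp (\<psi> l / 2 ^ n)" using v N power_eq_iff_eq_base[of N v "exp (\<psi> l / 2 ^ n)"] by simp
  then show ?thesis using v by simp
qed

text \<open>Chernoff bound: on the event, \<open>- q * Z\<close> is at most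
  \<open>- (r - q) * \<epsilon> - r * Z\<close>. The parameter \<open>r\<close> stays free so that
  it can grow as the mesh shrinks.\<close>

lemma large_drop_dyadic:
  assumes q: "q \<ge> 0" and e: "\<epsilon> > 0" and r: "r \<ge> q"
  shows "(\<integral>\<^sup>+ \<omega>. (if Z (1 / 2 ^ n) \<omega> < - \<epsilon> then ennreal (exp (- q * Z (1 / 2 ^ n) \<omega>)) else 0) \<partial>M)
    \<le> ennreal (exp (- (r - q) * \<epsilon> + \<psi> r / 2 ^ n))"
proof -
  have "(\<integral>\<^sup>+ \<omega>. (if Z (1 / 2 ^ n) \<omega> < - \<epsilon> then ennreal (exp (- q * Z (1 / 2 ^ n) \<omega>)) else 0) \<partial>M)
     \<le> (\<integral>\<^sup>+ \<omega>. ennreal (exp (- (r - q) * \<epsilon>)) * ennreal (exp (- r * Z (1 / 2 ^ n) \<omega>)) \<partial>M)"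
  proof (rule nn_integral_mono)
    fix \<omega>
    show "(if Z (1 / 2 ^ n) \<omega> < - \<epsilon> then ennreal (exp (- q * Z (1 / 2 ^ n) \<omega>)) else 0)
      \<le> ennreal (exp (- (r - q) * \<epsilon>)) * ennreal (exp (- r * Z (1 / 2 ^ n) \<omega>))"
    proof (cases "Z (1 / 2 ^ n) \<omega> < - \<epsilon>")
      case True
      then have "(r - q) * \<epsilon> \<le> (r - q) * (- Z (1 / 2 ^ n) \<omega>)" using r by (intro mult_left_mono) auto
      then have "- q * Z (1 / 2 ^ n) \<omega> \<le> - (r - q) * \<epsilon> + - r * Z (1 / 2 ^ n) \<omega>" by (simp add: algebra_simps)
      then show ?thesis using True by (simp add: ennreal_mult[symmetric] exp_add[symmetric])
    qed simp
  qed
  also have "\<dots> = ennreal (exp (- (r - q) * \<epsilon>)) * ennreal (exp (\<psi> r / 2 ^ n))"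
    using laplace_dyadic[of r n] q r by (subst nn_integral_cmult) auto
  also have "\<dots> = ennreal (exp (- (r - q) * \<epsilon> + \<psi> r / 2 ^ n))"
    by (simp add: ennreal_mult[symmetric] exp_add[symmetric])
  finally show ?thesis .
qed

section \<open>Optional stopping on a dyadic grid\<close>

definition grid_alive :: "real \<Rightarrow> nat \<Rightarrow> nat \<Rightarrow> 'a \<Rightarrow> bool" where
  "grid_alive z n k \<omega> \<longleftrightarrow> (\<forall>j\<in>{..k}. 0 \<le> z + Z (real j / 2 ^ n) \<omega>)"

lemma grid_alive_measurable[measurable]: "Measurable.pred M (grid_alive z n k)"
  unfolding grid_alive_def by measurable

lemma grid_alive_past: "Measurable.pred (past (real k / 2 ^ n)) (grid_alive z n k)"
  unfolding grid_alive_def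
proof (rule pred_intros_finite(3))
  fix j assume "j \<in> {..k}"
  then have [measurable]: "Z (real j / 2 ^ n) \<in> borel_measurable (past (real k / 2 ^ n))"
    by (intro Z_measurable_past) (auto simp: divide_right_mono)
  show "Measurable.pred (past (real k / 2 ^ n)) (\<lambda>\<omega>. 0 \<le> z + Z (real j / 2 ^ n) \<omega>)" by measurable
qed simp

lemma grid_alive_Suc: "grid_alive z n (Suc k) \<omega> \<longleftrightarrow> grid_alive z n k \<omega> \<and> 0 \<le> z + Z (real (Suc k) / 2 ^ n) \<omega>"
  by (auto simp: grid_alive_def atMost_Suc)

text \<open>Survival up to step \<open>k\<close> and the position there belong to the past, and the
  next increment is independent of it, so the integral factors. Taking \<open>exp (- q * y)\<close>
  for \<open>g y\<close> gives the recursion, its restriction to \<open>y < - \<epsilon>\<close> the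
  error from large drops.\<close>

lemma grid_step:
  fixes g :: "real \<Rightarrow> ennreal"
  assumes [measurable]: "g \<in> borel_measurable borel"
  shows "(\<integral>\<^sup>+ \<omega>. (if grid_alive z n k \<omega> then ennreal (exp (- q * (z + Z (real k / 2 ^ n) \<omega>))) *
        g (Z (real (Suc k) / 2 ^ n) \<omega> - Z (real k / 2 ^ n) \<omega>) else 0) \<partial>M)
    = (\<integral>\<^sup>+ \<omega>. (if grid_alive z n k \<omega> then ennreal (exp (- q * (z + Z (real k / 2 ^ n) \<omega>))) else 0) \<partial>M)
      * (\<integral>\<^sup>+ \<omega>. g (Z (1 / 2 ^ n) \<omega>) \<partial>M)"
proof -
  define s where "s = real k / 2 ^ n"
  have s: "s \<ge> 0" by (simp add: s_def)
  have [measurable]: "Z s \<in> borel_measurable (past s)" using s by (intro Z_measurable_past) auto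
  have [measurable]: "Measurable.pred (past s) (grid_alive z n k)" unfolding s_def by (rule grid_alive_past)
  have comp[measurable]: "(\<lambda>x. snd x 0) \<in> borel_measurable (past s \<Otimes>\<^sub>M PiR 1)"
    by (rule measurable_compose[OF measurable_snd measurable_component_singleton]) simp
  define \<Phi> where "\<Phi> x = (if grid_alive z n k (fst x) then ennreal (exp (- q * (z + Z s (fst x)))) * g (snd x 0) else 0)" for x :: "'a \<times> (nat \<Rightarrow> real)"
  have \<Phi>: "\<Phi> \<in> borel_measurable (past s \<Otimes>\<^sub>M PiR 1)"
    unfolding \<Phi>_def by measurable
  have inc: "increments t (1 / 2 ^ n) 1 \<omega> 0 = Z (t + 1 / 2 ^ n) \<omega> - Z t \<omega>" for t \<omega>
    by (simp add: increments_def)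
  have s1: "s + 1 / 2 ^ n = real (Suc k) / 2 ^ n" by (simp add: s_def add_divide_distrib)
  have "(\<integral>\<^sup>+ \<omega>. \<Phi> (\<omega>, increments s (1 / 2 ^ n) 1 \<omega>) \<partial>M)
     = (\<integral>\<^sup>+ \<omega>. \<integral>\<^sup>+ \<omega>'. \<Phi> (\<omega>, increments 0 (1 / 2 ^ n) 1 \<omega>') \<partial>M \<partial>M)"
    by (rule nn_integral_past_increments[OF s _ _ \<Phi>]) simp_all
  also have "\<dots> = (\<integral>\<^sup>+ \<omega>. (if grid_alive z n k \<omega> then ennreal (exp (- q * (z + Z s \<omega>))) else 0) * (\<integral>\<^sup>+ \<omega>. g (Z (1 / 2 ^ n) \<omega>) \<partial>M) \<partial>M)"
  proof (rule nn_integral_cong)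
    fix \<omega>
    have "(\<integral>\<^sup>+ \<omega>'. \<Phi> (\<omega>, increments 0 (1 / 2 ^ n) 1 \<omega>') \<partial>M)
       = (\<integral>\<^sup>+ \<omega>'. (if grid_alive z n k \<omega> then ennreal (exp (- q * (z + Z s \<omega>))) else 0) * g (Z (1 / 2 ^ n) \<omega>') \<partial>M)"
      unfolding \<Phi>_def fst_conv snd_conv inc by (rule nn_integral_cong) (simp add: Z_0)
    also have "\<dots> = (if grid_alive z n k \<omega> then ennreal (exp (- q * (z + Z s \<omega>))) else 0) * (\<integral>\<^sup>+ \<omega>. g (Z (1 / 2 ^ n) \<omega>) \<partial>M)"
      by (rule nn_integral_cmult) measurable
    finally show "(\<integral>\<^sup>+ \<omega>'. \<Phi> (\<omega>, increments 0 (1 / 2 ^ n) 1 \<omega>') \<partial>M)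
      = (if grid_alive z n k \<omega> then ennreal (exp (- q * (z + Z s \<omega>))) else 0) * (\<integral>\<^sup>+ \<omega>. g (Z (1 / 2 ^ n) \<omega>) \<partial>M)" .
  qed
  also have "\<dots> = (\<integral>\<^sup>+ \<omega>. (if grid_alive z n k \<omega> then ennreal (exp (- q * (z + Z s \<omega>))) else 0) \<partial>M)
      * (\<integral>\<^sup>+ \<omega>. g (Z (1 / 2 ^ n) \<omega>) \<partial>M)"
    by (rule nn_integral_multc) measurable
  finally show ?thesis
    unfolding \<Phi>_def fst_conv snd_conv inc s1 unfolding s_def .
qed

definition grid_survival :: "real \<Rightarrow> nat \<Rightarrow> nat \<Rightarrow> real" where
  "grid_survival z n k = prob {\<omega>\<in>space M. grid_alive z n k \<omega>}"

text \<open>Optional stopping on the grid of mesh \<open>1 / 2 ^ n\<close>. The stopped value lies between \<open>1\<close> and \<open>exp (q * \<epsilon>)\<close>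
  unless the last step drops by more than \<open>\<epsilon>\<close>.\<close>

lemma grid_passage:
  fixes n :: nat
  assumes z: "z \<ge> 0" and q: "q > 0" and e: "\<epsilon> > 0" and r: "r \<ge> q"
  defines "\<theta> \<equiv> exp (- \<psi> q * (1 / 2 ^ n))"
  defines "S \<equiv> (1 - \<theta>) * (\<Sum>k. \<theta> ^ k * grid_survival z n k)"
  shows "summable (\<lambda>k. \<theta> ^ k * grid_survival z n k)"
    and "1 - S \<le> exp (- q * z)"
    and "exp (- q * z) \<le> exp (q * \<epsilon>) * (1 - S) + exp (- (r - q) * \<epsilon> + \<psi> r / 2 ^ n) / (exp (\<psi> q / 2 ^ n) - 1)"
proof -
  let ?dies = "\<lambda>(k :: nat) \<omega>. grid_alive z n k \<omega> \<and> \<not> grid_alive z n (Suc k) \<omega>"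
  let ?e = "\<lambda>(k :: nat) \<omega>. ennreal (exp (- q * (z + Z (real k / 2 ^ n) \<omega>)))"
  let ?inc = "\<lambda>(k :: nat) \<omega>. Z (real (Suc k) / 2 ^ n) \<omega> - Z (real k / 2 ^ n) \<omega>"
  define E where "E = exp (\<psi> q / 2 ^ n)"
  have E: "E > 1" using psi_pos[OF q] by (simp add: E_def)
  have \<theta>: "\<theta> = 1 / E" by (simp add: \<theta>_def E_def exp_minus field_simps)
  define \<eta> where "\<eta> = exp (- (r - q) * \<epsilon> + \<psi> r / 2 ^ n)"
  define Y where "Y k \<omega> = ?e k \<omega>" for k \<omega>
  have [measurable]: "Y k \<in> borel_measurable M" for k unfolding Y_def by measurable
  define \<alpha> where "\<alpha> k = (\<integral>\<^sup>+ \<omega>. (if grid_alive z n k \<omega> then Y k \<omega> else 0) \<partial>M)" for k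
  define \<beta> where "\<beta> k = (\<integral>\<^sup>+ \<omega>. (if ?dies k \<omega> then Y (Suc k) \<omega> else 0) \<partial>M)" for k
  have Ysplit: "Y (Suc k) \<omega> = ?e k \<omega> *
      ennreal (exp (- q * (?inc k \<omega>)))" for k \<omega>
    unfolding Y_def by (simp add: ennreal_mult[symmetric] exp_add[symmetric] algebra_simps del: of_nat_Suc)
  \<comment> \<open>Survival and death in step \<open>Suc k\<close> exhaust the paths alive at
    \<open>k\<close>, and one step multiplies the exponential functional by
    \<open>E\<close>.\<close>
  have rec: "\<alpha> (Suc k) + \<beta> k = ennreal E * \<alpha> k" for k
  proof -
    have "\<alpha> (Suc k) + \<beta> k = (\<integral>\<^sup>+ \<omega>. (if grid_alive z n k \<omega> then Y (Suc k) \<omega> else 0) \<partial>M)"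
      unfolding \<alpha>_def \<beta>_def
      by (subst nn_integral_add[symmetric]) (auto intro!: nn_integral_cong simp: grid_alive_Suc)
    also have "\<dots> = \<alpha> k * (\<integral>\<^sup>+ \<omega>. ennreal (exp (- q * Z (1 / 2 ^ n) \<omega>)) \<partial>M)"
      unfolding Ysplit \<alpha>_def unfolding Y_def by (rule grid_step) measurable
    finally show ?thesis using laplace_dyadic[of q n] q by (simp add: E_def mult.commute)
  qed
  have \<alpha>1: "\<alpha> k \<le> 1" for k
  proof -
    have "\<alpha> k \<le> (\<integral>\<^sup>+ \<omega>. 1 \<partial>M)"
      unfolding \<alpha>_def
    proof (rule nn_integral_mono)
      fix \<omega>
      have "exp (- q * (z + Z (real k / 2 ^ n) \<omega>)) \<le> 1" if "grid_alive z n k \<omega>"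
        using that q by (auto simp: grid_alive_def)
      then show "(if grid_alive z n k \<omega> then Y k \<omega> else 0) \<le> 1" by (simp add: Y_def)
    qed
    then show ?thesis by (simp add: emeasure_space_1)
  qed
  have \<beta>f: "\<beta> k < \<top>" for k
  proof -
    have "\<beta> k \<le> ennreal E * \<alpha> k" using rec[of k] by (metis add.commute le_iff_add)
    also have "\<dots> \<le> ennreal E * 1" by (intro mult_left_mono \<alpha>1) auto
    finally show ?thesis by (simp add: le_less_trans)
  qed
  define d where "d k = grid_survival z n k - grid_survival z n (Suc k)" for k
  have d: "(\<integral>\<^sup>+ \<omega>. (if ?dies k \<omega> then 1 else 0) \<partial>M) = ennreal (d k)" for k
  proof -
    have "(\<integral>\<^sup>+ \<omega>. (if ?dies k \<omega> then 1 else 0) \<partial>M)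
        = (\<integral>\<^sup>+ \<omega>. indicator ({\<omega>\<in>space M. grid_alive z n k \<omega>} - {\<omega>\<in>space M. grid_alive z n (Suc k) \<omega>}) \<omega> \<partial>M)"
      by (intro nn_integral_cong) (auto simp: indicator_def)
    also have "\<dots> = emeasure M ({\<omega>\<in>space M. grid_alive z n k \<omega>} - {\<omega>\<in>space M. grid_alive z n (Suc k) \<omega>})"
      by (rule nn_integral_indicator) measurable
    also have "\<dots> = ennreal (d k)"
      unfolding d_def grid_survival_def emeasure_eq_measure
      by (subst finite_measure_Diff) (auto simp: grid_alive_Suc)
    finally show ?thesis .
  qed
  have d0: "d k \<ge> 0" for k
    unfolding d_def grid_survival_def
    by (simp, intro finite_measure_mono) (auto simp: grid_alive_Suc)
  \<comment> \<open>At death the position is negative, so the exponential functional there is at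
    least 1.\<close>
  have lo: "ennreal (d k) \<le> \<beta> k" for k
    unfolding d[symmetric] \<beta>_def
  proof (rule nn_integral_mono)
    fix \<omega>
    have "0 \<le> - q * (z + Z (real (Suc k) / 2 ^ n) \<omega>)" if "z + Z (real (Suc k) / 2 ^ n) \<omega> < 0"
      using that q by (simp add: mult_nonneg_nonpos del: of_nat_Suc)
    then show "(if ?dies k \<omega> then 1 else 0)
      \<le> (if ?dies k \<omega> then Y (Suc k) \<omega> else 0)"
      by (auto simp: grid_alive_Suc Y_def not_le simp del: of_nat_Suc)
  qed
  have hi: "\<beta> k \<le> ennreal (exp (q * \<epsilon>)) * ennreal (d k) + ennreal \<eta>" for k
  proof -
    \<comment> \<open>Death with a last drop of at most \<open>\<epsilon>\<close> happens at or
      above \<open>- \<epsilon>\<close>, where the functional is at most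
      \<open>exp (q * \<epsilon>)\<close>; \<open>g\<close> collects the larger drops.\<close>
    define g where "g y = (if y < - \<epsilon> then ennreal (exp (- q * y)) else 0)" for y
    have [measurable]: "g \<in> borel_measurable borel" unfolding g_def by measurable
    have "\<beta> k \<le> (\<integral>\<^sup>+ \<omega>. ennreal (exp (q * \<epsilon>)) * (if ?dies k \<omega> then 1 else 0)
        + (if grid_alive z n k \<omega> then ?e k \<omega> *
        g (?inc k \<omega>) else 0) \<partial>M)"
      unfolding \<beta>_def
    proof (rule nn_integral_mono)
      fix \<omega>
      define D where "D = ?inc k \<omega>"
      have Y: "Y (Suc k) \<omega> = ?e k \<omega> * ennreal (exp (- q * D))"
        unfolding D_def by (rule Ysplit)
      have small: "Y (Suc k) \<omega> \<le> ennreal (exp (q * \<epsilon>))" if "grid_alive z n k \<omega>" "D \<ge> - \<epsilon>"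
      proof -
        have "0 \<le> z + Z (real k / 2 ^ n) \<omega>" using that by (auto simp: grid_alive_def)
        then have "- \<epsilon> \<le> z + Z (real (Suc k) / 2 ^ n) \<omega>" using that(2) unfolding D_def by linarith
        then have "q * (- \<epsilon>) \<le> q * (z + Z (real (Suc k) / 2 ^ n) \<omega>)" using q by (intro mult_left_mono) auto
        then have "- q * (z + Z (real (Suc k) / 2 ^ n) \<omega>) \<le> q * \<epsilon>" by linarith
        then show ?thesis by (simp add: Y_def del: of_nat_Suc)
      qed
      show "(if ?dies k \<omega> then Y (Suc k) \<omega> else 0)
        \<le> ennreal (exp (q * \<epsilon>)) * (if ?dies k \<omega> then 1 else 0)
        + (if grid_alive z n k \<omega> then ?e k \<omega> *
        g (?inc k \<omega>) else 0)"
        unfolding D_def[symmetric]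
        using small Y by (cases "D < - \<epsilon>") (auto simp: g_def)
    qed
    also have "\<dots> = (\<integral>\<^sup>+ \<omega>. ennreal (exp (q * \<epsilon>)) * (if ?dies k \<omega> then 1 else 0) \<partial>M)
        + (\<integral>\<^sup>+ \<omega>. (if grid_alive z n k \<omega> then ?e k \<omega> *
        g (?inc k \<omega>) else 0) \<partial>M)"
      by (rule nn_integral_add) measurable
    also have "\<dots> = ennreal (exp (q * \<epsilon>)) * ennreal (d k) + \<alpha> k * (\<integral>\<^sup>+ \<omega>. g (Z (1 / 2 ^ n) \<omega>) \<partial>M)"
      unfolding d[symmetric] \<alpha>_def Y_def
      by (intro arg_cong2[where f = "(+)"] nn_integral_cmult grid_step) measurable
    also have "\<dots> \<le> ennreal (exp (q * \<epsilon>)) * ennreal (d k) + 1 * ennreal \<eta>"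
      unfolding g_def \<eta>_def using q e r
      by (intro add_left_mono mult_mono \<alpha>1 large_drop_dyadic) auto
    finally show ?thesis by simp
  qed
  define a where "a k = enn2real (\<alpha> k)" for k
  define b where "b k = enn2real (\<beta> k)" for k
  have a: "\<alpha> k = ennreal (a k)" "a k \<ge> 0" for k
    using \<alpha>1[of k] by (auto simp: a_def le_less_trans)
  have b: "\<beta> k = ennreal (b k)" "b k \<ge> 0" for k
    using \<beta>f[of k] by (auto simp: b_def)
  have "grid_alive z n 0 \<omega>" if "\<omega> \<in> space M" for \<omega>
    using z that by (simp add: grid_alive_def Z_0)
  then have sp0: "{\<omega>\<in>space M. grid_alive z n 0 \<omega>} = space M" by auto
  have a0: "a 0 = exp (- q * z)"
  proof -
    have "\<alpha> 0 = (\<integral>\<^sup>+ \<omega>. ennreal (exp (- q * z)) \<partial>M)"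
      unfolding \<alpha>_def Y_def using sp0 by (intro nn_integral_cong) (auto simp: Z_0)
    then show ?thesis by (simp add: a_def emeasure_space_1)
  qed
  have main: "a (Suc k) + b k = E * a k" "0 \<le> a k" "a k \<le> 1" "d k \<le> b k" "b k \<le> exp (q * \<epsilon>) * d k + \<eta>" for k
  proof -
    show "a (Suc k) + b k = E * a k"
      using rec[of k] a[of k] a[of "Suc k"] b[of k] E
      by (simp add: ennreal_plus[symmetric] ennreal_mult[symmetric] del: ennreal_plus)
    show "0 \<le> a k" by (rule a)
    show "a k \<le> 1" using \<alpha>1[of k] a by simp
    show "d k \<le> b k" using lo[of k] b by simp
    show "b k \<le> exp (q * \<epsilon>) * d k + \<eta>"
      using hi[of k] b d0[of k]
      by (simp add: ennreal_plus[symmetric] ennreal_mult[symmetric] \<eta>_def del: ennreal_plus)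
  qed
  have c: "0 \<le> grid_survival z n k" "grid_survival z n k \<le> 1" "grid_survival z n 0 = 1" for k
    by (auto simp: grid_survival_def sp0 prob_space)
  have \<eta>: "\<eta> \<ge> 0" by (simp add: \<eta>_def)
  note concl = discounted_sum_bounds[of E a "exp (- q * z)" b "grid_survival z n" "exp (q * \<epsilon>)" \<eta>,
      OF E a0 main(1,2,3) c main(4,5)[unfolded d_def] \<eta>, folded \<theta>, folded S_def]
  show "summable (\<lambda>k. \<theta> ^ k * grid_survival z n k)" by (rule concl)
  show "1 - S \<le> exp (- q * z)" by (rule concl)
  show "exp (- q * z) \<le> exp (q * \<epsilon>) * (1 - S) + exp (- (r - q) * \<epsilon> + \<psi> r / 2 ^ n) / (exp (\<psi> q / 2 ^ n) - 1)"
    using concl(3) unfolding \<eta>_def E_def .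
qed

section \<open>From the grid to continuous time\<close>

definition survival :: "real \<Rightarrow> real \<Rightarrow> ennreal" where
  "survival z t = emeasure M {\<omega>\<in>space M. alive z t \<omega>}"

text \<open>The grids only check dyadic times up to \<open>t\<close>, and survival may still fail at
  a non-dyadic endpoint. The limit is therefore the dyadic event; the gap disappears after
  integration over \<open>t\<close>.\<close>

lemma grid_survival_limit:
  "(\<lambda>n. ennreal (grid_survival z n (nat \<lfloor>t / (1 / 2 ^ n)\<rfloor>)))
     \<longlonglongrightarrow> emeasure M {\<omega>\<in>space M. \<forall>n k. real k / 2 ^ n \<le> t \<longrightarrow> 0 \<le> z + Z (real k / 2 ^ n) \<omega>}" (is "_ \<longlonglongrightarrow> emeasure M ?D")
  if t: "t \<ge> 0"
proof -
  define A where "A n = {\<omega>\<in>space M. grid_alive z n (nat \<lfloor>t / (1 / 2 ^ n)\<rfloor>) \<omega>}" for n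
  have A: "A n = {\<omega>\<in>space M. \<forall>k. real k / 2 ^ n \<le> t \<longrightarrow> 0 \<le> z + Z (real k / 2 ^ n) \<omega>}" for n
  proof -
    have "k \<le> nat \<lfloor>t / (1 / 2 ^ n)\<rfloor> \<longleftrightarrow> real k / 2 ^ n \<le> t" for k
      using t by (auto simp: le_nat_floor le_nat_iff le_floor_iff divide_le_eq)
    then show ?thesis by (auto simp: A_def grid_alive_def)
  qed
  have "decseq A"
  proof (rule decseq_SucI, rule subsetI)
    fix n \<omega> assume *: "\<omega> \<in> A (Suc n)"
    show "\<omega> \<in> A n"
      unfolding A
    proof (intro CollectI conjI allI impI)
      show "\<omega> \<in> space M" using * by (simp add: A)
      fix k :: nat assume "real k / 2 ^ n \<le> t"
      moreover have eq: "real (2 * k) / 2 ^ Suc n = real k / 2 ^ n" by simp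
      ultimately have "0 \<le> z + Z (real (2 * k) / 2 ^ Suc n) \<omega>"
        using * unfolding A mem_Collect_eq by metis
      then show "0 \<le> z + Z (real k / 2 ^ n) \<omega>" unfolding eq .
    qed
  qed
  moreover have "range A \<subseteq> events" unfolding A_def by auto
  ultimately have "(\<lambda>n. emeasure M (A n)) \<longlonglongrightarrow> emeasure M (\<Inter>n. A n)"
    by (intro Lim_emeasure_decseq) auto
  moreover have "(\<Inter>n. A n) = ?D" unfolding A by auto
  ultimately show ?thesis
    by (simp add: A_def emeasure_eq_measure grid_survival_def)
qed

end

context rc_levy begin

lemma nn_integral_swap:
  assumes "(\<lambda>(t :: real, \<omega>). f t \<omega>) \<in> borel_measurable (borel \<Otimes>\<^sub>M M)"
  shows "(\<integral>\<^sup>+ t. \<integral>\<^sup>+ \<omega>. f t \<omega> \<partial>M \<partial>lborel) = (\<integral>\<^sup>+ \<omega>. \<integral>\<^sup>+ t. f t \<omega> \<partial>lborel \<partial>M)"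
proof -
  interpret LM: pair_sigma_finite lborel M ..
  show ?thesis by (rule LM.Fubini'[symmetric]) (use assms in measurable)
qed

text \<open>Dyadic survival up to \<open>t\<close> implies true survival up to every
  \<open>s < t\<close>, by right limits along dyadic times below \<open>t\<close>. Hence the two
  conditions disagree for at most one \<open>t\<close>.\<close>

lemma AE_dyadic_alive_iff_alive:
  assumes \<omega>: "\<omega> \<in> space M"
  shows "AE t in lborel. t \<ge> 0 \<longrightarrow> (\<forall>n k. real k / 2 ^ n \<le> t \<longrightarrow> 0 \<le> z + Z (real k / 2 ^ n) \<omega>) = alive z t \<omega>"
proof -
  define D where "D t \<longleftrightarrow> (\<forall>n k. real k / 2 ^ n \<le> t \<longrightarrow> 0 \<le> z + Z (real k / 2 ^ n) \<omega>)" for t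
  have up: "alive z t \<omega> \<Longrightarrow> D t" for t by (auto simp: D_def stay_def)
  have dn: "alive z s \<omega>" if "D t" "s < t" for s t
    unfolding stay_def
  proof
    fix r assume r: "r \<in> {0..s}"
    have "(\<lambda>n. Z (grid_up n r) \<omega>) \<longlonglongrightarrow> Z r \<omega>"
      by (rule Z_tendsto_from_right[OF \<omega>]) (use r grid_up in auto)
    then have lim: "(\<lambda>n. z + Z (grid_up n r) \<omega>) \<longlonglongrightarrow> z + Z r \<omega>" by (intro tendsto_intros)
    have "eventually (\<lambda>n. grid_up n r < t) sequentially"
      by (rule order_tendstoD(2)[OF grid_up(2)]) (use r that in auto)
    then have "eventually (\<lambda>n. 0 \<le> z + Z (grid_up n r) \<omega>) sequentially"
    proof eventually_elim
      case (elim n)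
      have "0 \<le> 2 ^ n * r" using r by simp
      then have "\<lfloor>2 ^ n * r\<rfloor> + 1 \<ge> 0" by (simp only: zero_le_floor add_nonneg_nonneg zero_le_one)
      then have "grid_up n r = real (nat (\<lfloor>2 ^ n * r\<rfloor> + 1)) / 2 ^ n" by (simp add: grid_up_def)
      then show ?case using \<open>D t\<close> elim unfolding D_def by (metis less_imp_le)
    qed
    then have "0 \<le> z + Z r \<omega>" by (rule tendsto_lowerbound[OF lim]) simp
    then show "0 \<le> z + Z (0 + r) \<omega>" by simp
  qed
  have "\<exists>t0. \<forall>t. D t \<and> \<not> alive z t \<omega> \<longrightarrow> t = t0"
  proof (cases "\<exists>t. D t \<and> \<not> alive z t \<omega>")
    case True
    then obtain t0 where t0: "D t0" "\<not> alive z t0 \<omega>" by blast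
    show ?thesis using dn t0 by (intro exI[of _ t0] allI impI) (metis linorder_less_linear)
  qed blast
  then obtain t0 where "\<And>t. D t \<Longrightarrow> \<not> alive z t \<omega> \<Longrightarrow> t = t0" by blast
  then show ?thesis
    unfolding D_def[symmetric] using AE_lborel_singleton[of t0] up by (auto elim!: eventually_mono)
qed

end

lemma borel_measurable_indicator_Ici[measurable (raw)]:
  fixes f g :: "'b \<Rightarrow> real"
  assumes [measurable]: "f \<in> borel_measurable N" "g \<in> borel_measurable N"
  shows "(\<lambda>x. indicator {f x..} (g x) :: ennreal) \<in> borel_measurable N"
proof -
  have "(\<lambda>x. if f x \<le> g x then 1 else 0 :: ennreal) \<in> borel_measurable N" by measurable
  then show ?thesis by (simp add: indicator_def of_bool_def)
qed

lemma ennreal_at_most_real_limit: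
  fixes S :: "nat \<Rightarrow> real"
  assumes "(\<lambda>n. ennreal (S n)) \<longlonglongrightarrow> L" "\<And>n. 0 \<le> S n" "\<And>n. S n \<le> C"
  obtains l where "L = ennreal l" "0 \<le> l" "S \<longlonglongrightarrow> l"
proof -
  have "L \<le> ennreal C" by (rule LIMSEQ_le_const2[OF assms(1)]) (use assms in \<open>auto intro!: ennreal_leI\<close>)
  then obtain l where l: "L = ennreal l" "0 \<le> l" by (cases L) (auto simp: top_unique)
  then have "S \<longlonglongrightarrow> l" using assms by (simp add: tendsto_ennreal_iff)
  with l show ?thesis by (rule that)
qed

text \<open>Integrating \<open>eq\<close> over all \<open>s\<close> gives \<open>m r\<close> the
  weight \<open>1 - (1 - exp (- p * r))\<close>, which is the claim formally. The integral of
  \<open>m\<close> can be infinite, so integration stops at \<open>T\<close>; the remainder is at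
  most \<open>m T / p\<close> and vanishes.\<close>

lemma discounted_potential_identity:
  fixes m k :: "real \<Rightarrow> ennreal"
  assumes [measurable]: "m \<in> borel_measurable borel" "k \<in> borel_measurable borel" and p: "p > 0"
    and m1: "\<And>t. m t \<le> 1" and anti: "\<And>s t. s \<le> t \<Longrightarrow> m t \<le> m s" and m0: "(\<lambda>n. m (real n)) \<longlonglongrightarrow> 0"
    and eq: "\<And>s. s \<ge> 0 \<Longrightarrow> k s + (\<integral>\<^sup>+ t\<in>{0..}. ennreal (p * exp (- p * t)) * m (s + t) \<partial>lborel) = m s"
  shows "(\<integral>\<^sup>+ s\<in>{0..}. k s \<partial>lborel) = (\<integral>\<^sup>+ t\<in>{0..}. ennreal (exp (- p * t)) * m t \<partial>lborel)" (is "?K = ?R")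
proof -
  let ?X = "\<lambda>(s :: real) (r :: real). ennreal (p * exp (- p * (r - s))) * m r * indicator {s..} r"
  let ?Y = "\<lambda>(T :: real) (r :: real). ennreal (exp (- p * (r - T))) * m r"
  have T: "(\<integral>\<^sup>+ s\<in>{0..T}. k s \<partial>lborel) + (\<integral>\<^sup>+ r\<in>{T<..}. ?Y T r \<partial>lborel) = ?R"
    if T: "T \<ge> 0" for T
  proof -
    have shift: "(\<integral>\<^sup>+ t\<in>{0..}. ennreal (p * exp (- p * t)) * m (s + t) \<partial>lborel)
       = (\<integral>\<^sup>+ r. ?X s r \<partial>lborel)" for s
      by (subst (2) nn_integral_real_affine[where c = 1 and t = s])
        (auto intro!: nn_integral_cong simp: indicator_def)
    have kk: "k s + (\<integral>\<^sup>+ r. ennreal (p * exp (- (p * (r - s)))) * m r * indicator {s..} r \<partial>lborel) = m s" if "s \<ge> 0" for s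
      using eq[OF that] unfolding shift by simp
    \<comment> \<open>The exponential left at the upper end \<open>min r T\<close> is 1 for
      \<open>r \<le> T\<close> and \<open>exp (- p * (r - T))\<close> beyond; the latter is the
      remainder.\<close>
    have inner: "(\<integral>\<^sup>+ s. ?X s r * indicator {0..T} s \<partial>lborel)
        + ennreal (exp (- p * r)) * m r * indicator {0..} r
      = m r * indicator {0..T} r + ?Y T r * indicator {T<..} r" for r
    proof (cases "r \<ge> 0")
      case True
      have "(\<integral>\<^sup>+ s. ?X s r * indicator {0..T} s \<partial>lborel)
         = (\<integral>\<^sup>+ s. m r * (ennreal (p * exp (- p * (r - s))) * indicator {0..min r T} s) \<partial>lborel)"
        by (intro nn_integral_cong) (auto simp: indicator_def mult.commute)
      also have "\<dots> = m r * (\<integral>\<^sup>+ s\<in>{0..min r T}. ennreal (p * exp (- p * (r - s))) \<partial>lborel)"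
        by (rule nn_integral_cmult) measurable
      also have "(\<integral>\<^sup>+ s\<in>{0..min r T}. ennreal (p * exp (- p * (r - s))) \<partial>lborel)
         = ennreal (exp (- p * (r - min r T)) - exp (- p * (r - 0)))"
        by (rule nn_integral_FTC_Icc) (use True T p in \<open>auto intro!: derivative_eq_intros\<close>)
      finally have "(\<integral>\<^sup>+ s. ?X s r * indicator {0..T} s \<partial>lborel)
        + ennreal (exp (- p * r)) * m r = m r * (ennreal (exp (- p * (r - min r T)) - exp (- p * r)) + ennreal (exp (- p * r)))"
        by (simp add: distrib_left mult.commute)
      also have "\<dots> = m r * ennreal (exp (- p * (r - min r T)))"
        using True T p by (subst ennreal_plus[symmetric]) (auto simp: min_def)
      finally show ?thesis using True T by (auto simp: indicator_def min_def mult.commute)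
    next
      case False
      then have z: "indicator {s..} r * indicator {0..T} s = (0 :: ennreal)" for s by (auto simp: indicator_def)
      show ?thesis using False T by (simp add: mult.assoc z)
    qed
    have "(\<integral>\<^sup>+ s\<in>{0..T}. k s \<partial>lborel) + (\<integral>\<^sup>+ s. (\<integral>\<^sup>+ r. ?X s r \<partial>lborel) * indicator {0..T} s \<partial>lborel)
       = (\<integral>\<^sup>+ s\<in>{0..T}. m s \<partial>lborel)"
      by (subst nn_integral_add[symmetric])
        (auto intro!: nn_integral_cong simp: kk split: split_indicator)
    also have "(\<integral>\<^sup>+ s. (\<integral>\<^sup>+ r. ?X s r \<partial>lborel) * indicator {0..T} s \<partial>lborel)
       = (\<integral>\<^sup>+ s. \<integral>\<^sup>+ r. ?X s r * indicator {0..T} s \<partial>lborel \<partial>lborel)"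
      by (intro nn_integral_cong nn_integral_multc[symmetric]) measurable
    also have "\<dots> = (\<integral>\<^sup>+ r. \<integral>\<^sup>+ s. ?X s r * indicator {0..T} s \<partial>lborel \<partial>lborel)"
      by (rule lborel_pair.Fubini') measurable
    finally have e1: "(\<integral>\<^sup>+ s\<in>{0..T}. k s \<partial>lborel)
        + (\<integral>\<^sup>+ r. \<integral>\<^sup>+ s. ?X s r * indicator {0..T} s \<partial>lborel \<partial>lborel)
       = (\<integral>\<^sup>+ s\<in>{0..T}. m s \<partial>lborel)" (is "?kT + ?J = ?mT") .
    have e2: "?J + ?R = ?mT + (\<integral>\<^sup>+ r\<in>{T<..}. ?Y T r \<partial>lborel)"
      by (subst (1 2) nn_integral_add[symmetric]) (auto simp: inner[simplified])
    \<comment> \<open>Finiteness over a bounded interval permits the final cancellation.\<close>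
    have "?mT \<le> (\<integral>\<^sup>+ s\<in>{0..T}. 1 \<partial>lborel)"
      by (intro nn_integral_mono) (auto simp: indicator_def m1)
    also have "\<dots> < \<top>" using T by simp
    finally have mT: "?mT < \<top>" .
    have "?mT + (?kT + (\<integral>\<^sup>+ r\<in>{T<..}. ?Y T r \<partial>lborel))
        = ?kT + (?mT + (\<integral>\<^sup>+ r\<in>{T<..}. ?Y T r \<partial>lborel))"
      by (rule add.left_commute)
    also have "\<dots> = ?kT + ?J + ?R" unfolding e2[symmetric] by (rule add.assoc[symmetric])
    also have "\<dots> = ?mT + ?R" unfolding e1 ..
    finally show ?thesis using mT unfolding ennreal_add_left_cancel by auto
  qed
  have "(\<lambda>n. (\<integral>\<^sup>+ s\<in>{0..real n}. k s \<partial>lborel)) \<longlonglongrightarrow> ?K"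
  proof (rule nn_integral_LIMSEQ)
    show "incseq (\<lambda>n s. k s * indicator {0..real n} s)" by (auto simp: incseq_def le_fun_def indicator_def)
    show "(\<lambda>n. k s * indicator {0..real n} s) \<longlonglongrightarrow> k s * indicator {0..} s" for s
    proof -
      obtain n0 :: nat where "s \<le> n0" using real_arch_simple by blast
      then have "k s * indicator {0..real n} s = k s * indicator {0..} s" if "n \<ge> n0" for n
        using that by (auto simp: indicator_def dest!: of_nat_mono[where 'a = real])
      then show ?thesis by (intro tendsto_eventually) (auto simp: eventually_sequentially)
    qed
  qed measurable
  moreover have "(\<lambda>n. (\<integral>\<^sup>+ r\<in>{real n<..}. ennreal (exp (- p * (r - real n))) * m r \<partial>lborel)) \<longlonglongrightarrow> 0"
  proof (rule tendsto_sandwich[OF _ _ tendsto_const])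
    have "(\<integral>\<^sup>+ r\<in>{T<..}. ?Y T r \<partial>lborel) \<le> ennreal (1 / p) * m T" for T
    proof -
      have "(\<integral>\<^sup>+ r\<in>{T<..}. ?Y T r \<partial>lborel)
        \<le> (\<integral>\<^sup>+ r. (ennreal (exp (p * T) / p) * m T) * (ennreal (p * exp (- p * r)) * indicator {T..} r) \<partial>lborel)"
      proof (rule nn_integral_mono)
        fix r
        show "?Y T r * indicator {T<..} r
          \<le> (ennreal (exp (p * T) / p) * m T) * (ennreal (p * exp (- p * r)) * indicator {T..} r)"
        proof (cases "r > T")
          case True
          have e: "ennreal (exp (- p * (r - T))) = ennreal (exp (p * T) / p) * ennreal (p * exp (- p * r))"
            using p by (subst ennreal_mult[symmetric]) (auto simp: exp_add[symmetric] algebra_simps)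
          have "?Y T r \<le> ennreal (exp (- p * (r - T))) * m T"
            by (intro mult_left_mono anti) (use True in auto)
          also have "\<dots> = (ennreal (exp (p * T) / p) * m T) * ennreal (p * exp (- p * r))"
            unfolding e by (simp only: mult.assoc mult.commute mult.left_commute)
          finally show ?thesis using True by simp
        qed simp
      qed
      also have "\<dots> = (ennreal (exp (p * T) / p) * m T) * ennreal (exp (- p * T))"
        using p by (subst nn_integral_cmult, simp, subst nn_integral_exp_density_tail) auto
      also have "\<dots> = ennreal (exp (p * T) / p * exp (- p * T)) * m T"
        using p by (subst ennreal_mult) (auto simp: mult_ac)
      also have "exp (p * T) / p * exp (- p * T) = 1 / p"
        by (simp add: exp_minus field_simps)
      finally show ?thesis .
    qed
    then show "eventually (\<lambda>n. (\<integral>\<^sup>+ r\<in>{real n<..}. ennreal (exp (- p * (r - real n))) * m r \<partial>lborel) \<le> ennreal (1 / p) * m (real n)) sequentially"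
      by simp
    show "(\<lambda>n. ennreal (1 / p) * m (real n)) \<longlonglongrightarrow> 0"
      using tendsto_mult_ennreal[OF tendsto_const[of "ennreal (1 / p)"] m0] by simp
  qed simp
  ultimately have "(\<lambda>n. (\<integral>\<^sup>+ s\<in>{0..real n}. k s \<partial>lborel) + (\<integral>\<^sup>+ r\<in>{real n<..}. ennreal (exp (- p * (r - real n))) * m r \<partial>lborel)) \<longlonglongrightarrow> ?K + 0"
    by (rule tendsto_add)
  then show ?thesis using T by (simp add: LIMSEQ_const_iff)
qed

context sp_levy begin

lemma survival_eq: "survival z t = (\<integral>\<^sup>+ \<omega>. (if alive z t \<omega> then 1 else 0) \<partial>M)"
proof -
  have "(\<integral>\<^sup>+ \<omega>. (if alive z t \<omega> then 1 else 0) \<partial>M) = (\<integral>\<^sup>+ \<omega>. indicator {\<omega>\<in>space M. alive z t \<omega>} \<omega> \<partial>M)"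
    by (intro nn_integral_cong) (auto simp: indicator_def)
  then show ?thesis by (simp add: survival_def)
qed

lemma survival_measurable[measurable (raw)]:
  assumes [measurable]: "f \<in> borel_measurable N" "g \<in> borel_measurable N"
  shows "(\<lambda>x. survival (f x) (g x)) \<in> borel_measurable N"
  unfolding survival_eq by measurable

lemma survival_le_1: "survival z t \<le> 1"
  unfolding survival_def by (rule measure_le_1)

lemma survival_antimono: "s \<le> t \<Longrightarrow> survival z t \<le> survival z s"
  unfolding survival_def by (rule emeasure_mono) (auto intro: alive_mono)

text \<open>Exponential decay in \<open>sqrt (2 ^ n)\<close> beats the factor
  \<open>2 ^ n / p\<close>, the number of grid steps in a time span of length
  \<open>1 / p\<close>.\<close>

lemma overshoot_error_tendsto_0:
  assumes p: "p > 0" and e: "\<epsilon> > (0 :: real)"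
  shows "(\<lambda>n. exp (q * \<epsilon> + C - sqrt (2 ^ n) * \<epsilon>) * (2 ^ n / p)) \<longlonglongrightarrow> 0"
  using assms by real_asymp

text \<open>Letting the mesh tend to \<open>0\<close> with \<open>r = sqrt (2 ^ n)\<close> in the grid estimate makes the overshoot error vanish,
  since \<open>\<psi> r = O(r\<^sup>2)\<close>. The lower barrier is thus crossed continuously.\<close>

lemma passage_laplace:
  assumes z: "z \<ge> 0" and q: "q > 0"
  shows "(\<integral>\<^sup>+ t\<in>{0..}. ennreal (\<psi> q * exp (- \<psi> q * t)) * survival z t \<partial>lborel) = ennreal (1 - exp (- q * z))"
proof -
  let ?c = "\<lambda>(n :: nat) (t :: real). ennreal (grid_survival z n (nat \<lfloor>t / (1 / 2 ^ n)\<rfloor>))"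
  define p where "p = \<psi> q"
  let ?X = "\<lambda>(t :: real). ennreal (p * exp (- p * t))"
  have p: "p > 0" using psi_pos[OF q] by (simp add: p_def)
  define \<theta> where "\<theta> n = exp (- p * (1 / 2 ^ n))" for n :: nat
  \<comment> \<open>The probability that the grid walk survives an independent exponential time of
    rate \<open>p\<close>.\<close>
  define S where "S n = (1 - \<theta> n) * (\<Sum>k. \<theta> n ^ k * grid_survival z n k)" for n
  note gp = grid_passage[OF z q, folded p_def, folded \<theta>_def, folded S_def]
  have sm: "summable (\<lambda>k. \<theta> n ^ k * grid_survival z n k)" for n
    using gp(1)[of 1 q n] by simp
  have lo: "1 - S n \<le> exp (- q * z)" for n
    using gp(2)[of 1 q n] by simp
  have S: "ennreal (S n) = (\<integral>\<^sup>+ t\<in>{0..}. ?X t * ?c n t \<partial>lborel)" for n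
    unfolding S_def \<theta>_def
    by (rule nn_integral_exp_density_step[symmetric]) (use p sm[of n] in \<open>auto simp: grid_survival_def \<theta>_def\<close>)
  have S0: "S n \<ge> 0" for n
  proof -
    have "\<theta> n \<le> 1" using p by (simp add: \<theta>_def)
    then show ?thesis unfolding S_def
      by (intro mult_nonneg_nonneg suminf_nonneg sm) (auto simp: grid_survival_def \<theta>_def)
  qed
  have total: "(\<integral>\<^sup>+ t\<in>{0..}. ?X t \<partial>lborel) = 1"
    using nn_integral_exp_density_tail[OF p, of 0] by simp
  have S1: "S n \<le> 1" for n
  proof -
    have "ennreal (S n) \<le> (\<integral>\<^sup>+ t\<in>{0..}. ?X t \<partial>lborel)"
      unfolding S
    proof (intro nn_integral_mono mult_right_mono)
      show "?X t * ?c n t \<le> ?X t" for t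
        using mult_left_mono[of "?c n t" 1 "?X t"]
        by (simp add: grid_survival_def)
    qed simp
    then show ?thesis unfolding total by simp
  qed
  define D where "D t \<omega> \<longleftrightarrow> (\<forall>n k. real k / 2 ^ n \<le> t \<longrightarrow> 0 \<le> z + Z (real k / 2 ^ n) \<omega>)" for t \<omega>
  let ?d = "\<lambda>(t :: real). emeasure M {\<omega>\<in>space M. D t \<omega>}"
  have D[measurable (raw)]: "Measurable.pred N (\<lambda>x. D (f x) (g x))"
    if [measurable]: "f \<in> borel_measurable N" "g \<in> measurable N M" for f g and N :: "'c measure"
    unfolding D_def by measurable
  have D'[measurable]: "Measurable.pred (borel \<Otimes>\<^sub>M M) (\<lambda>x. D (fst x) (snd x))"
    unfolding D_def by measurable
  have emD: "?d t = (\<integral>\<^sup>+ \<omega>. (if D t \<omega> then 1 else 0) \<partial>M)" for t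
  proof -
    have [measurable]: "Measurable.pred M (D t)" unfolding D_def by measurable
    have "(\<integral>\<^sup>+ \<omega>. (if D t \<omega> then 1 else 0) \<partial>M) = (\<integral>\<^sup>+ \<omega>. indicator {\<omega>\<in>space M. D t \<omega>} \<omega> \<partial>M)"
      by (intro nn_integral_cong) (auto simp: indicator_def)
    then show ?thesis by simp
  qed
  have Dm: "(\<lambda>t. ?d t) \<in> borel_measurable borel"
  proof -
    have "(\<lambda>(t, \<omega>). if D t \<omega> then 1 else 0 :: ennreal) \<in> borel_measurable (borel \<Otimes>\<^sub>M M)"
      unfolding split_beta' by measurable
    then show ?thesis unfolding emD by measurable
  qed
  have lim: "(\<lambda>n. ennreal (S n)) \<longlonglongrightarrow> (\<integral>\<^sup>+ t\<in>{0..}. ?X t * ?d t \<partial>lborel)"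
    unfolding S
  proof (rule nn_integral_dominated_convergence[where w = "\<lambda>t. ?X t * indicator {0..} t"])
    show "(\<lambda>t. ?X t * ?c n t * indicator {0..} t) \<in> borel_measurable lborel" for n
      by measurable
    show "(\<lambda>t. ?X t * ?d t * indicator {0..} t) \<in> borel_measurable lborel"
      using Dm by measurable
    show "AE t in lborel. (\<lambda>n. ?X t * ?c n t * indicator {0..} t)
        \<longlonglongrightarrow> ?X t * ?d t * indicator {0..} t"
    proof (rule AE_I2)
      fix t :: real
      show "(\<lambda>n. ?X t * ?c n t * indicator {0..} t)
        \<longlonglongrightarrow> ?X t * ?d t * indicator {0..} t"
      proof (cases "t \<ge> 0")
        case True
        show ?thesis using True p
          using grid_survival_limit[OF True, of z] by (auto intro!: tendsto_mult_ennreal simp: D_def)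
      qed simp
    qed
    show "AE t in lborel. ?X t * ?c n t * indicator {0..} t
        \<le> ?X t * indicator {0..} t" for n
    proof (intro AE_I2 mult_right_mono)
      fix t
      show "?X t * ?c n t \<le> ?X t"
        using mult_left_mono[of "?c n t" 1 "?X t"]
        by (simp add: grid_survival_def)
    qed simp
  qed (use total in auto)
  also have "(\<integral>\<^sup>+ t\<in>{0..}. ?X t * ?d t \<partial>lborel)
     = (\<integral>\<^sup>+ t. \<integral>\<^sup>+ \<omega>. ?X t * (if D t \<omega> then 1 else 0) * indicator {0..} t \<partial>M \<partial>lborel)"
  proof (rule nn_integral_cong)
    fix t
    have [measurable]: "Measurable.pred M (D t)" unfolding D_def by measurable
    show "?X t * ?d t * indicator {0..} t
      = (\<integral>\<^sup>+ \<omega>. ?X t * (if D t \<omega> then 1 else 0) * indicator {0..} t \<partial>M)"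
      unfolding emD by (subst nn_integral_cmult[symmetric], measurable, subst nn_integral_multc[symmetric], measurable)
  qed
  also have "\<dots> = (\<integral>\<^sup>+ \<omega>. \<integral>\<^sup>+ t. ?X t * (if D t \<omega> then 1 else 0) * indicator {0..} t \<partial>lborel \<partial>M)"
    by (rule nn_integral_swap) (unfold split_beta', measurable)
  \<comment> \<open>Under the time integral dyadic survival may be replaced by survival, because on
    each path they differ for at most one \<open>t\<close>.\<close>
  also have "\<dots> = (\<integral>\<^sup>+ \<omega>. \<integral>\<^sup>+ t. ?X t * (if alive z t \<omega> then 1 else 0) * indicator {0..} t \<partial>lborel \<partial>M)"
  proof (rule nn_integral_cong, rule nn_integral_cong_AE)
    fix \<omega> assume "\<omega> \<in> space M"
    from AE_dyadic_alive_iff_alive[OF this, of z]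
    show "AE t in lborel. ?X t * (if D t \<omega> then 1 else 0) * indicator {0..} t
      = ?X t * (if alive z t \<omega> then 1 else 0) * indicator {0..} t"
      by eventually_elim (auto simp: D_def indicator_def)
  qed
  also have "\<dots> = (\<integral>\<^sup>+ t. \<integral>\<^sup>+ \<omega>. ?X t * (if alive z t \<omega> then 1 else 0) * indicator {0..} t \<partial>M \<partial>lborel)"
    by (rule nn_integral_swap[symmetric]) measurable
  also have "\<dots> = (\<integral>\<^sup>+ t\<in>{0..}. ?X t * survival z t \<partial>lborel)"
    unfolding survival_eq
  proof (rule nn_integral_cong)
    fix t
    have "(\<integral>\<^sup>+ \<omega>. ?X t * (if alive z t \<omega> then 1 else 0) * indicator {0..} t \<partial>M)
      = (\<integral>\<^sup>+ \<omega>. ?X t * (if alive z t \<omega> then 1 else 0) \<partial>M) * indicator {0..} t"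
      by (rule nn_integral_multc) measurable
    also have "(\<integral>\<^sup>+ \<omega>. ?X t * (if alive z t \<omega> then 1 else 0) \<partial>M)
      = ?X t * (\<integral>\<^sup>+ \<omega>. (if alive z t \<omega> then 1 else 0) \<partial>M)"
      by (rule nn_integral_cmult) measurable
    finally show "(\<integral>\<^sup>+ \<omega>. ?X t * (if alive z t \<omega> then 1 else 0) * indicator {0..} t \<partial>M)
      = ?X t * (\<integral>\<^sup>+ \<omega>. (if alive z t \<omega> then 1 else 0) \<partial>M) * indicator {0..} t" .
  qed
  finally have lim: "(\<lambda>n. ennreal (S n)) \<longlonglongrightarrow> (\<integral>\<^sup>+ t\<in>{0..}. ?X t * survival z t \<partial>lborel)" .
  obtain l where l: "(\<integral>\<^sup>+ t\<in>{0..}. ?X t * survival z t \<partial>lborel) = ennreal l" "0 \<le> l" "S \<longlonglongrightarrow> l"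
    using ennreal_at_most_real_limit[OF lim S0 S1] by metis
  have l1: "1 - l \<le> exp (- q * z)"
    by (rule LIMSEQ_le_const2[OF tendsto_diff[OF tendsto_const l(3)]]) (use lo in auto)
  have l2: "exp (- q * z) \<le> exp (q * \<epsilon>) * (1 - l)" if e: "\<epsilon> > 0" for \<epsilon>
  proof -
    obtain C where C: "C > 0" "\<And>r. r \<ge> 1 \<Longrightarrow> \<psi> r \<le> C * r\<^sup>2" using psi_quadratic by auto
    define r where "r n = sqrt (2 ^ n)" for n :: nat
    have "filterlim r at_top sequentially" unfolding r_def by real_asymp
    then have "eventually (\<lambda>n. r n \<ge> max 1 q) sequentially" unfolding filterlim_at_top by blast
    then have ev: "eventually (\<lambda>n. exp (- q * z) \<le> exp (q * \<epsilon>) * (1 - S n) + exp (q * \<epsilon> + C - sqrt (2 ^ n) * \<epsilon>) * (2 ^ n / p)) sequentially"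
    proof eventually_elim
      case (elim n)
      have "\<psi> (r n) \<le> C * 2 ^ n" using C(2)[of "r n"] elim by (simp add: r_def)
      then have "\<psi> (r n) / 2 ^ n \<le> C" by (simp add: pos_divide_le_eq)
      then have num: "exp (- (r n - q) * \<epsilon> + \<psi> (r n) / 2 ^ n) \<le> exp (q * \<epsilon> + C - sqrt (2 ^ n) * \<epsilon>)"
        by (simp add: r_def algebra_simps)
      have den: "p / 2 ^ n \<le> exp (p / 2 ^ n) - 1"
        using exp_ge_add_one_self[of "p / 2 ^ n"] by linarith
      have "exp (- (r n - q) * \<epsilon> + \<psi> (r n) / 2 ^ n) / (exp (p / 2 ^ n) - 1)
        \<le> exp (q * \<epsilon> + C - sqrt (2 ^ n) * \<epsilon>) / (p / 2 ^ n)"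
        using p by (intro frac_le num den) auto
      also have "\<dots> = exp (q * \<epsilon> + C - sqrt (2 ^ n) * \<epsilon>) * (2 ^ n / p)" by simp
      finally show ?case using gp(3)[OF e, of "r n" n] elim by simp
    qed
    have "(\<lambda>n. exp (q * \<epsilon>) * (1 - S n) + exp (q * \<epsilon> + C - sqrt (2 ^ n) * \<epsilon>) * (2 ^ n / p)) \<longlonglongrightarrow> exp (q * \<epsilon>) * (1 - l) + 0"
      by (intro tendsto_intros l(3) overshoot_error_tendsto_0 p e)
    then show ?thesis
      using tendsto_lowerbound[OF _ ev] by simp
  qed
  \<comment> \<open>Only after the mesh limit is \<open>\<epsilon>\<close> sent to 0, along
    \<open>1 / Suc n\<close>.\<close>
  have "exp (- q * z) \<le> 1 - l"
  proof -
    have "(\<lambda>n. exp (q * (1 / real (Suc n))) * (1 - l)) \<longlonglongrightarrow> exp (q * 0) * (1 - l)"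
      by (intro tendsto_intros LIMSEQ_inverse_real_of_nat[unfolded inverse_eq_divide])
    moreover have "exp (- q * z) \<le> exp (q * (1 / real (Suc n))) * (1 - l)" for n by (rule l2) simp
    ultimately have "exp (- q * z) \<le> exp (q * 0) * (1 - l)" by (intro LIMSEQ_le_const) blast+
    then show ?thesis by simp
  qed
  then have "l = 1 - exp (- q * z)" using l1 by linarith
  then show ?thesis using l(1) by (simp add: p_def)
qed

text \<open>A lower bound for survival at all times also bounds its mean under the exponential law
  of rate \<open>\<psi> q\<close>, hence is at most \<open>1 - exp (- q * z)\<close>. Letting
  \<open>q\<close> tend to 0 forces it to vanish, which makes passage almost sure.\<close>

lemma survival_limit_point:
  assumes z: "z \<ge> 0" and \<sigma>: "\<And>t. t \<ge> 0 \<Longrightarrow> \<sigma> \<le> survival z t"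
  shows "\<sigma> = 0"
proof -
  have "\<sigma> \<le> ennreal (1 - exp (- (1 / real (Suc n)) * z))" for n
  proof -
    define q where "q = 1 / real (Suc n)"
    have q: "q > 0" by (simp add: q_def)
    have p: "\<psi> q > 0" by (rule psi_pos[OF q])
    have "\<sigma> = \<sigma> * (\<integral>\<^sup>+ t\<in>{0..}. ennreal (\<psi> q * exp (- \<psi> q * t)) \<partial>lborel)"
      using nn_integral_exp_density_tail[OF p, of 0] by simp
    also have "\<dots> = (\<integral>\<^sup>+ t. \<sigma> * (ennreal (\<psi> q * exp (- \<psi> q * t)) * indicator {0..} t) \<partial>lborel)"
      by (rule nn_integral_cmult[symmetric]) measurable
    also have "\<dots> \<le> (\<integral>\<^sup>+ t\<in>{0..}. ennreal (\<psi> q * exp (- \<psi> q * t)) * survival z t \<partial>lborel)"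
      using \<sigma> by (intro nn_integral_mono) (auto simp: indicator_def mult.commute[of \<sigma>] intro!: mult_left_mono)
    also have "\<dots> = ennreal (1 - exp (- q * z))" by (rule passage_laplace[OF z q])
    finally show ?thesis by (simp add: q_def)
  qed
  moreover have "(\<lambda>n. ennreal (1 - exp (- (1 / real (Suc n)) * z))) \<longlonglongrightarrow> ennreal (1 - exp (- 0 * z))"
    by (intro tendsto_ennrealI tendsto_intros LIMSEQ_inverse_real_of_nat[unfolded inverse_eq_divide])
  ultimately have "\<sigma> \<le> ennreal (1 - exp (- 0 * z))"
    by (intro LIMSEQ_le_const[where X = "\<lambda>n. ennreal (1 - exp (- (1 / real (Suc n)) * z))"]) auto
  then show ?thesis by simp
qed

lemma survival_tendsto:
  "(\<lambda>n. survival z (real n)) \<longlonglongrightarrow> emeasure M (\<Inter>n. {\<omega>\<in>space M. alive z (real n) \<omega>})"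
  unfolding survival_def
  by (rule Lim_emeasure_decseq) (auto simp: decseq_def intro: alive_mono)

lemma survival_inter_null:
  assumes z: "z \<ge> 0"
  shows "emeasure M (\<Inter>n. {\<omega>\<in>space M. alive z (real n) \<omega>}) = 0"
proof (rule survival_limit_point[OF z])
  fix t :: real
  obtain n0 :: nat where "t \<le> n0" using real_arch_simple by blast
  then show "emeasure M (\<Inter>n. {\<omega>\<in>space M. alive z (real n) \<omega>}) \<le> survival z t"
    unfolding survival_def by (intro emeasure_mono) (auto intro: alive_mono)
qed

lemma survival_tendsto_0: "z \<ge> 0 \<Longrightarrow> (\<lambda>n. survival z (real n)) \<longlonglongrightarrow> 0"
  using survival_tendsto[of z] survival_inter_null[of z] by simp

lemma AE_dies:
  assumes z: "z \<ge> 0"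
  shows "AE \<omega> in M. \<exists>n. \<not> alive z (real n) \<omega>"
proof (rule AE_I)
  show "{\<omega>\<in>space M. \<not> (\<exists>n. \<not> alive z (real n) \<omega>)} \<subseteq> (\<Inter>n. {\<omega>\<in>space M. alive z (real n) \<omega>})" by auto
  show "(\<Inter>n. {\<omega>\<in>space M. alive z (real n) \<omega>}) \<in> events" by measurable
qed (rule survival_inter_null[OF z])

end

section \<open>The potential measure\<close>

context rc_levy begin

text \<open>Transition semigroup of the process killed below the level, applied to
  \<open>f\<close>.\<close>

definition kernel :: "real \<Rightarrow> real \<Rightarrow> (real \<Rightarrow> ennreal) \<Rightarrow> ennreal" where
  "kernel z t f = (\<integral>\<^sup>+ \<omega>. (if alive z t \<omega> then f (z + Z t \<omega>) else 0) \<partial>M)"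

lemma kernel_measurable[measurable (raw)]:
  assumes [measurable]: "f \<in> borel_measurable borel" "g \<in> borel_measurable N" "h \<in> borel_measurable N"
  shows "(\<lambda>x. kernel (g x) (h x) f) \<in> borel_measurable N"
  unfolding kernel_def by measurable

lemma alive_nonneg: "alive z t \<omega> \<Longrightarrow> t \<ge> 0 \<Longrightarrow> 0 \<le> z + Z t \<omega>"
  by (auto simp: stay_def)

text \<open>With \<open>F = 1\<close> this is the semigroup property; with \<open>F\<close> a
  discount up to time \<open>s\<close> it drives the resolvent identity.\<close>

lemma markov_kernel:
  assumes s: "0 \<le> s" and u: "0 \<le> u" and [measurable]: "F \<in> borel_measurable (past s)" "f \<in> borel_measurable borel"
  shows "(\<integral>\<^sup>+ \<omega>. (if alive z (s + u) \<omega> then F \<omega> * f (z + Z (s + u) \<omega>) else 0) \<partial>M)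
       = (\<integral>\<^sup>+ \<omega>. (if alive z s \<omega> then F \<omega> * kernel (z + Z s \<omega>) u f else 0) \<partial>M)"
proof -
  note [measurable] = alive_measurable_past[OF s]
  define \<Phi> where "\<Phi> x = (if alive z s (fst x) then F (fst x) * f (z + snd x) else 0)" for x
  have [measurable]: "\<Phi> \<in> borel_measurable (past s \<Otimes>\<^sub>M borel)" unfolding \<Phi>_def by measurable
  have "(\<integral>\<^sup>+ \<omega>. (if alive z (s + u) \<omega> then F \<omega> * f (z + Z (s + u) \<omega>) else 0) \<partial>M)
     = (\<integral>\<^sup>+ \<omega>. (if stay z s u \<omega> then \<Phi> (\<omega>, Z (s + u) \<omega>) else 0) \<partial>M)"
    by (intro nn_integral_cong) (simp add: alive_add[OF s u] \<Phi>_def)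
  also have "\<dots> = (\<integral>\<^sup>+ \<omega>. \<integral>\<^sup>+ \<omega>'. (if alive (z + Z s \<omega>) u \<omega>' then \<Phi> (\<omega>, Z s \<omega> + Z u \<omega>') else 0) \<partial>M \<partial>M)"
    by (rule markov[OF s u]) measurable
  also have "\<dots> = (\<integral>\<^sup>+ \<omega>. (if alive z s \<omega> then F \<omega> * kernel (z + Z s \<omega>) u f else 0) \<partial>M)"
  proof (rule nn_integral_cong)
    fix \<omega>
    show "(\<integral>\<^sup>+ \<omega>'. (if alive (z + Z s \<omega>) u \<omega>' then \<Phi> (\<omega>, Z s \<omega> + Z u \<omega>') else 0) \<partial>M)
      = (if alive z s \<omega> then F \<omega> * kernel (z + Z s \<omega>) u f else 0)"
    proof (cases "alive z s \<omega>")
      case True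
      have "(\<integral>\<^sup>+ \<omega>'. (if alive (z + Z s \<omega>) u \<omega>' then \<Phi> (\<omega>, Z s \<omega> + Z u \<omega>') else 0) \<partial>M)
        = (\<integral>\<^sup>+ \<omega>'. F \<omega> * (if alive (z + Z s \<omega>) u \<omega>' then f (z + Z s \<omega> + Z u \<omega>') else 0) \<partial>M)"
        using True by (intro nn_integral_cong) (simp add: \<Phi>_def add.assoc)
      also have "\<dots> = F \<omega> * kernel (z + Z s \<omega>) u f"
        unfolding kernel_def by (rule nn_integral_cmult) measurable
      finally show ?thesis using True by simp
    next
      case False
      then have "\<Phi> (\<omega>, y) = 0" for y by (simp add: \<Phi>_def)
      then show ?thesis using False by (simp cong: if_cong)
    qed
  qed
  finally show ?thesis .
qed

definition potential :: "(real \<Rightarrow> ennreal) \<Rightarrow> real \<Rightarrow> ennreal" where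
  "potential f z = (\<integral>\<^sup>+ t\<in>{0..}. kernel z t f \<partial>lborel)"

lemma potential_measurable[measurable (raw)]:
  assumes [measurable]: "f \<in> borel_measurable borel" "g \<in> borel_measurable N"
  shows "(\<lambda>x. potential f (g x)) \<in> borel_measurable N"
  unfolding potential_def by measurable

end

context sp_levy begin

lemma survival_kernel: "survival z t = kernel z t (\<lambda>_. 1)"
  by (simp add: survival_eq kernel_def)

text \<open>From position \<open>y\<close> at time \<open>s\<close>, a further exponential time of
  rate \<open>\<psi> q\<close> is survived with probability \<open>1 - exp (- q * y)\<close>. Adding
  \<open>exp (- q * y)\<close> gives 1, so the Markov property at \<open>s\<close> yields the
  equation required by \<open>discounted_potential_identity\<close>; a second use of
  \<open>passage_laplace\<close> evaluates the result.\<close>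

lemma potential_exp:
  assumes z: "z \<ge> 0" and q: "q > 0"
  shows "potential (\<lambda>y. ennreal (exp (- q * y))) z = ennreal ((1 - exp (- q * z)) / \<psi> q)"
proof -
  define e where "e y = ennreal (exp (- q * y))" for y
  have [measurable]: "e \<in> borel_measurable borel" unfolding e_def by measurable
  define p where "p = \<psi> q"
  let ?X = "\<lambda>(t :: real). ennreal (p * exp (- p * t))"
  have p: "p > 0" using psi_pos[OF q] by (simp add: p_def)
  note passage = passage_laplace[OF _ q, folded p_def]
  have eq: "kernel z s e + (\<integral>\<^sup>+ t\<in>{0..}. ?X t * survival z (s + t) \<partial>lborel) = survival z s"
    if s: "s \<ge> 0" for s
  proof -
    have "(\<integral>\<^sup>+ t\<in>{0..}. ?X t * survival z (s + t) \<partial>lborel)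
       = (\<integral>\<^sup>+ t. \<integral>\<^sup>+ \<omega>. (?X t * indicator {0..} t) * (if alive z s \<omega> then survival (z + Z s \<omega>) t else 0) \<partial>M \<partial>lborel)"
    proof (rule nn_integral_cong)
      fix t :: real
      show "?X t * survival z (s + t) * indicator {0..} t
        = (\<integral>\<^sup>+ \<omega>. (?X t * indicator {0..} t) * (if alive z s \<omega> then survival (z + Z s \<omega>) t else 0) \<partial>M)"
      proof (cases "t \<ge> 0")
        case True
        have "survival z (s + t) = (\<integral>\<^sup>+ \<omega>. (if alive z s \<omega> then survival (z + Z s \<omega>) t else 0) \<partial>M)"
          using markov_kernel[OF s True borel_measurable_const[of 1] borel_measurable_const[of 1], of z] unfolding survival_kernel[symmetric] mult_1 survival_eq[of z "s + t"] .
        then show ?thesis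
          by (subst nn_integral_cmult) (simp_all add: mult_ac)
      qed simp
    qed
    also have "\<dots> = (\<integral>\<^sup>+ \<omega>. \<integral>\<^sup>+ t. (?X t * indicator {0..} t) * (if alive z s \<omega> then survival (z + Z s \<omega>) t else 0) \<partial>lborel \<partial>M)"
      by (rule nn_integral_swap) measurable
    also have "\<dots> = (\<integral>\<^sup>+ \<omega>. (if alive z s \<omega> then ennreal (1 - exp (- q * (z + Z s \<omega>))) else 0) \<partial>M)"
    proof (rule nn_integral_cong)
      fix \<omega>
      show "(\<integral>\<^sup>+ t. (?X t * indicator {0..} t) * (if alive z s \<omega> then survival (z + Z s \<omega>) t else 0) \<partial>lborel)
        = (if alive z s \<omega> then ennreal (1 - exp (- q * (z + Z s \<omega>))) else 0)"
      proof (cases "alive z s \<omega>")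
        case True
        then have "0 \<le> z + Z s \<omega>" using s by (auto intro: alive_nonneg)
        from passage[OF this] True show ?thesis by (simp add: mult_ac)
      qed simp
    qed
    finally have "kernel z s e + (\<integral>\<^sup>+ t\<in>{0..}. ?X t * survival z (s + t) \<partial>lborel)
      = (\<integral>\<^sup>+ \<omega>. (if alive z s \<omega> then e (z + Z s \<omega>) else 0) + (if alive z s \<omega> then ennreal (1 - exp (- q * (z + Z s \<omega>))) else 0) \<partial>M)"
      unfolding kernel_def by (subst nn_integral_add) auto
    also have "\<dots> = survival z s"
      unfolding survival_eq
    proof (rule nn_integral_cong)
      fix \<omega>
      show "(if alive z s \<omega> then e (z + Z s \<omega>) else 0) + (if alive z s \<omega> then ennreal (1 - exp (- q * (z + Z s \<omega>))) else 0)
        = (if alive z s \<omega> then 1 else 0)"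
      proof (cases "alive z s \<omega>")
        case True
        then have "0 \<le> q * (z + Z s \<omega>)" using s q by (intro mult_nonneg_nonneg alive_nonneg) auto
        then show ?thesis using True by (simp add: e_def ennreal_plus[symmetric] del: ennreal_plus)
      qed simp
    qed
    finally show ?thesis .
  qed
  have "potential e z = (\<integral>\<^sup>+ t\<in>{0..}. ennreal (exp (- p * t)) * survival z t \<partial>lborel)"
    unfolding potential_def
    by (rule discounted_potential_identity[OF _ _ p survival_le_1 survival_antimono survival_tendsto_0[OF z] eq]) measurable
  also have "\<dots> = (\<integral>\<^sup>+ t. ennreal (1 / p) * (?X t * survival z t * indicator {0..} t) \<partial>lborel)"
    using p by (intro nn_integral_cong) (simp add: mult.assoc[symmetric] ennreal_mult[symmetric])
  also have "\<dots> = ennreal (1 / p) * ennreal (1 - exp (- q * z))"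
    by (subst nn_integral_cmult, measurable, simp only: passage[OF z])
  also have "\<dots> = ennreal ((1 - exp (- q * z)) / p)"
    using p q z by (subst ennreal_mult[symmetric]) auto
  finally show ?thesis unfolding e_def[abs_def] p_def .
qed

lemma potential_density:
  assumes W: "scale_function \<psi> W" and z: "z \<ge> 0" and f[measurable]: "f \<in> borel_measurable borel"
  shows "potential f z = (\<integral>\<^sup>+ y. ennreal (W y - W (y - z)) * f y \<partial>lborel)"
proof -
  have psi0: "\<And>q. q > 0 \<Longrightarrow> \<psi> q \<ge> 0" using psi_pos less_imp_le by blast
  have Wm[measurable]: "W \<in> borel_measurable borel" by (rule scale_function_measurable[OF W])
  have W0: "W y \<ge> 0" for y by (rule scale_function_nonneg[OF W psi0])
  have Wneg: "W y = 0" if "y < 0" for y using W that by (simp add: scale_function_def)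
  have Wd: "W y - W (y - z) \<ge> 0" for y
  proof (cases "y - z < 0")
    case False
    then have "W (y - z) \<le> W y"
      using W z strict_mono_on_leD[of "{0..}" W "y - z" y] by (auto simp: scale_function_def)
    then show ?thesis by simp
  qed (simp add: Wneg W0)
  \<comment> \<open>\<open>\<mu>\<close> is the expected occupation measure of the killed process
    started at \<open>z\<close>: the image of time and probability restricted to survival.\<close>
  define \<rho> where "\<rho> = density (lborel \<Otimes>\<^sub>M M) (\<lambda>(t, \<omega>). if 0 \<le> t \<and> alive z t \<omega> then 1 else 0)"
  define \<mu> where "\<mu> = distr \<rho> borel (\<lambda>(t, \<omega>). z + Z t \<omega>)"
  define \<nu> where "\<nu> = density lborel (\<lambda>y. ennreal (W y - W (y - z)))"
  have [measurable_cong]: "sets \<rho> = sets (lborel \<Otimes>\<^sub>M M)" by (simp add: \<rho>_def)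
  have \<mu>: "(\<integral>\<^sup>+ y. g y \<partial>\<mu>) = potential g z" if [measurable]: "g \<in> borel_measurable borel" for g
  proof -
    have "(\<integral>\<^sup>+ y. g y \<partial>\<mu>) = (\<integral>\<^sup>+ x. g (z + Z (fst x) (snd x)) \<partial>\<rho>)"
      unfolding \<mu>_def by (subst nn_integral_distr) (auto simp: split_beta')
    also have "\<dots> = (\<integral>\<^sup>+ x. (if 0 \<le> fst x \<and> alive z (fst x) (snd x) then 1 else 0) * g (z + Z (fst x) (snd x)) \<partial>(lborel \<Otimes>\<^sub>M M))"
      unfolding \<rho>_def by (subst nn_integral_density) (auto simp: split_beta')
    also have "\<dots> = (\<integral>\<^sup>+ t. \<integral>\<^sup>+ \<omega>. (if 0 \<le> t \<and> alive z t \<omega> then 1 else 0) * g (z + Z t \<omega>) \<partial>M \<partial>lborel)"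
      by (subst nn_integral_fst[symmetric]) auto
    also have "\<dots> = potential g z"
      unfolding potential_def kernel_def
      by (intro nn_integral_cong) (auto simp: indicator_def intro!: nn_integral_cong)
    finally show ?thesis .
  qed
  have \<nu>: "(\<integral>\<^sup>+ y. g y \<partial>\<nu>) = (\<integral>\<^sup>+ y. ennreal (W y - W (y - z)) * g y \<partial>lborel)"
    if [measurable]: "g \<in> borel_measurable borel" for g
    unfolding \<nu>_def by (rule nn_integral_density) measurable
  have lapl: "(\<integral>\<^sup>+ y. ennreal (exp (- q * y)) \<partial>\<nu>) = ennreal ((1 - exp (- q * z)) / \<psi> q)" if q: "q > 0" for q
  proof -
    have pq: "\<psi> q > 0" by (rule psi_pos[OF q])
    note L = scale_function_laplace(1)[OF W psi0 q]
    have "(\<integral>\<^sup>+ y. ennreal (exp (- q * y) * W (y - z)) \<partial>lborel)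
       = (\<integral>\<^sup>+ y. ennreal (exp (- q * z)) * ennreal (exp (- q * y) * W y) \<partial>lborel)"
    proof -
      have e: "exp (- q * (z + 1 * y)) * W (z + 1 * y - z) = exp (- q * z) * (exp (- q * y) * W y)" for y
        unfolding mult.assoc[symmetric] mult_exp_exp by (simp add: algebra_simps)
      have "(\<integral>\<^sup>+ y. ennreal (exp (- q * y) * W (y - z)) \<partial>lborel)
        = ennreal \<bar>1\<bar> * (\<integral>\<^sup>+ y. ennreal (exp (- q * (z + 1 * y)) * W (z + 1 * y - z)) \<partial>lborel)"
        by (rule nn_integral_real_affine) auto
      then show ?thesis unfolding e by (simp add: ennreal_mult W0)
    qed
    also have "\<dots> = ennreal (exp (- q * z)) * ennreal (1 / \<psi> q)"
      by (subst nn_integral_cmult, measurable, simp only: L)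
    also have "\<dots> = ennreal (exp (- q * z) / \<psi> q)"
      using pq by (subst ennreal_mult[symmetric]) auto
    finally have sh: "(\<integral>\<^sup>+ y. ennreal (exp (- q * y) * W (y - z)) \<partial>lborel) = ennreal (exp (- q * z) / \<psi> q)" .
    \<comment> \<open>The shifted transform is added to both sides and cancelled as a finite term,
      in place of a subtraction of integrals.\<close>
    have "(\<integral>\<^sup>+ y. ennreal (exp (- q * y)) \<partial>\<nu>) + ennreal (exp (- q * z) / \<psi> q)
      = (\<integral>\<^sup>+ y. ennreal (W y - W (y - z)) * ennreal (exp (- q * y)) + ennreal (exp (- q * y) * W (y - z)) \<partial>lborel)"
      unfolding sh[symmetric] by (subst \<nu>, measurable, subst nn_integral_add, measurable)
    also have "\<dots> = (\<integral>\<^sup>+ y. ennreal (exp (- q * y) * W y) \<partial>lborel)"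
    proof (rule nn_integral_cong)
      fix y
      have "ennreal (W y - W (y - z)) * ennreal (exp (- q * y)) + ennreal (exp (- q * y) * W (y - z))
        = ennreal ((W y - W (y - z)) * exp (- q * y) + exp (- q * y) * W (y - z))"
        using Wd W0 by (subst ennreal_plus) (simp_all add: ennreal_mult)
      also have "(W y - W (y - z)) * exp (- q * y) + exp (- q * y) * W (y - z) = exp (- q * y) * W y"
        by (simp add: algebra_simps)
      finally show "ennreal (W y - W (y - z)) * ennreal (exp (- q * y)) + ennreal (exp (- q * y) * W (y - z))
        = ennreal (exp (- q * y) * W y)" .
    qed
    also have "\<dots> = ennreal (1 / \<psi> q)" by (rule L)
    also have "\<dots> = ennreal ((1 - exp (- q * z)) / \<psi> q) + ennreal (exp (- q * z) / \<psi> q)"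
      using pq q z by (subst ennreal_plus[symmetric]) (auto simp: field_simps)
    finally show ?thesis
      unfolding add.commute[of _ "ennreal (exp (- q * z) / \<psi> q)"] ennreal_add_left_cancel by simp
  qed
  have "\<mu> = \<nu>"
  proof (rule laplace_eqI)
    show "sets \<mu> = sets borel" "sets \<nu> = sets borel" by (simp_all add: \<mu>_def \<nu>_def)
    show "AE y in \<mu>. 0 \<le> y"
      unfolding \<mu>_def
    proof (subst AE_distr_iff)
      show "AE x in \<rho>. 0 \<le> (case x of (t, \<omega>) \<Rightarrow> z + Z t \<omega>)"
        unfolding \<rho>_def by (subst AE_density) (auto simp: split_beta' intro!: AE_I2 alive_nonneg)
    qed measurable
    show "AE y in \<nu>. 0 \<le> y"
    proof -
      have "0 \<le> y" if "0 < ennreal (W y - W (y - z))" for y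
        using that z Wneg[of y] Wneg[of "y - z"] by (cases "y < 0") auto
      then show ?thesis unfolding \<nu>_def by (subst AE_density) (auto intro!: AE_I2)
    qed
    fix n :: nat assume n: "n > 0"
    have a: "(\<integral>\<^sup>+ y. ennreal (exp (- (real n * y))) \<partial>\<mu>) = ennreal ((1 - exp (- real n * z)) / \<psi> (real n))"
      using potential_exp[OF z, of "real n"] n by (subst \<mu>) auto
    show "(\<integral>\<^sup>+ y. ennreal (exp (- (real n * y))) \<partial>\<mu>) < \<infinity>" by (simp add: a)
    show "(\<integral>\<^sup>+ y. ennreal (exp (- (real n * y))) \<partial>\<mu>) = (\<integral>\<^sup>+ y. ennreal (exp (- (real n * y))) \<partial>\<nu>)"
      using lapl[of "real n"] n by (simp add: a)
  qed
  then show ?thesis using \<mu>[OF f] \<nu>[OF f] by simp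
qed

end

section \<open>Discounting\<close>

text \<open>The time change \<open>A\<close> maps the measure \<open>a s ds\<close> on \<open>[0, r]\<close> to Lebesgue measure on \<open>[0, A r]\<close>.\<close>

lemma nn_integral_exp_neg_cumulative:
  fixes a :: "real \<Rightarrow> real"
  defines "A \<equiv> \<lambda>t. \<integral>s\<in>{0..t}. a s \<partial>lborel"
  assumes a0: "\<And>s. 0 \<le> a s" and r: "r \<ge> 0" and int: "set_integrable lborel {0..r} a"
    and [measurable]: "a \<in> borel_measurable borel"
  shows "(\<integral>\<^sup>+ s\<in>{0..r}. ennreal (a s) * ennreal (exp (- A s)) \<partial>lborel) + ennreal (exp (- A r)) = 1"
proof -
  have int': "set_integrable lborel {0..t} a" if "t \<le> r" for t
    by (rule set_integrable_subset[OF int]) (use that in auto)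
  have nnA: "(\<integral>\<^sup>+ s\<in>{0..t}. ennreal (a s) \<partial>lborel) = ennreal (A t)" if "t \<le> r" for t
  proof -
    have "(\<integral>\<^sup>+ s. ennreal (indicator {0..t} s * a s) \<partial>lborel) = ennreal (\<integral>s. indicator {0..t} s * a s \<partial>lborel)"
      by (rule nn_integral_eq_integral) (use int'[OF that] a0 in \<open>auto simp: set_integrable_def\<close>)
    then show ?thesis
      by (simp add: A_def set_lebesgue_integral_def ennreal_mult'' ennreal_indicator mult.commute)
  qed
  have A_nonneg: "A t \<ge> 0" for t
    unfolding A_def set_lebesgue_integral_def using a0 by (intro integral_nonneg_AE) auto
  have A0: "A 0 = 0"
  proof -
    have "A 0 = (\<integral>s. 0 \<partial>(lborel :: real measure))" unfolding A_def set_lebesgue_integral_def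
    proof (rule integral_cong_AE)
      show "AE s in lborel. indicator {0..0} s *\<^sub>R a s = 0"
        using AE_lborel_singleton[of 0] by eventually_elim simp
    qed auto
    then show ?thesis by simp
  qed
  have A_mono: "A s \<le> A t" if "s \<le> t" "t \<le> r" for s t
  proof -
    have "(\<integral>\<^sup>+ u\<in>{0..s}. ennreal (a u) \<partial>lborel) \<le> (\<integral>\<^sup>+ u\<in>{0..t}. ennreal (a u) \<partial>lborel)"
      by (intro nn_integral_mono) (use that in \<open>auto simp: indicator_def\<close>)
    then show ?thesis using nnA[of s] nnA[of t] A_nonneg that by simp
  qed
  have A_cont: "continuous_on {0..r} A"
  proof -
    have "a integrable_on {0..r}" using int by (rule set_borel_integral_eq_integral(1))
    then have "continuous_on {0..r} (\<lambda>t. integral {0..t} a)" by (rule indefinite_integral_continuous_1)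
    moreover have "integral {0..t} a = A t" if "t \<le> r" for t
      unfolding A_def by (rule set_borel_integral_eq_integral(2)[symmetric, OF int'[OF that]])
    ultimately show ?thesis by (rule continuous_on_eq) simp
  qed
  \<comment> \<open>The cutoff gives a Borel function on the whole line; continuity of
    \<open>A\<close> is available on \<open>{0..r}\<close>.\<close>
  define A' where "A' s = (if s \<in> {0..r} then A s else 0)" for s
  have A'm[measurable]: "A' \<in> borel_measurable borel"
    unfolding A'_def by (rule borel_measurable_continuous_on_if) (use A_cont in auto)
  have pre[measurable]: "A' -` {x<..} \<in> sets borel" for x
    using measurable_sets_borel[OF A'm] by simp
  define N where "N = density lborel (\<lambda>s. ennreal (a s) * indicator {0..r} s)"
  have "distr N borel A' = density lborel (indicator {0..A r})"
  proof (rule measure_eqI_lessThan)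
    have em: "emeasure (distr N borel A') {x<..} = emeasure (density lborel (indicator {0..A r})) {x<..}" for x
    proof -
      have "emeasure (distr N borel A') {x<..} = (\<integral>\<^sup>+ s. (ennreal (a s) * indicator {0..r} s) * indicator (A' -` {x<..}) s \<partial>lborel)"
        by (subst emeasure_distr) (auto simp: N_def emeasure_density)
      also have "\<dots> = (\<integral>\<^sup>+ s\<in>{s\<in>{0..r}. A s > x}. ennreal (a s) \<partial>lborel)"
        by (intro nn_integral_cong) (auto simp: indicator_def A'_def)
      also have "\<dots> = ennreal (A r - max 0 x)"
      proof (cases "0 \<le> x \<and> x < A r")
        case False
        then consider "x < 0" | "x \<ge> A r" "x \<ge> 0" using A_nonneg[of r] by force
        then show ?thesis
        proof cases
          case 1
          then have "{s\<in>{0..r}. A s > x} = {0..r}" using A_nonneg by (auto intro: less_le_trans)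
          then show ?thesis using nnA[of r] 1 by simp
        next
          case 2
          then have "{s\<in>{0..r}. A s > x} = {}" using A_mono[of _ r] by force
          then show ?thesis using 2 by (simp add: ennreal_neg)
        qed
      next
        case True
        obtain c where c: "0 \<le> c" "c \<le> r" "A c = x"
          using IVT'[of A 0 x r] A_cont A0 True r by auto
        \<comment> \<open>\<open>A\<close> may be constant on an interval, so the level
          \<open>x\<close> is located by its last point \<open>d\<close>: the sublevel set is closed
          and, by monotonicity, equal to \<open>{0..d}\<close>, with integral
          \<open>A d = x\<close>.\<close>
        define B where "B = {s\<in>{0..r}. A s \<le> x}"
        have B: "B = A' -` {..x} \<inter> {0..r}" unfolding B_def A'_def by auto
        have [measurable]: "B \<in> sets borel"
          unfolding B using measurable_sets_borel[OF A'm, of "{..x}"] by simp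
        define d where "d = Sup B"
        have cB: "c \<in> B" using c by (auto simp: B_def)
        have bdd: "bdd_above B" by (rule bdd_aboveI[where M = r]) (auto simp: B_def)
        have "closed B"
        proof -
          have "B = {0..r} \<inter> A -` {..x}" by (auto simp: B_def)
          then show ?thesis
            using continuous_closed_preimage[OF A_cont closed_atLeastAtMost closed_atMost[of x]] by metis
        qed
        then have dB: "d \<in> B" using closed_contains_Sup[of B] cB bdd by (auto simp: d_def)
        have d: "0 \<le> d" "d \<le> r" "A d = x"
        proof -
          show "0 \<le> d" "d \<le> r" using dB by (auto simp: B_def)
          have "c \<le> d" unfolding d_def by (rule cSup_upper[OF cB bdd])
          then show "A d = x" using A_mono[of c d] c dB by (force simp: B_def)
        qed
        have Beq: "B = {0..d}"
        proof (intro equalityI subsetI)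
          fix s assume "s \<in> B"
          then show "s \<in> {0..d}" using cSup_upper[OF _ bdd, of s] by (auto simp: B_def d_def)
        next
          fix s assume s: "s \<in> {0..d}"
          then show "s \<in> B" using A_mono[of s d] d by (simp add: B_def)
        qed
        have Bx: "{s\<in>{0..r}. A s > x} = {0..r} - B" by (auto simp: B_def)
        have Bsub: "B \<subseteq> {0..r}" by (auto simp: B_def)
        have "(\<integral>\<^sup>+ s\<in>{s\<in>{0..r}. A s > x}. ennreal (a s) \<partial>lborel) + ennreal x
          = (\<integral>\<^sup>+ s\<in>{0..r} - B. ennreal (a s) \<partial>lborel) + (\<integral>\<^sup>+ s\<in>B. ennreal (a s) \<partial>lborel)"
          unfolding Bx using nnA[of d] d Beq by simp
        also have "\<dots> = (\<integral>\<^sup>+ s\<in>{0..r}. ennreal (a s) \<partial>lborel)"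
        proof (subst nn_integral_add[symmetric])
          show "(\<integral>\<^sup>+ s. ennreal (a s) * indicator ({0..r} - B) s + ennreal (a s) * indicator B s \<partial>lborel)
              = (\<integral>\<^sup>+ s\<in>{0..r}. ennreal (a s) \<partial>lborel)"
            using Bsub by (intro nn_integral_cong) (auto split: split_indicator)
        qed measurable
        also have "\<dots> = ennreal (A r)" by (rule nnA) simp
        also have "\<dots> = ennreal (A r - max 0 x) + ennreal x"
          using True by (simp flip: ennreal_plus)
        finally show ?thesis by simp
      qed
      also have "\<dots> = emeasure lborel ({0..A r} \<inter> {x<..})"
      proof (cases "x < 0")
        case True
        then have "{0..A r} \<inter> {x<..} = {0..A r}" by auto
        then show ?thesis using True A_nonneg[of r] by simp
      next
        case False
        then have "{0..A r} \<inter> {x<..} = {x<..A r}" by auto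
        then show ?thesis using False by (cases "x \<le> A r") (auto simp: ennreal_neg)
      qed
      also have "\<dots> = emeasure (density lborel (indicator {0..A r})) {x<..}"
        by (subst emeasure_density) (auto simp: indicator_inter_arith[symmetric] simp flip: nn_integral_indicator)
      finally show ?thesis .
    qed
    then show "emeasure (distr N borel A') {x<..} = emeasure (density lborel (indicator {0..A r})) {x<..}" for x .
    show "emeasure (distr N borel A') {x<..} < \<infinity>" for x
    proof -
      have "emeasure (density lborel (indicator {0..A r})) {x<..} \<le> emeasure lborel {0..A r}"
        by (subst emeasure_density)
          (auto simp flip: nn_integral_indicator intro!: nn_integral_mono simp: indicator_def)
      also have "\<dots> < \<infinity>" using A_nonneg[of r] by simp
      finally show ?thesis by (simp add: em)
    qed
  qed auto
  then have eq: "(\<integral>\<^sup>+ y. ennreal (exp (- y)) \<partial>distr N borel A') = (\<integral>\<^sup>+ y. ennreal (exp (- y)) \<partial>density lborel (indicator {0..A r}))"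
    by simp
  have L: "(\<integral>\<^sup>+ y. ennreal (exp (- y)) \<partial>distr N borel A') = (\<integral>\<^sup>+ s\<in>{0..r}. ennreal (a s) * ennreal (exp (- A s)) \<partial>lborel)"
  proof -
    have "(\<integral>\<^sup>+ y. ennreal (exp (- y)) \<partial>distr N borel A') = (\<integral>\<^sup>+ s. ennreal (exp (- A' s)) \<partial>N)"
      by (subst nn_integral_distr) (auto simp: N_def)
    also have "\<dots> = (\<integral>\<^sup>+ s. (ennreal (a s) * indicator {0..r} s) * ennreal (exp (- A' s)) \<partial>lborel)"
      unfolding N_def by (subst nn_integral_density) auto
    also have "\<dots> = (\<integral>\<^sup>+ s\<in>{0..r}. ennreal (a s) * ennreal (exp (- A s)) \<partial>lborel)"
      by (intro nn_integral_cong) (auto simp: A'_def indicator_def)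
    finally show ?thesis .
  qed
  have R: "(\<integral>\<^sup>+ y. ennreal (exp (- y)) \<partial>density lborel (indicator {0..A r})) = ennreal (1 - exp (- A r))"
  proof -
    have "(\<integral>\<^sup>+ y. ennreal (exp (- y)) * indicator {0..A r} y \<partial>lborel) = ennreal (- exp (- A r) - (- exp (- 0)))"
      by (rule nn_integral_FTC_Icc) (use A_nonneg in \<open>auto intro!: derivative_eq_intros\<close>)
    then show ?thesis
      by (subst nn_integral_density) (auto simp: mult.commute)
  qed
  have "(\<integral>\<^sup>+ s\<in>{0..r}. ennreal (a s) * ennreal (exp (- A s)) \<partial>lborel) + ennreal (exp (- A r))
    = ennreal (1 - exp (- A r)) + ennreal (exp (- A r))"
    using L R eq by simp
  also have "\<dots> = 1"
    using A_nonneg[of r] by (simp flip: ennreal_plus)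
  finally show ?thesis .
qed

lemma borel_measurable_indicator_Icc[measurable (raw)]:
  fixes f g h :: "'b \<Rightarrow> real"
  assumes [measurable]: "f \<in> borel_measurable N" "g \<in> borel_measurable N" "h \<in> borel_measurable N"
  shows "(\<lambda>x. indicator {f x..g x} (h x) :: ennreal) \<in> borel_measurable N"
proof -
  have "(\<lambda>x. if f x \<le> h x \<and> h x \<le> g x then 1 else 0 :: ennreal) \<in> borel_measurable N" by measurable
  then show ?thesis by (simp add: indicator_def of_bool_def)
qed

lemma exp_neg_enn_measurable[measurable]: "exp_neg_enn \<in> borel_measurable borel"
  unfolding exp_neg_enn_def[abs_def] by measurable

lemma exp_neg_enn_ennreal: "a \<ge> 0 \<Longrightarrow> exp_neg_enn (ennreal a) = ennreal (exp (- a))"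
  by (simp add: exp_neg_enn_def)

text \<open>Transfer from the real primitive to the \<open>ennreal\<close> clock; finiteness at
  \<open>r\<close> excludes the infinite branch of \<open>exp_neg_enn\<close> at all earlier
  times.\<close>

lemma nn_integral_discount:
  fixes a :: "real \<Rightarrow> real"
  assumes a0: "\<And>s. 0 \<le> a s" and r: "r \<ge> 0" and [measurable]: "a \<in> borel_measurable borel"
    and fin: "(\<integral>\<^sup>+ s\<in>{0..r}. ennreal (a s) \<partial>lborel) < \<infinity>"
  shows "(\<integral>\<^sup>+ s\<in>{0..r}. ennreal (a s) * exp_neg_enn (\<integral>\<^sup>+ u\<in>{0..s}. ennreal (a u) \<partial>lborel) \<partial>lborel)
     + exp_neg_enn (\<integral>\<^sup>+ s\<in>{0..r}. ennreal (a s) \<partial>lborel) = 1"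
proof -
  define A where "A t = (\<integral>s\<in>{0..t}. a s \<partial>lborel)" for t
  have nn: "(\<integral>\<^sup>+ s\<in>{0..t}. ennreal (a s) \<partial>lborel) = (\<integral>\<^sup>+ s. ennreal (indicator {0..t} s *\<^sub>R a s) \<partial>lborel)" for t
    by (intro nn_integral_cong) (auto simp: indicator_def)
  have int: "set_integrable lborel {0..t} a" if "t \<le> r" for t
    unfolding set_integrable_def
  proof (rule integrableI_nonneg)
    have "(\<integral>\<^sup>+ s\<in>{0..t}. ennreal (a s) \<partial>lborel) \<le> (\<integral>\<^sup>+ s\<in>{0..r}. ennreal (a s) \<partial>lborel)"
      using that by (intro nn_integral_mono) (auto simp: indicator_def)
    then show "(\<integral>\<^sup>+ s. ennreal (indicator {0..t} s *\<^sub>R a s) \<partial>lborel) < \<infinity>"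
      using fin unfolding nn by (rule le_less_trans)
  qed (use a0 in auto)
  have clock: "exp_neg_enn (\<integral>\<^sup>+ s\<in>{0..t}. ennreal (a s) \<partial>lborel) = ennreal (exp (- A t))" if "t \<le> r" for t
  proof -
    have "(\<integral>\<^sup>+ s\<in>{0..t}. ennreal (a s) \<partial>lborel) = ennreal (A t)"
      unfolding nn A_def set_lebesgue_integral_def
      by (rule nn_integral_eq_integral) (use int[OF that] a0 in \<open>auto simp: set_integrable_def\<close>)
    moreover have "A t \<ge> 0"
      unfolding A_def set_lebesgue_integral_def using a0 by (intro integral_nonneg_AE) auto
    ultimately show ?thesis by (simp add: exp_neg_enn_ennreal)
  qed
  have "(\<integral>\<^sup>+ s\<in>{0..r}. ennreal (a s) * exp_neg_enn (\<integral>\<^sup>+ u\<in>{0..s}. ennreal (a u) \<partial>lborel) \<partial>lborel)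
     = (\<integral>\<^sup>+ s\<in>{0..r}. ennreal (a s) * ennreal (exp (- A s)) \<partial>lborel)"
    by (intro nn_integral_cong) (auto split: split_indicator simp: clock)
  then show ?thesis
    using nn_integral_exp_neg_cumulative[of a r, OF a0 r int] clock[of r] by (simp add: A_def)
qed

context rc_levy begin

text \<open>Values in \<open>ennreal\<close>, because the rate need not be integrable along the
  path.\<close>

definition clock :: "(real \<Rightarrow> real) \<Rightarrow> real \<Rightarrow> real \<Rightarrow> 'a \<Rightarrow> ennreal" where
  "clock v z t \<omega> = (\<integral>\<^sup>+ s\<in>{0..t}. ennreal (v (z + Z s \<omega>)) \<partial>lborel)"

text \<open>The time integral stands inside the expectation, since the discount is handled path by
  path.\<close>

definition killed_potential :: "(real \<Rightarrow> real) \<Rightarrow> (real \<Rightarrow> ennreal) \<Rightarrow> real \<Rightarrow> ennreal" where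
  "killed_potential v f z = (\<integral>\<^sup>+ \<omega>. (\<integral>\<^sup>+ t\<in>{0..}.
     (if alive z t \<omega> then exp_neg_enn (clock v z t \<omega>) * f (z + Z t \<omega>) else 0) \<partial>lborel) \<partial>M)"

lemma clock_measurable[measurable (raw)]:
  assumes [measurable]: "v \<in> borel_measurable borel" "f \<in> borel_measurable N" "g \<in> borel_measurable N" "h \<in> measurable N M"
  shows "(\<lambda>x. clock v (f x) (g x) (h x)) \<in> borel_measurable N"
  unfolding clock_def by measurable

lemma clock_measurable_past:
  assumes [measurable]: "v \<in> borel_measurable borel" and s: "s \<ge> 0"
  shows "clock v z s \<in> borel_measurable (past s)"
proof -
  \<comment> \<open>The integral only looks at \<open>r \<le> s\<close>, so the path may be stopped
    at \<open>s\<close>, which keeps it measurable for the past.\<close>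
  have [measurable]: "(\<lambda>(r :: real, \<omega>). Z (min s r) \<omega>) \<in> borel_measurable (borel \<Otimes>\<^sub>M past s)"
    by (rule Z_stopped_joint_measurable[OF space_past s Z_measurable_past])
  have "(\<lambda>\<omega>. \<integral>\<^sup>+ r\<in>{0..s}. ennreal (v (z + (case (r, \<omega>) of (r, \<omega>) \<Rightarrow> Z (min s r) \<omega>))) \<partial>lborel) \<in> borel_measurable (past s)"
    by measurable
  also have "(\<lambda>\<omega>. \<integral>\<^sup>+ r\<in>{0..s}. ennreal (v (z + (case (r, \<omega>) of (r, \<omega>) \<Rightarrow> Z (min s r) \<omega>))) \<partial>lborel) = clock v z s"
    unfolding clock_def fun_eq_iff
    by (intro allI nn_integral_cong) (auto simp: indicator_def min_def)
  finally show ?thesis .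
qed

lemma potential_nested:
  assumes [measurable]: "f \<in> borel_measurable borel"
  shows "potential f z = (\<integral>\<^sup>+ \<omega>. (\<integral>\<^sup>+ t\<in>{0..}. (if alive z t \<omega> then f (z + Z t \<omega>) else 0) \<partial>lborel) \<partial>M)"
proof -
  have "potential f z = (\<integral>\<^sup>+ t. \<integral>\<^sup>+ \<omega>. (if alive z t \<omega> then f (z + Z t \<omega>) else 0) * indicator {0..} t \<partial>M \<partial>lborel)"
    unfolding potential_def kernel_def by (intro nn_integral_cong nn_integral_multc[symmetric]) measurable
  also have "\<dots> = (\<integral>\<^sup>+ \<omega>. (\<integral>\<^sup>+ t\<in>{0..}. (if alive z t \<omega> then f (z + Z t \<omega>) else 0) \<partial>lborel) \<partial>M)"
    by (rule nn_integral_swap) measurable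
  finally show ?thesis .
qed

text \<open>A finite expectation makes the total clock over the lifetime almost surely finite.
  Without this the identity of \<open>nn_integral_discount\<close> can fail: a rate like
  \<open>1 / s\<close> at the start would make both its terms 0.\<close>

lemma AE_clock_finite:
  assumes [measurable]: "v \<in> borel_measurable borel" and fin: "potential (\<lambda>y. ennreal (v y)) z < \<infinity>"
  shows "AE \<omega> in M. (\<integral>\<^sup>+ t\<in>{0..}. (if alive z t \<omega> then ennreal (v (z + Z t \<omega>)) else 0) \<partial>lborel) < \<infinity>"
proof -
  have "AE \<omega> in M. (\<integral>\<^sup>+ t\<in>{0..}. (if alive z t \<omega> then ennreal (v (z + Z t \<omega>)) else 0) \<partial>lborel) \<noteq> \<infinity>"
    by (rule nn_integral_PInf_AE) (use fin in \<open>auto simp: potential_nested\<close>)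
  then show ?thesis by (simp add: less_top)
qed

lemma clock_le:
  "alive z r \<omega> \<Longrightarrow> clock v z r \<omega> \<le> (\<integral>\<^sup>+ t\<in>{0..}. (if alive z t \<omega> then ennreal (v (z + Z t \<omega>)) else 0) \<partial>lborel)"
  unfolding clock_def by (intro nn_integral_mono) (auto simp: indicator_def dest: alive_mono)

text \<open>The Markov property at time \<open>s\<close> is applied under \<open>\<integral> ds\<close>; the resulting inner integral over \<open>s \<le> r\<close> is
  \<open>1 - exp (- clock r)\<close>.\<close>

lemma resolvent_identity:
  assumes v[measurable]: "v \<in> borel_measurable borel" and v0: "\<And>y. 0 \<le> v y"
    and f[measurable]: "f \<in> borel_measurable borel" and fin: "potential (\<lambda>y. ennreal (v y)) z < \<infinity>"
  shows "killed_potential v f z + killed_potential v (\<lambda>y. ennreal (v y) * potential f y) z = potential f z"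
proof -
  let ?D = "\<lambda>(r :: real) \<omega>. (if alive z r \<omega> then exp_neg_enn (clock v z r \<omega>) * f (z + Z r \<omega>) else 0)"
  let ?f = "\<lambda>(r :: real) \<omega>. (if alive z r \<omega> then f (z + Z r \<omega>) else 0)"
  \<comment> \<open>Density of the killing time given the path. It is measurable for the past at
    \<open>s\<close>, so \<open>markov_kernel\<close> accepts it as a weight.\<close>
  define F where "F s \<omega> = exp_neg_enn (clock v z s \<omega>) * ennreal (v (z + Z s \<omega>))" for s \<omega>
  let ?K = "\<lambda>(s :: real) (u :: real) \<omega>. (if alive z s \<omega> then F s \<omega> * kernel (z + Z s \<omega>) u f else 0)"
  let ?P = "\<lambda>(s :: real) \<omega>. (if alive z s \<omega> then F s \<omega> * potential f (z + Z s \<omega>) else 0)"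
  let ?G = "\<lambda>(r :: real) (s :: real) \<omega>. (if alive z r \<omega> then F s \<omega> * f (z + Z r \<omega>) else 0)"
  let ?Q = "\<lambda>(r :: real) \<omega>. (if alive z r \<omega> then f (z + Z r \<omega>) * (\<integral>\<^sup>+ s\<in>{0..r}. F s \<omega> \<partial>lborel) else 0)"
  have F[measurable (raw)]: "(\<lambda>x. F (g x) (h x)) \<in> borel_measurable N"
    if [measurable]: "g \<in> borel_measurable N" "h \<in> measurable N M" for g h and N :: "'c measure"
    unfolding F_def by measurable
  have Fj[measurable]: "(\<lambda>x. F (fst x) (snd x)) \<in> borel_measurable (borel \<Otimes>\<^sub>M M)"
    unfolding F_def by measurable
  have F3[measurable]: "(\<lambda>x. F (fst x) (snd (snd x))) \<in> borel_measurable (borel \<Otimes>\<^sub>M (borel \<Otimes>\<^sub>M M))"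
    unfolding F_def by measurable
  have Fs[measurable]: "F s \<in> borel_measurable M" for s
    unfolding F_def by measurable
  have Fw: "(\<lambda>s. F s \<omega>) \<in> borel_measurable borel" if [measurable]: "\<omega> \<in> space M" for \<omega>
    unfolding F_def by measurable
  have Fp: "F s \<in> borel_measurable (past s)" if s: "s \<ge> 0" for s
  proof -
    have [measurable]: "Z s \<in> borel_measurable (past s)" using s by (intro Z_measurable_past) auto
    note [measurable] = clock_measurable_past[OF v s]
    show ?thesis unfolding F_def by measurable
  qed
  \<comment> \<open>The further life \<open>u\<close> after \<open>s\<close> is renamed to the
    absolute time \<open>r = s + u\<close>, which prepares the exchange of \<open>s\<close> and
    \<open>r\<close>.\<close>
  have step: "(\<integral>\<^sup>+ \<omega>. ?P s \<omega> \<partial>M)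
     = (\<integral>\<^sup>+ \<omega>. \<integral>\<^sup>+ r. ?G r s \<omega> * indicator {s..} r \<partial>lborel \<partial>M)"
    if s: "s \<ge> 0" for s
  proof -
    have "(\<integral>\<^sup>+ \<omega>. ?P s \<omega> \<partial>M)
      = (\<integral>\<^sup>+ \<omega>. \<integral>\<^sup>+ u. ?K s u \<omega> * indicator {0..} u \<partial>lborel \<partial>M)"
    proof (rule nn_integral_cong)
      fix \<omega>
      show "?P s \<omega>
        = (\<integral>\<^sup>+ u. ?K s u \<omega> * indicator {0..} u \<partial>lborel)"
        by (simp add: potential_def mult.assoc nn_integral_cmult)
    qed
    also have "\<dots> = (\<integral>\<^sup>+ u. \<integral>\<^sup>+ \<omega>. ?K s u \<omega> * indicator {0..} u \<partial>M \<partial>lborel)"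
      by (rule nn_integral_swap[symmetric]) measurable
    also have "\<dots> = (\<integral>\<^sup>+ u. \<integral>\<^sup>+ \<omega>. ?G (s + u) s \<omega> * indicator {0..} u \<partial>M \<partial>lborel)"
    proof (rule nn_integral_cong)
      fix u :: real
      show "(\<integral>\<^sup>+ \<omega>. ?K s u \<omega> * indicator {0..} u \<partial>M)
        = (\<integral>\<^sup>+ \<omega>. ?G (s + u) s \<omega> * indicator {0..} u \<partial>M)"
        using markov_kernel[OF s _ Fp[OF s] f, of u z] by (cases "u \<ge> 0") simp_all
    qed
    also have "\<dots> = (\<integral>\<^sup>+ \<omega>. \<integral>\<^sup>+ u. ?G (s + u) s \<omega> * indicator {0..} u \<partial>lborel \<partial>M)"
      by (rule nn_integral_swap) measurable
    also have "\<dots> = (\<integral>\<^sup>+ \<omega>. \<integral>\<^sup>+ r. ?G r s \<omega> * indicator {s..} r \<partial>lborel \<partial>M)"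
    proof (rule nn_integral_cong)
      fix \<omega> assume [measurable]: "\<omega> \<in> space M"
      have "(\<integral>\<^sup>+ r. ?G r s \<omega> * indicator {s..} r \<partial>lborel)
        = ennreal \<bar>1\<bar> * (\<integral>\<^sup>+ u. ?G (s + 1 * u) s \<omega> * indicator {s..} (s + 1 * u) \<partial>lborel)"
        by (rule nn_integral_real_affine) auto
      also have "\<dots> = (\<integral>\<^sup>+ u. ?G (s + u) s \<omega> * indicator {0..} u \<partial>lborel)"
        unfolding mult_1 by (simp add: indicator_def)
      finally show "(\<integral>\<^sup>+ u. ?G (s + u) s \<omega> * indicator {0..} u \<partial>lborel)
        = (\<integral>\<^sup>+ r. ?G r s \<omega> * indicator {s..} r \<partial>lborel)" ..
    qed
    finally show ?thesis .
  qed
  have "killed_potential v (\<lambda>y. ennreal (v y) * potential f y) z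
     = (\<integral>\<^sup>+ s. \<integral>\<^sup>+ \<omega>. ?P s \<omega> * indicator {0..} s \<partial>M \<partial>lborel)"
    unfolding killed_potential_def F_def mult.assoc[symmetric]
    by (rule nn_integral_swap[symmetric]) measurable
  also have "\<dots> = (\<integral>\<^sup>+ s. \<integral>\<^sup>+ \<omega>. (\<integral>\<^sup>+ r. ?G r s \<omega> * indicator {s..} r * indicator {0..} s \<partial>lborel) \<partial>M \<partial>lborel)"
  proof (rule nn_integral_cong)
    fix s :: real
    show "(\<integral>\<^sup>+ \<omega>. ?P s \<omega> * indicator {0..} s \<partial>M)
      = (\<integral>\<^sup>+ \<omega>. (\<integral>\<^sup>+ r. ?G r s \<omega> * indicator {s..} r * indicator {0..} s \<partial>lborel) \<partial>M)"
      using step[of s] by (cases "s \<ge> 0") simp_all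
  qed
  also have "\<dots> = (\<integral>\<^sup>+ \<omega>. \<integral>\<^sup>+ s. (\<integral>\<^sup>+ r. ?G r s \<omega> * indicator {s..} r * indicator {0..} s \<partial>lborel) \<partial>lborel \<partial>M)"
    by (rule nn_integral_swap) measurable
  also have "\<dots> = (\<integral>\<^sup>+ \<omega>. \<integral>\<^sup>+ r. (\<integral>\<^sup>+ s. ?G r s \<omega> * indicator {s..} r * indicator {0..} s \<partial>lborel) \<partial>lborel \<partial>M)"
  proof (rule nn_integral_cong)
    fix \<omega> assume [measurable]: "\<omega> \<in> space M"
    note [measurable] = Fw[OF this]
    show "(\<integral>\<^sup>+ s. (\<integral>\<^sup>+ r. ?G r s \<omega> * indicator {s..} r * indicator {0..} s \<partial>lborel) \<partial>lborel)
      = (\<integral>\<^sup>+ r. (\<integral>\<^sup>+ s. ?G r s \<omega> * indicator {s..} r * indicator {0..} s \<partial>lborel) \<partial>lborel)"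
      by (rule lborel_pair.Fubini') measurable
  qed
  also have "\<dots> = (\<integral>\<^sup>+ \<omega>. (\<integral>\<^sup>+ r\<in>{0..}. ?Q r \<omega> \<partial>lborel) \<partial>M)"
  proof (intro nn_integral_cong)
    fix \<omega> r assume [measurable]: "\<omega> \<in> space M"
    note [measurable] = Fw[OF this]
    have "(\<integral>\<^sup>+ s. ?G r s \<omega> * indicator {s..} r * indicator {0..} s \<partial>lborel)
       = (\<integral>\<^sup>+ s. ?f r \<omega> * indicator {0..} r * (F s \<omega> * indicator {0..r} s) \<partial>lborel)"
      by (intro nn_integral_cong) (auto simp: indicator_def mult.commute)
    also have "\<dots> = ?f r \<omega> * indicator {0..} r * (\<integral>\<^sup>+ s\<in>{0..r}. F s \<omega> \<partial>lborel)"
      by (rule nn_integral_cmult) measurable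
    finally show "(\<integral>\<^sup>+ s. ?G r s \<omega> * indicator {s..} r * indicator {0..} s \<partial>lborel)
       = ?Q r \<omega> * indicator {0..} r"
      by (simp add: mult_ac)
  qed
  finally have second: "killed_potential v (\<lambda>y. ennreal (v y) * potential f y) z
    = (\<integral>\<^sup>+ \<omega>. (\<integral>\<^sup>+ r\<in>{0..}. ?Q r \<omega> \<partial>lborel) \<partial>M)" .
  have "killed_potential v f z + killed_potential v (\<lambda>y. ennreal (v y) * potential f y) z
    = (\<integral>\<^sup>+ \<omega>. (\<integral>\<^sup>+ r\<in>{0..}. ?D r \<omega> \<partial>lborel)
       + (\<integral>\<^sup>+ r\<in>{0..}. ?Q r \<omega> \<partial>lborel) \<partial>M)"
    unfolding second unfolding killed_potential_def by (rule nn_integral_add[symmetric]) measurable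
  also have "\<dots> = (\<integral>\<^sup>+ \<omega>. (\<integral>\<^sup>+ t\<in>{0..}. ?f t \<omega> \<partial>lborel) \<partial>M)"
  proof (rule nn_integral_cong_AE)
    show "AE \<omega> in M. (\<integral>\<^sup>+ r\<in>{0..}. ?D r \<omega> \<partial>lborel)
       + (\<integral>\<^sup>+ r\<in>{0..}. ?Q r \<omega> \<partial>lborel)
       = (\<integral>\<^sup>+ t\<in>{0..}. ?f t \<omega> \<partial>lborel)"
      using AE_clock_finite[OF v fin] AE_space
    proof eventually_elim
      case (elim \<omega>)
      note [measurable] = elim(2) Fw[OF elim(2)]
      have one: "exp_neg_enn (clock v z r \<omega>) + (\<integral>\<^sup>+ s\<in>{0..r}. F s \<omega> \<partial>lborel) = 1" if r: "alive z r \<omega>" "r \<ge> 0" for r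
      proof -
        have "clock v z r \<omega> < \<infinity>" using clock_le[OF r(1), of v] elim(1) by (rule le_less_trans)
        then have "(\<integral>\<^sup>+ s\<in>{0..r}. ennreal (v (z + Z s \<omega>)) * exp_neg_enn (clock v z s \<omega>) \<partial>lborel) + exp_neg_enn (clock v z r \<omega>) = 1"
          unfolding clock_def by (intro nn_integral_discount v0 r) measurable
        then show ?thesis by (simp add: F_def mult.commute add.commute)
      qed
      have "(\<integral>\<^sup>+ r\<in>{0..}. ?D r \<omega> \<partial>lborel)
       + (\<integral>\<^sup>+ r\<in>{0..}. ?Q r \<omega> \<partial>lborel)
       = (\<integral>\<^sup>+ r. ?D r \<omega> * indicator {0..} r
       + ?Q r \<omega> * indicator {0..} r \<partial>lborel)"
        by (rule nn_integral_add[symmetric]) measurable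
      also have "\<dots> = (\<integral>\<^sup>+ t\<in>{0..}. ?f t \<omega> \<partial>lborel)"
      proof (rule nn_integral_cong)
        fix r
        show "?D r \<omega> * indicator {0..} r
          + ?Q r \<omega> * indicator {0..} r
          = ?f r \<omega> * indicator {0..} r"
        proof (cases "alive z r \<omega> \<and> r \<ge> 0")
          case True
          then have "f (z + Z r \<omega>) * (exp_neg_enn (clock v z r \<omega>) + (\<integral>\<^sup>+ s\<in>{0..r}. F s \<omega> \<partial>lborel)) = f (z + Z r \<omega>) * 1"
            using one[of r] by simp
          then show ?thesis using True by (simp add: distrib_left mult.commute)
        qed auto
      qed
      finally show ?case .
    qed
  qed
  also have "\<dots> = potential f z" by (rule potential_nested[OF f, symmetric])
  finally show ?thesis .
qed

end

section \<open>The killed expectation\<close>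

context sp_levy begin

text \<open>A real infimum, meaningful on paths that do pass below the level; for
  \<open>z \<ge> 0\<close> these have full measure by \<open>AE_dies\<close>.\<close>

definition death :: "real \<Rightarrow> 'a \<Rightarrow> real" where
  "death z \<omega> = Inf {t. 0 \<le> t \<and> z + Z t \<omega> < 0}"

text \<open>Nothing is claimed at \<open>t = death z \<omega>\<close> itself, where the path may or
  may not be below the level; a single time is null in the later integrals.\<close>

lemma death:
  assumes "\<not> alive z u \<omega>"
  shows "0 \<le> death z \<omega>" and "t < death z \<omega> \<Longrightarrow> alive z t \<omega>" and "death z \<omega> < t \<Longrightarrow> \<not> alive z t \<omega>"
    and "\<exists>t\<ge>0. z + Z t \<omega> < 0"
proof -
  define S where "S = {t. 0 \<le> t \<and> z + Z t \<omega> < 0}"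
  obtain r where "r \<in> {0..u}" "z + Z r \<omega> < 0" using assms by (auto simp: stay_def not_le)
  then have "r \<in> S" by (simp add: S_def)
  then have S: "S \<noteq> {}" by auto
  have bdd: "bdd_below S" by (rule bdd_belowI[of _ 0]) (simp add: S_def)
  have d: "death z \<omega> = Inf S" by (simp add: death_def S_def)
  show "0 \<le> death z \<omega>" unfolding d by (rule cInf_greatest[OF S]) (simp add: S_def)
  show "alive z t \<omega>" if "t < death z \<omega>"
    unfolding stay_def
  proof (intro ballI, rule ccontr)
    fix r assume "r \<in> {0..t}" "\<not> 0 \<le> z + Z (0 + r) \<omega>"
    then have "r \<in> S" "r \<le> t" by (auto simp: S_def)
    then show False using cInf_lower[OF _ bdd, of r] that d by linarith
  qed
  show "\<not> alive z t \<omega>" if dt: "death z \<omega> < t"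
  proof -
    obtain r where "r \<in> S" "r < t" using dt cInf_less_iff[OF S bdd] by (auto simp: d)
    then show ?thesis unfolding stay_def S_def by (auto simp: not_le intro!: bexI[of _ r])
  qed
  show "\<exists>t\<ge>0. z + Z t \<omega> < 0" using S by (auto simp: S_def)
qed

text \<open>Pathwise, the mass killed at rate \<open>v\<close> before death and the discount at
  death add up to 1, by \<open>nn_integral_discount\<close> at time
  \<open>death z \<omega>\<close>.\<close>

lemma killed_potential_death:
  assumes v[measurable]: "v \<in> borel_measurable borel" and v0: "\<And>y. 0 \<le> v y" and z: "z \<ge> 0"
    and fin: "potential (\<lambda>y. ennreal (v y)) z < \<infinity>"
  shows "killed_potential v (\<lambda>y. ennreal (v y)) z + (\<integral>\<^sup>+ \<omega>. exp_neg_enn (clock v z (death z \<omega>) \<omega>) \<partial>M) = 1"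
proof -
  let ?g = "\<lambda>\<omega>. exp_neg_enn (clock v z (death z \<omega>) \<omega>)"
  define I where "I \<omega> = (\<integral>\<^sup>+ t\<in>{0..}. (if alive z t \<omega> then exp_neg_enn (clock v z t \<omega>) * ennreal (v (z + Z t \<omega>)) else 0) \<partial>lborel)" for \<omega>
  have [measurable]: "I \<in> borel_measurable M" unfolding I_def by measurable
  have ae: "AE \<omega> in M. I \<omega> + ?g \<omega> = 1"
    using AE_clock_finite[OF v fin] AE_dies[OF z] AE_space
  proof eventually_elim
    case (elim \<omega>)
    note [measurable] = elim(3)
    obtain n where n: "\<not> alive z (real n) \<omega>" using elim(2) by blast
    note d = death[OF n]
    have near: "AE t in lborel. t \<noteq> death z \<omega>" by (rule AE_lborel_singleton)
    have "I \<omega> = (\<integral>\<^sup>+ t\<in>{0..death z \<omega>}. ennreal (v (z + Z t \<omega>)) * exp_neg_enn (clock v z t \<omega>) \<partial>lborel)"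
      unfolding I_def
    proof (rule nn_integral_cong_AE)
      show "AE t in lborel. (if alive z t \<omega> then exp_neg_enn (clock v z t \<omega>) * ennreal (v (z + Z t \<omega>)) else 0) * indicator {0..} t
        = ennreal (v (z + Z t \<omega>)) * exp_neg_enn (clock v z t \<omega>) * indicator {0..death z \<omega>} t"
        using near
      proof eventually_elim
        case (elim t)
        then show ?case using d(2,3)[of t] by (auto simp: indicator_def mult.commute)
      qed
    qed
    moreover have "clock v z (death z \<omega>) \<omega> < \<infinity>"
    proof -
      have "clock v z (death z \<omega>) \<omega> \<le> (\<integral>\<^sup>+ t\<in>{0..}. (if alive z t \<omega> then ennreal (v (z + Z t \<omega>)) else 0) \<partial>lborel)"
        unfolding clock_def
      proof (rule nn_integral_mono_AE)
        show "AE t in lborel. ennreal (v (z + Z t \<omega>)) * indicator {0..death z \<omega>} t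
          \<le> (if alive z t \<omega> then ennreal (v (z + Z t \<omega>)) else 0) * indicator {0..} t"
          using near by eventually_elim (auto simp: indicator_def d(2))
      qed
      also note elim(1)
      finally show ?thesis .
    qed
    then have "(\<integral>\<^sup>+ t\<in>{0..death z \<omega>}. ennreal (v (z + Z t \<omega>)) * exp_neg_enn (clock v z t \<omega>) \<partial>lborel)
        + ?g \<omega> = 1"
      unfolding clock_def by (intro nn_integral_discount v0 d(1)) measurable
    ultimately show ?case by simp
  qed
  \<comment> \<open>The discount at death is replaced by the measurable \<open>1 - I\<close>;
    additivity of the integral then applies without a measurability proof for
    \<open>death z\<close>.\<close>
  have ae': "AE \<omega> in M. ?g \<omega> = 1 - I \<omega> \<and> I \<omega> \<le> 1"
    using ae
  proof eventually_elim
    case (elim \<omega>)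
    then have le: "I \<omega> \<le> 1" by (metis le_iff_add)
    then have "I \<omega> \<noteq> \<top>" by (auto simp: top_unique)
    then show ?case using elim le by (metis ennreal_add_diff_cancel_left)
  qed
  have "killed_potential v (\<lambda>y. ennreal (v y)) z + (\<integral>\<^sup>+ \<omega>. ?g \<omega> \<partial>M)
    = (\<integral>\<^sup>+ \<omega>. I \<omega> \<partial>M) + (\<integral>\<^sup>+ \<omega>. 1 - I \<omega> \<partial>M)"
    unfolding killed_potential_def I_def[symmetric]
    using ae' by (intro arg_cong2[where f = "(+)"] refl nn_integral_cong_AE) (auto elim: eventually_mono)
  also have "\<dots> = (\<integral>\<^sup>+ \<omega>. I \<omega> + (1 - I \<omega>) \<partial>M)"
    by (rule nn_integral_add[symmetric]) measurable
  also have "\<dots> = (\<integral>\<^sup>+ \<omega>. 1 \<partial>M)"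
    using ae' by (intro nn_integral_cong_AE) (auto elim!: eventually_mono)
  also have "\<dots> = 1" by (simp add: emeasure_space_1)
  finally show ?thesis .
qed

lemma killed_potential_cong:
  assumes "\<And>y. y \<ge> 0 \<Longrightarrow> f y = g y"
  shows "killed_potential v f z = killed_potential v g z"
  unfolding killed_potential_def
  by (intro nn_integral_cong) (auto simp: indicator_def alive_nonneg assms)

text \<open>With \<open>U\<close> the potential and \<open>V\<close> the killed potential, the resolvent identity for \<open>f = v h\<close> gives
  \<open>H * V v = U (v h) = H - h\<close>, while \<open>V v = 1 - E exp (- clock)\<close>.\<close>

lemma expectation_exp_neg_clock:
  assumes v[measurable]: "v \<in> borel_measurable borel" and v0: "\<And>y. 0 \<le> v y" and z: "z \<ge> 0"
    and h[measurable]: "h \<in> borel_measurable borel" and h1: "\<And>y. 1 \<le> h y" and H: "H < \<infinity>"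
    and eq: "\<And>y. y \<ge> 0 \<Longrightarrow> h y + potential (\<lambda>y. ennreal (v y) * h y) y = H"
  shows "(\<integral>\<^sup>+ \<omega>. exp_neg_enn (clock v z (death z \<omega>) \<omega>) \<partial>M) = h z / H"
proof -
  define f where "f y = ennreal (v y) * h y" for y
  have [measurable]: "f \<in> borel_measurable borel" unfolding f_def by measurable
  note eq' = eq[folded f_def]
  let ?G = "\<integral>\<^sup>+ \<omega>. exp_neg_enn (clock v z (death z \<omega>) \<omega>) \<partial>M"
  \<comment> \<open>Since \<open>1 \<le> h\<close>, the potential of \<open>v\<close> is dominated
    by that of \<open>f\<close>, which is at most \<open>H\<close>. This is the finiteness required
    by the resolvent identity.\<close>
  have "potential (\<lambda>y. ennreal (v y)) z \<le> potential f z"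
    unfolding potential_def kernel_def
  proof (intro nn_integral_mono mult_right_mono)
    fix t \<omega>
    have "ennreal (v y) \<le> f y" for y
      using mult_left_mono[OF h1[of y], of "ennreal (v y)"] by (simp add: f_def)
    then show "(if alive z t \<omega> then ennreal (v (z + Z t \<omega>)) else 0) \<le> (if alive z t \<omega> then f (z + Z t \<omega>) else 0)" by simp
  qed simp
  also have "\<dots> \<le> H" using eq'[OF z] by (metis le_iff_add add.commute)
  finally have fin: "potential (\<lambda>y. ennreal (v y)) z < \<infinity>" using H by (rule le_less_trans)
  have "potential f z = killed_potential v f z + killed_potential v (\<lambda>y. ennreal (v y) * potential f y) z"
    by (rule resolvent_identity[OF v v0 _ fin, symmetric]) measurable
  also have "\<dots> = killed_potential v (\<lambda>y. f y + ennreal (v y) * potential f y) z"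
    unfolding killed_potential_def
    by (subst nn_integral_add[symmetric], measurable, intro nn_integral_cong, subst nn_integral_add[symmetric])
      (auto intro!: nn_integral_cong simp: distrib_left indicator_def)
  also have "\<dots> = killed_potential v (\<lambda>y. H * ennreal (v y)) z"
  proof (rule killed_potential_cong)
    fix y :: real assume "y \<ge> 0"
    have "f y + ennreal (v y) * potential f y = ennreal (v y) * (h y + potential f y)"
      by (simp only: f_def[of y] distrib_left)
    then show "f y + ennreal (v y) * potential f y = H * ennreal (v y)"
      by (simp only: eq'[OF \<open>y \<ge> 0\<close>] mult.commute)
  qed
  also have "\<dots> = H * killed_potential v (\<lambda>y. ennreal (v y)) z"
    unfolding killed_potential_def
    by (subst nn_integral_cmult[symmetric], measurable, intro nn_integral_cong, subst nn_integral_cmult[symmetric])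
      (auto intro!: nn_integral_cong simp: mult_ac)
  finally have U: "potential f z = H * killed_potential v (\<lambda>y. ennreal (v y)) z" .
  \<comment> \<open>Adding \<open>potential f z\<close> to both sides leaves a finite term to
    cancel.\<close>
  have "potential f z + H * ?G = H * (killed_potential v (\<lambda>y. ennreal (v y)) z + ?G)"
    by (simp add: U distrib_left)
  also have "\<dots> = H" using killed_potential_death[OF v v0 z fin] by simp
  also have "\<dots> = potential f z + h z" using eq'[OF z] by (simp add: add.commute)
  finally have "H * ?G = h z"
    unfolding ennreal_add_left_cancel using \<open>potential f z \<le> H\<close> H by (auto simp: top_unique)
  moreover have "H \<noteq> 0" using eq'[OF z] h1[of z] by (auto simp: add_eq_0_iff_both_eq_0)
  ultimately show ?thesis using H by (metis ennreal_mult_divide_eq infinity_ennreal_def less_irrefl mult.commute)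
qed

end

section \<open>Proof of the theorem\<close>

text \<open>Independence is an equation between the joint law and the product of the marginal laws,
  all of which ignore null sets. A finite index set keeps the union of the exceptional sets
  null.\<close>

lemma (in prob_space) indep_vars_cong_AE:
  assumes ind: "indep_vars (\<lambda>_. N) X I" and I: "finite I"
    and Y: "\<And>i. i \<in> I \<Longrightarrow> random_variable N (Y i)" and ae: "\<And>i. i \<in> I \<Longrightarrow> AE \<omega> in M. X i \<omega> = Y i \<omega>"
  shows "indep_vars (\<lambda>_. N) Y I"
proof (cases "I = {}")
  case True
  then show ?thesis by (simp add: indep_vars_def indep_sets_def)
next
  case False
  have X: "\<And>i. i \<in> I \<Longrightarrow> random_variable N (X i)" using ind by (simp add: indep_vars_def)
  have allI: "AE \<omega> in M. \<forall>i\<in>I. X i \<omega> = Y i \<omega>" using ae I by (simp add: AE_finite_all)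
  have "distr M (PiM I (\<lambda>_. N)) (\<lambda>x. \<lambda>i\<in>I. Y i x) = distr M (PiM I (\<lambda>_. N)) (\<lambda>x. \<lambda>i\<in>I. X i x)"
    using allI by (intro distr_cong_AE refl measurable_restrict X Y) (auto elim!: eventually_mono)
  also have "\<dots> = PiM I (\<lambda>i. distr M N (X i))"
    using ind by (subst (asm) indep_vars_iff_distr_eq_PiM'[OF False X]) auto
  also have "\<dots> = PiM I (\<lambda>i. distr M N (Y i))"
    by (intro PiM_cong refl distr_cong_AE X Y ae)
  finally show ?thesis by (subst indep_vars_iff_distr_eq_PiM'[OF False Y]) auto
qed

text \<open>Paths in a measurable null set containing all failures of right-continuity are replaced
  by 0, as are negative times. Laws and independence of increments survive because the two versions
  agree almost surely at all \<open>t \<ge> 0\<close> simultaneously.\<close>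

lemma levy_process_regular_version:
  assumes L: "levy_process M Z"
  obtains Z' where "rc_levy M Z'" and "AE \<omega> in M. \<forall>t\<ge>0. Z' t \<omega> = Z t \<omega>"
proof -
  interpret prob_space M using L by (simp add: levy_process_def)
  have Zm: "t \<ge> 0 \<Longrightarrow> Z t \<in> borel_measurable M" for t using L by (simp add: levy_process_def)
  have Z0: "\<omega> \<in> space M \<Longrightarrow> Z 0 \<omega> = 0" for \<omega> using L by (simp add: levy_process_def)
  have "AE \<omega> in M. \<forall>t\<ge>0. continuous (at_right t) (\<lambda>s. Z s \<omega>)"
    using L unfolding levy_process_def by (auto elim: eventually_mono)
  then obtain N where N: "N \<in> null_sets M" "{\<omega> \<in> space M. \<not> (\<forall>t\<ge>0. continuous (at_right t) (\<lambda>s. Z s \<omega>))} \<subseteq> N"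
    by (auto simp: eventually_ae_filter)
  have [measurable]: "N \<in> sets M" using N by auto
  define Z' where "Z' t \<omega> = (if \<omega> \<notin> N \<and> 0 \<le> t then Z t \<omega> else 0)" for t \<omega>
  have Z'm[measurable]: "Z' t \<in> borel_measurable M" for t
  proof (cases "t \<ge> 0")
    case True
    note [measurable] = Zm[OF True]
    show ?thesis unfolding Z'_def by measurable
  next
    case False
    then have "Z' t = (\<lambda>_. 0)" by (simp add: Z'_def fun_eq_iff)
    then show ?thesis by simp
  qed
  have ae: "AE \<omega> in M. \<forall>t\<ge>0. Z' t \<omega> = Z t \<omega>"
    using AE_not_in[OF N(1)] by eventually_elim (simp add: Z'_def)
  have "rc_levy M Z'"
  proof (unfold_locales)
    show "random_variable borel (Z' t)" for t by (rule Z'm)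
    show "Z' 0 \<omega> = 0" if "\<omega> \<in> space M" for \<omega> using Z0[OF that] by (simp add: Z'_def)
    show "Z' t \<omega> = 0" if "t < 0" for t \<omega> using that by (simp add: Z'_def)
    show "continuous (at_right t) (\<lambda>s. Z' s \<omega>)" if "\<omega> \<in> space M" "0 \<le> t" for t \<omega>
    proof (cases "\<omega> \<in> N")
      case False
      then have "continuous (at_right t) (\<lambda>s. Z s \<omega>)" using that N(2) by auto
      then have "((\<lambda>s. Z s \<omega>) \<longlongrightarrow> Z t \<omega>) (at_right t)" by (simp add: continuous_within)
      moreover have "eventually (\<lambda>s. Z s \<omega> = Z' s \<omega>) (at_right t)"
        using that False by (auto simp: eventually_at_right_field Z'_def intro!: exI[of _ "t + 1"])
      ultimately have "((\<lambda>s. Z' s \<omega>) \<longlongrightarrow> Z t \<omega>) (at_right t)" by (rule Lim_transform_eventually)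
      then show ?thesis using False that by (simp add: continuous_within Z'_def)
    qed (simp add: Z'_def)
    show "indep_vars (\<lambda>_. borel) (\<lambda>i \<omega>. Z' (t (Suc i)) \<omega> - Z' (t i) \<omega>) {..<n}"
      if t: "0 \<le> t 0" "\<And>i. i < n \<Longrightarrow> t i \<le> t (Suc i)" for n :: nat and t
    proof (rule indep_vars_cong_AE)
      show "indep_vars (\<lambda>_. borel) (\<lambda>i \<omega>. Z (t (Suc i)) \<omega> - Z (t i) \<omega>) {..<n}"
        using L t by (auto simp: levy_process_def)
      \<comment> \<open>Agreement of the versions is known at nonnegative times, so all time points
        have to be located there.\<close>
      have t0: "0 \<le> t i" if "i \<le> n" for i
        using that by (induction i) (use t in \<open>auto intro: order_trans\<close>)
      show "AE \<omega> in M. Z (t (Suc i)) \<omega> - Z (t i) \<omega> = Z' (t (Suc i)) \<omega> - Z' (t i) \<omega>" if "i \<in> {..<n}" for i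
        using ae by eventually_elim (use t0[of i] t0[of "Suc i"] that in auto)
    qed auto
    show "distr M borel (\<lambda>\<omega>. Z' (s + t) \<omega> - Z' s \<omega>) = distr M borel (Z' t)" if st: "0 \<le> s" "0 \<le> t" for s t
    proof -
      note [measurable] = Zm[OF st(1)] Zm[OF st(2)] Zm[of "s + t"]
      have "distr M borel (\<lambda>\<omega>. Z' (s + t) \<omega> - Z' s \<omega>) = distr M borel (\<lambda>\<omega>. Z (s + t) \<omega> - Z s \<omega>)"
        by (rule distr_cong_AE) (use ae st in \<open>auto elim!: eventually_mono\<close>)
      also have "\<dots> = distr M borel (Z t)" using L st by (simp add: levy_process_def)
      also have "\<dots> = distr M borel (Z' t)"
        by (rule distr_cong_AE) (use ae st in \<open>auto elim!: eventually_mono\<close>)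
      finally show ?thesis .
    qed
  qed
  then show ?thesis using ae by (rule that)
qed

section \<open>The series of iterated integrals and its renewal equation\<close>

lemma Wom_measurable[measurable]:
  assumes [measurable]: "W \<in> borel_measurable borel" "w \<in> borel_measurable borel"
  shows "Wom W w n \<in> borel_measurable borel"
proof (induction n)
  case 0
  have "Wom W w 0 = (\<lambda>_. 1)" by auto
  then show ?case by simp
next
  case (Suc n)
  note [measurable] = Suc
  have "Wom W w (Suc n) = (\<lambda>x. \<integral>\<^sup>+ z. indicator {x..} z * ennreal (W (z - x) * w z) * Wom W w n z \<partial>lborel)"
    by auto
  then show ?case by simp
qed

text \<open>Centring at \<open>b\<close> by \<open>t = b + u\<close> leaves the kernel
  \<open>W (u - y)\<close>, which absorbs the indicator as \<open>W\<close> vanishes on the negative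
  axis. Inside \<open>ennreal\<close> negative numbers become 0, so \<open>max 0\<close> changes no
  integral and gives a rate that is nonnegative everywhere.\<close>

lemma Wom_Suc_shift:
  assumes [measurable]: "W \<in> borel_measurable borel" "w \<in> borel_measurable borel"
    and W0: "\<And>y. W y \<ge> 0" and Wneg: "\<And>y. y < 0 \<Longrightarrow> W y = 0"
  shows "Wom W w (Suc n) (b + y) = (\<integral>\<^sup>+ u. ennreal (W (u - y)) * (ennreal (max 0 (w (b + u))) * Wom W w n (b + u)) \<partial>lborel)"
proof -
  have "Wom W w (Suc n) (b + y)
    = (\<integral>\<^sup>+ t. indicator {b + y..} t * ennreal (W (t - (b + y)) * w t) * Wom W w n t \<partial>lborel)"
    by simp
  also have "\<dots> = ennreal \<bar>1\<bar> * (\<integral>\<^sup>+ u. indicator {b + y..} (b + 1 * u) * ennreal (W ((b + 1 * u) - (b + y)) * w (b + 1 * u)) * Wom W w n (b + 1 * u) \<partial>lborel)"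
    by (rule nn_integral_real_affine) auto
  also have "\<dots> = (\<integral>\<^sup>+ u. ennreal (W (u - y)) * (ennreal (max 0 (w (b + u))) * Wom W w n (b + u)) \<partial>lborel)"
  proof -
    have "indicator {b + y..} (b + 1 * u) * ennreal (W ((b + 1 * u) - (b + y)) * w (b + 1 * u)) * Wom W w n (b + 1 * u)
      = ennreal (W (u - y)) * (ennreal (max 0 (w (b + u))) * Wom W w n (b + u))" for u
    proof (cases "u \<ge> y")
      case True
      have "ennreal (W (u - y) * w (b + u)) = ennreal (W (u - y)) * ennreal (w (b + u))"
        by (rule ennreal_mult'[OF W0])
      moreover have "ennreal (max 0 (w (b + u))) = ennreal (w (b + u))"
        by (cases "w (b + u) \<ge> 0") (auto simp: ennreal_neg max_def)
      ultimately show ?thesis using True by (simp add: mult.assoc)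
    qed (simp add: Wneg)
    then show ?thesis by simp
  qed
  finally show ?thesis .
qed

text \<open>On a path that dies the extended infimum is the real number
  \<open>death (x - b) \<omega>\<close>. The half-open interval of the functional and the closed
  interval of the clock differ by one point.\<close>

lemma killed_functional_eq:
  assumes sp: "sp_levy M Z' \<psi>" and eq: "\<And>t. t \<ge> 0 \<Longrightarrow> Z' t \<omega> = Z t \<omega>"
    and dies: "\<not> rc_levy.stay Z' (x - b) 0 u \<omega>"
  shows "killed_functional Z w x b \<omega>
    = exp_neg_enn (rc_levy.clock Z' (\<lambda>y. max 0 (w (b + y))) (x - b) (sp_levy.death Z' (x - b) \<omega>) \<omega>)"
proof -
  interpret sp_levy M Z' \<psi> by fact
  define S where "S = {t. 0 \<le> t \<and> x + Z t \<omega> < b}"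
  have S: "S = {t. 0 \<le> t \<and> (x - b) + Z' t \<omega> < 0}" using eq by (auto simp: S_def)
  have dS: "death (x - b) \<omega> = Inf S" unfolding S death_def ..
  have Sne: "S \<noteq> {}" using death(4)[OF dies] by (auto simp: S)
  have tau: "tau_below Z x b \<omega> = ereal (death (x - b) \<omega>)"
    unfolding tau_below_def S_def[symmetric] dS
    by (rule ereal_Inf'[symmetric, OF bdd_belowI[of _ 0] Sne]) (simp add: S_def)
  have "(\<integral>\<^sup>+ s\<in>{0..<death (x - b) \<omega>}. ennreal (w (x + Z s \<omega>)) \<partial>lborel) = clock (\<lambda>y. max 0 (w (b + y))) (x - b) (death (x - b) \<omega>) \<omega>"
    unfolding clock_def
  proof (rule nn_integral_cong_AE)
    have "ennreal (max 0 c) = ennreal c" for c by (cases "c \<ge> 0") (auto simp: ennreal_neg max_def)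
    then show "AE s in lborel. ennreal (w (x + Z s \<omega>)) * indicator {0..<death (x - b) \<omega>} s
      = ennreal (max 0 (w (b + (x - b + Z' s \<omega>)))) * indicator {0..death (x - b) \<omega>} s"
      using AE_lborel_singleton[of "death (x - b) \<omega>"] eq
      by (auto elim!: eventually_mono simp: indicator_def add.assoc)
  qed
  then show ?thesis by (simp add: killed_functional_def tau)
qed

theorem theorem2p7:
  fixes M :: "'a measure" and Z :: "real \<Rightarrow> 'a \<Rightarrow> real"
    and \<gamma> \<sigma> :: real and \<pi> :: "real measure"
    and W w :: "real \<Rightarrow> real" and b x :: real
  assumes "\<gamma> \<ge> 0" and "\<sigma> \<ge> 0"
    and "sets \<pi> = sets borel" and "emeasure \<pi> {..0} = 0"
    and "(\<integral>\<^sup>+ z. ennreal (min z (z\<^sup>2)) \<partial>\<pi>) < \<infinity>"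
    and "levy_process M Z"
    and "\<forall>l\<ge>0. (\<integral>\<^sup>+ \<omega>. ennreal (exp (- l * Z 1 \<omega>)) \<partial>M) = ennreal (exp (Psi \<gamma> \<sigma> \<pi> l))"
    and "scale_function (Psi \<gamma> \<sigma> \<pi>) W"
    and "w \<in> borel_measurable borel"
    and "\<forall>z>0. w z \<ge> 0"
    and "\<forall>K. compact K \<and> K \<subseteq> {0<..} \<longrightarrow> bounded (w ` K)"
    and "b \<ge> 0"
    and "(\<Sum>n. Wom W w n b) < \<infinity>"
    and "x \<ge> b"
  shows "(\<integral>\<^sup>+ \<omega>. killed_functional Z w x b \<omega> \<partial>M)
           = (\<Sum>n. Wom W w n x) / (\<Sum>n. Wom W w n b)"
proof -
  let ?\<psi> = "Psi \<gamma> \<sigma> \<pi>"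
  note Psi_props = Psi_nonneg_and_quadratic_bound[OF assms(1,3,4,5)]
  have psi0: "?\<psi> q \<ge> 0" if "q > 0" for q using Psi_props(1) that by simp
  note sf = assms(8)
  have [measurable]: "W \<in> borel_measurable borel" by (rule scale_function_measurable[OF sf])
  have W0: "W y \<ge> 0" for y by (rule scale_function_nonneg[OF sf psi0])
  have Wneg: "W y = 0" if "y < 0" for y using sf that by (simp add: scale_function_def)
  note [measurable] = assms(9)
  obtain Z' where Z': "rc_levy M Z'" and ae: "AE \<omega> in M. \<forall>t\<ge>0. Z' t \<omega> = Z t \<omega>"
    using levy_process_regular_version[OF assms(6)] by blast
  interpret rc_levy M Z' by (rule Z')
  have sp: "sp_levy M Z' ?\<psi>"
  proof (unfold_locales)
    fix l :: real assume l: "l \<ge> 0"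
    have "(\<integral>\<^sup>+ \<omega>. ennreal (exp (- l * Z' 1 \<omega>)) \<partial>M) = (\<integral>\<^sup>+ \<omega>. ennreal (exp (- l * Z 1 \<omega>)) \<partial>M)"
      by (rule nn_integral_cong_AE) (use ae in eventually_elim, simp)
    then show "(\<integral>\<^sup>+ \<omega>. ennreal (exp (- l * Z' 1 \<omega>)) \<partial>M) = ennreal (exp (?\<psi> l))"
      using assms(7) l by simp
  next
    show "\<exists>C>0. \<forall>r\<ge>1. ?\<psi> r \<le> C * r\<^sup>2" by (rule Psi_props(2))
  qed (rule scale_function_laplace(2)[OF sf psi0])
  interpret sp_levy M Z' ?\<psi> by (rule sp)
  define z where "z = x - b"
  have z: "z \<ge> 0" using assms(14) by (simp add: z_def)
  define v where "v y = max 0 (w (b + y))" for y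
  have v[measurable]: "v \<in> borel_measurable borel" unfolding v_def by measurable
  define h where "h y = (\<Sum>n. Wom W w n (b + y))" for y
  have h[measurable]: "h \<in> borel_measurable borel" unfolding h_def by measurable
  \<comment> \<open>Renewal equation: exchanging sum and integral in the recursion reproduces the
    series itself.\<close>
  have ren: "h y = 1 + (\<integral>\<^sup>+ u. ennreal (W (u - y)) * (ennreal (v u) * h u) \<partial>lborel)" for y
  proof -
    have "h y = Wom W w 0 (b + y) + (\<Sum>n. Wom W w (Suc n) (b + y))"
      unfolding h_def by (subst suminf_offset[of _ 1]) (auto intro: summableI)
    also have "(\<Sum>n. Wom W w (Suc n) (b + y))
      = (\<Sum>n. \<integral>\<^sup>+ u. ennreal (W (u - y)) * (ennreal (v u) * Wom W w n (b + u)) \<partial>lborel)"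
      unfolding v_def by (intro suminf_cong Wom_Suc_shift W0 Wneg) measurable
    also have "\<dots> = (\<integral>\<^sup>+ u. (\<Sum>n. ennreal (W (u - y)) * (ennreal (v u) * Wom W w n (b + u))) \<partial>lborel)"
      by (rule nn_integral_suminf[symmetric]) measurable
    also have "\<dots> = (\<integral>\<^sup>+ u. ennreal (W (u - y)) * (ennreal (v u) * h u) \<partial>lborel)"
      by (simp add: h_def ennreal_suminf_cmult)
    finally show ?thesis by simp
  qed
  \<comment> \<open>The kernel \<open>W (u - y)\<close> of the renewal equation and the potential
    density \<open>W u - W (u - y)\<close> add up to \<open>W u\<close>, free of \<open>y\<close>;
    what remains is the renewal equation at 0.\<close>
  have "h y + potential (\<lambda>y. ennreal (v y) * h y) y = h 0" if y: "y \<ge> 0" for y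
  proof -
    have incr: "W u - W (u - y) \<ge> 0" for u
    proof (cases "u - y < 0")
      case False
      then have "W (u - y) \<le> W u"
        using sf y strict_mono_on_leD[of "{0..}" W "u - y" u] by (auto simp: scale_function_def)
      then show ?thesis by simp
    qed (simp add: Wneg W0)
    have pd: "potential (\<lambda>y. ennreal (v y) * h y) y
      = (\<integral>\<^sup>+ u. ennreal (W u - W (u - y)) * (ennreal (v u) * h u) \<partial>lborel)"
      by (rule potential_density[OF sf y]) measurable
    have "h y + potential (\<lambda>y. ennreal (v y) * h y) y
      = 1 + ((\<integral>\<^sup>+ u. ennreal (W (u - y)) * (ennreal (v u) * h u) \<partial>lborel)
        + (\<integral>\<^sup>+ u. ennreal (W u - W (u - y)) * (ennreal (v u) * h u) \<partial>lborel))"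
      unfolding pd by (subst ren[of y]) (simp only: add.assoc)
    also have "\<dots> = 1 + (\<integral>\<^sup>+ u. ennreal (W (u - y)) * (ennreal (v u) * h u)
        + ennreal (W u - W (u - y)) * (ennreal (v u) * h u) \<partial>lborel)"
      by (subst nn_integral_add) auto
    also have "\<dots> = 1 + (\<integral>\<^sup>+ u. ennreal (W u) * (ennreal (v u) * h u) \<partial>lborel)"
    proof -
      have "ennreal (W (u - y)) + ennreal (W u - W (u - y)) = ennreal (W u)" for u
        using incr W0 by (subst ennreal_plus[symmetric]) auto
      then show ?thesis by (simp add: distrib_right[symmetric])
    qed
    also have "\<dots> = h 0" using ren[of 0] by simp
    finally show ?thesis .
  qed
  moreover have "1 \<le> h y" for y by (subst ren) simp
  moreover have "h 0 < \<infinity>" using assms(13) by (simp add: h_def)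
  ultimately have main: "(\<integral>\<^sup>+ \<omega>. exp_neg_enn (clock v z (death z \<omega>) \<omega>) \<partial>M) = h z / h 0"
    by (intro expectation_exp_neg_clock v h z) (auto simp: v_def)
  have "(\<integral>\<^sup>+ \<omega>. killed_functional Z w x b \<omega> \<partial>M) = (\<integral>\<^sup>+ \<omega>. exp_neg_enn (clock v z (death z \<omega>) \<omega>) \<partial>M)"
  proof (rule nn_integral_cong_AE)
    show "AE \<omega> in M. killed_functional Z w x b \<omega> = exp_neg_enn (clock v z (death z \<omega>) \<omega>)"
      using ae AE_dies[OF z]
    proof eventually_elim
      case (elim \<omega>)
      then obtain n where "\<not> stay (x - b) 0 (real n) \<omega>" by (auto simp: z_def)
      from killed_functional_eq[OF sp _ this] elim(1)
      show ?case by (simp add: z_def v_def[abs_def])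
    qed
  qed
  then show ?thesis using main by (simp add: h_def z_def)
qed

end
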